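(* Let $n\ge2$ and $x\in\mathbb{N}^n$, and let $X^n$ be the crystal process started at $x$. Let $v^2=\frac{2\beta_0\beta_1}{\beta_0+\beta_1}$ and $v^{2,\infty}=\frac{2\beta_1\beta_2}{\beta_1+\beta_2}$. (i) If $\beta_2<\beta_0\le\beta_1$, then $t^{-1}X^n_t$ converges $\mathbb{P}_x$-a.s. as $t\to\infty$ and its limit belongs a.s. to $\mathcal E_1$, the set of $n$-tuples of the form $(a_1,\beta_2,a_2,\beta_2,\dots,a_{k-1},\beta_2,a_k)$ with $k\ge1$ and each block $a_i$ equal to $(\beta_0)$ or $(v^2,v^2)$. (ii) If $\beta_2<\beta_1<\beta_0$, then $t^{-1}X^n_t$ converges $\mathbb{P}_x$-a.s. and its limit belongs a.s. to $\mathcal E_2$, the set of $n$-tuples $(\beta_{i_1},\dots,\beta_{i_n})$ with $i_j\in\{0,1,2\}$, $i_j\ne i_{j+1}$ for $1\le j\le n-1$, and $i_1\ne2$, $i_n\ne2$. (iii) If $\beta_1\le\beta_2<\beta_0$, then $t^{-1}X^n_t$ converges $\mathbb{P}_x$-a.s. and its limit belongs a.s. to $\mathcal E_3$, the set of $n$-tuples of the form $(e_L,\beta_0,a_1,\beta_0,a_2,\dots,a_{k-1},\beta_0,a_k,\beta_0,e_R)$ with $k\ge0$ (for $k=0$ the tuple is $(e_L,\beta_0,e_R)$), each block $a_i$ equal to $(\beta_2)$ or $(v^{2,\infty},v^{2,\infty})$, and each of $e_L,e_R$ equal to $(\beta_1)$ or the empty tuple.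
   Context: Fix $n\ge2$ and $\beta=(\beta_0,\beta_1,\beta_2)\in(0,\infty)^3$. For $x\in\mathbb{N}^n$, with the zero boundary convention $x(0)=x(n+1)=0$, let $V_j(x)=\mathbf 1_{\{x(j-1)>x(j)\}}+\mathbf 1_{\{x(j+1)>x(j)\}}\in\{0,1,2\}$. The crystal process $X^n$ is the continuous-time Markov chain on $\mathbb{N}^n$ jumping from $x$ to $x+e_j$ at rate $\beta_{V_j(x)}$ ($j=1,\dots,n$) with no other transitions; $\mathbb{P}_x$ is its law from $x$. $t^{-1}X^n_t$ denotes the vector $(t^{-1}X^n_t(1),\dots,t^{-1}X^n_t(n))$, and tuples are concatenated blockwise. *)

theory Defs
  imports "HOL-Probability.Probability"
begin

definition beta :: "real \<Rightarrow> real \<Rightarrow> real \<Rightarrow> nat \<Rightarrow> real" where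
  "beta b0 b1 b2 i = (if i = 0 then b0 else if i = 1 then b1 else b2)"

text \<open>A configuration of N^n is a function on sites 1..n; extension by zero boundary.\<close>
definition ext :: "nat \<Rightarrow> (nat \<Rightarrow> nat) \<Rightarrow> nat \<Rightarrow> nat" where
  "ext n x j = (if 1 \<le> j \<and> j \<le> n then x j else 0)"

definition Vn :: "nat \<Rightarrow> (nat \<Rightarrow> nat) \<Rightarrow> nat \<Rightarrow> nat" where
  "Vn n x j = (if ext n x (j - 1) > ext n x j then 1 else 0)
            + (if ext n x (j + 1) > ext n x j then 1 else 0)"

definition rate :: "real \<Rightarrow> real \<Rightarrow> real \<Rightarrow> nat \<Rightarrow> (nat \<Rightarrow> nat) \<Rightarrow> nat \<Rightarrow> real" where
  "rate b0 b1 b2 n x j = beta b0 b1 b2 (Vn n x j)"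

definition total_rate :: "real \<Rightarrow> real \<Rightarrow> real \<Rightarrow> nat \<Rightarrow> (nat \<Rightarrow> nat) \<Rightarrow> real" where
  "total_rate b0 b1 b2 n x = (\<Sum>j=1..n. rate b0 b1 b2 n x j)"

text \<open>Choice of the jumping site from a uniform variable u in [0,1]: site j is chosen
  with probability rate j / total rate.\<close>
definition choose_site :: "real \<Rightarrow> real \<Rightarrow> real \<Rightarrow> nat \<Rightarrow> (nat \<Rightarrow> nat) \<Rightarrow> real \<Rightarrow> nat" where
  "choose_site b0 b1 b2 n x u =
     (if \<exists>j. 1 \<le> j \<and> j \<le> n \<and> u * total_rate b0 b1 b2 n x \<le> (\<Sum>i=1..j. rate b0 b1 b2 n x i)
      then (LEAST j. 1 \<le> j \<and> j \<le> n \<and> u * total_rate b0 b1 b2 n x \<le> (\<Sum>i=1..j. rate b0 b1 b2 n x i))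
      else n)"

primrec jump_chain :: "real \<Rightarrow> real \<Rightarrow> real \<Rightarrow> nat \<Rightarrow> (nat \<Rightarrow> nat) \<Rightarrow> (nat \<Rightarrow> real)
    \<Rightarrow> nat \<Rightarrow> (nat \<Rightarrow> nat)" where
  "jump_chain b0 b1 b2 n x u 0 = x"
| "jump_chain b0 b1 b2 n x u (Suc k) =
     (let y = jump_chain b0 b1 b2 n x u k; j = choose_site b0 b1 b2 n y (u k) in y(j := y j + 1))"

text \<open>Jump times: holding time in state y is e_k / q(y) with e_k ~ Exp(1).\<close>
primrec jump_time :: "real \<Rightarrow> real \<Rightarrow> real \<Rightarrow> nat \<Rightarrow> (nat \<Rightarrow> nat) \<Rightarrow> (nat \<Rightarrow> real)
    \<Rightarrow> (nat \<Rightarrow> real) \<Rightarrow> nat \<Rightarrow> real" where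
  "jump_time b0 b1 b2 n x e u 0 = 0"
| "jump_time b0 b1 b2 n x e u (Suc k) = jump_time b0 b1 b2 n x e u k
     + e k / total_rate b0 b1 b2 n (jump_chain b0 b1 b2 n x u k)"

definition crystal :: "real \<Rightarrow> real \<Rightarrow> real \<Rightarrow> nat \<Rightarrow> (nat \<Rightarrow> nat) \<Rightarrow> (nat \<Rightarrow> real)
    \<Rightarrow> (nat \<Rightarrow> real) \<Rightarrow> real \<Rightarrow> (nat \<Rightarrow> nat)" where
  "crystal b0 b1 b2 n x e u t =
     jump_chain b0 b1 b2 n x u (card {k. 0 < k \<and> jump_time b0 b1 b2 n x e u k \<le> t})"

definition vel :: "real \<Rightarrow> real \<Rightarrow> real" where
  "vel a b = 2 * a * b / (a + b)"

definition E1 :: "real \<Rightarrow> real \<Rightarrow> real \<Rightarrow> nat \<Rightarrow> real list set" where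
  "E1 b0 b1 b2 n = {l. length l = n \<and> (\<exists>a as.
      (let B = {[b0], [vel b0 b1, vel b0 b1]} in a \<in> B \<and> (\<forall>c\<in>set as. c \<in> B)) \<and>
      l = a @ concat (map (\<lambda>c. b2 # c) as))}"

definition E2 :: "real \<Rightarrow> real \<Rightarrow> real \<Rightarrow> nat \<Rightarrow> real list set" where
  "E2 b0 b1 b2 n = {map (beta b0 b1 b2) is | is. length is = n \<and> set is \<subseteq> {0,1,2}
      \<and> (\<forall>j. j + 1 < n \<longrightarrow> is ! j \<noteq> is ! (j + 1)) \<and> hd is \<noteq> 2 \<and> last is \<noteq> 2}"

definition E3 :: "real \<Rightarrow> real \<Rightarrow> real \<Rightarrow> nat \<Rightarrow> real list set" where
  "E3 b0 b1 b2 n = {l. length l = n \<and> (\<exists>eL eR as.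
      eL \<in> {[], [b1]} \<and> eR \<in> {[], [b1]} \<and>
      (\<forall>c\<in>set as. c \<in> {[b2], [vel b1 b2, vel b1 b2]}) \<and>
      l = eL @ [b0] @ concat (map (\<lambda>c. c @ [b0]) as) @ eR)}"

definition converges_into :: "real \<Rightarrow> real \<Rightarrow> real \<Rightarrow> nat \<Rightarrow> (nat \<Rightarrow> nat) \<Rightarrow> (nat \<Rightarrow> real)
    \<Rightarrow> (nat \<Rightarrow> real) \<Rightarrow> real list set \<Rightarrow> bool" where
  "converges_into b0 b1 b2 n x e u E \<longleftrightarrow> (\<exists>l. length l = n \<and> l \<in> E \<and>
     (\<forall>j<n. ((\<lambda>t. real (crystal b0 b1 b2 n x e u t (j + 1)) / t) \<longlongrightarrow> l ! j) at_top))"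

end

theory Submission
  imports Defs "HOL-Library.Discrete_Functions" "HOL-Library.Landau_Symbols"
begin

text \<open>
  Consider the embedded jump chain. If \<open>b2\<close> is the smallest rate, a strict local minimum loses ground to
  its neighbours at a linear rate and hence stays a strict local minimum forever with probability
  bounded below; if \<open>b0\<close> is the largest rate, the same holds for strict local maxima. Therefore the set of
  strict valleys (in case (i)), of strict peaks (in case (iii)), or both (in case (ii)) is almost surely
  eventually constant. A run of too many consecutive unlabelled sites cannot persist: either their rates
  are equal and a recurrent walk of dimension one or two forces a new peak or valley with positive
  probability, or the rates contract the run and Foster's criterion brings it back to a bounded region,
  from which a new peak or valley appears with probability bounded below. In the remaining
  configurations every site has an eventually constant rate or belongs to an isolated pair, and a law of
  large numbers for the compensated jump counts determines the speeds.
\<close>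

subsection \<open>Uniformly elliptic Markov chains\<close>

lemma nonpos_if_contracting:
  fixes g :: "'s \<Rightarrow> real"
  assumes "0 \<le> a" "a < 1" and bounded: "\<And>y. g y \<le> 1"
    and contracting: "\<And>r y. 0 \<le> r \<Longrightarrow> (\<And>z. g z \<le> r) \<Longrightarrow> g y \<le> a * r"
  shows "g y \<le> 0"
proof -
  have "g y \<le> a ^ k" for k y
  proof (induction k arbitrary: y)
    case (Suc k)
    have "g y \<le> a * a ^ k" using assms(1) by (rule contracting[OF zero_le_power Suc])
    then show ?case by simp
  qed (simp add: bounded)
  moreover have "(\<lambda>k. a ^ k) \<longlonglongrightarrow> 0" using assms(1,2) by (intro LIMSEQ_realpow_zero)
  ultimately show ?thesis by (intro LIMSEQ_le_const) auto
qed

text \<open>The chain moves from \<open>y\<close> to \<open>act y i\<close> with probability \<open>p y i\<close>.\<close>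

locale elliptic_chain =
  fixes p :: "'s \<Rightarrow> 'i \<Rightarrow> real" and act :: "'s \<Rightarrow> 'i \<Rightarrow> 's" and I :: "'i set" and c :: real
  assumes finite_labels: "finite I" and c_pos: "0 < c"
    and p_ge: "\<And>y i. i \<in> I \<Longrightarrow> c \<le> p y i" and p_sum: "\<And>y. (\<Sum>i\<in>I. p y i) = 1"
begin

lemma p_nonneg: "i \<in> I \<Longrightarrow> 0 \<le> p y i"
  using p_ge[of i y] c_pos by linarith

lemma p_le_1: "i \<in> I \<Longrightarrow> p y i \<le> 1"
  using member_le_sum[of i I "p y"] p_nonneg finite_labels by (simp add: p_sum)

lemma c_le_1: "c \<le> 1"
proof -
  obtain i where "i \<in> I" using p_sum[of undefined] by fastforce
  then show ?thesis using p_ge[of i undefined] p_le_1[of i undefined] by linarith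
qed

lemma c_power_le_1: "c ^ k \<le> 1"
  using c_pos c_le_1 by (simp add: power_le_one)

definition mean_step :: "('s \<Rightarrow> real) \<Rightarrow> 's \<Rightarrow> real" where
  "mean_step f y = (\<Sum>i\<in>I. p y i * f (act y i))"

lemma mean_step_mono: "(\<And>i. i \<in> I \<Longrightarrow> f (act y i) \<le> g (act y i)) \<Longrightarrow> mean_step f y \<le> mean_step g y"
  unfolding mean_step_def by (intro sum_mono mult_left_mono p_nonneg) auto

lemma mean_step_const [simp]: "mean_step (\<lambda>_. a) y = a"
  unfolding mean_step_def using p_sum by (simp flip: sum_distrib_right)

lemma mean_step_add: "mean_step (\<lambda>z. f z + g z) y = mean_step f y + mean_step g y"
  unfolding mean_step_def by (simp add: algebra_simps sum.distrib)

lemma mean_step_diff: "mean_step (\<lambda>z. f z - g z) y = mean_step f y - mean_step g y"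
  unfolding mean_step_def by (simp add: algebra_simps sum_subtractf)

lemma mean_step_cmult: "mean_step (\<lambda>z. a * f z) y = a * mean_step f y"
  unfolding mean_step_def by (simp add: sum_distrib_left mult_ac)

lemma mean_step_sum: "mean_step (\<lambda>z. \<Sum>e\<in>S. f e z) y = (\<Sum>e\<in>S. mean_step (f e) y)"
  unfolding mean_step_def by (subst sum.swap) (simp add: sum_distrib_left)

lemma mean_step_le: "(\<And>i. i \<in> I \<Longrightarrow> f (act y i) \<le> a) \<Longrightarrow> mean_step f y \<le> a"
  using mean_step_mono[of f y "\<lambda>_. a"] by simp

lemma mean_step_ge: "(\<And>i. i \<in> I \<Longrightarrow> a \<le> f (act y i)) \<Longrightarrow> a \<le> mean_step f y"
  using mean_step_mono[of "\<lambda>_. a" y f] by simp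

lemma mean_step_drift:
  assumes "T \<subseteq> I" "\<And>i. i \<in> I - T \<Longrightarrow> f (act y i) = f y"
  shows "mean_step f y - f y = (\<Sum>i\<in>T. p y i * (f (act y i) - f y))"
proof -
  have "mean_step f y - f y = (\<Sum>i\<in>I. p y i * (f (act y i) - f y))"
    using mean_step_diff[of f "\<lambda>_. f y" y] unfolding mean_step_const by (simp add: mean_step_def)
  also have "\<dots> = (\<Sum>i\<in>T. p y i * (f (act y i) - f y))"
    using assms finite_labels by (intro sum.mono_neutral_right) auto
  finally show ?thesis .
qed

lemma mean_step_ge_single:
  assumes "j \<in> I" "\<And>z. 0 \<le> f z"
  shows "c * f (act y j) \<le> mean_step f y"
proof -
  have "c * f (act y j) \<le> p y j * f (act y j)" using assms p_ge by (intro mult_right_mono)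
  also have "\<dots> \<le> mean_step f y"
    unfolding mean_step_def by (rule member_le_sum) (use assms p_nonneg finite_labels in auto)
  finally show ?thesis .
qed

lemma mean_step_le_if_vanishing:
  assumes "j \<in> I" "f (act y j) = 0" "0 \<le> b" "\<And>i. i \<in> I \<Longrightarrow> f (act y i) \<le> b"
  shows "mean_step f y \<le> (1 - c) * b"
proof -
  have "mean_step f y = (\<Sum>i\<in>I - {j}. p y i * f (act y i))"
    unfolding mean_step_def using finite_labels assms(1,2) by (simp add: sum.remove)
  also have "\<dots> \<le> (\<Sum>i\<in>I - {j}. p y i) * b"
    unfolding sum_distrib_right by (intro sum_mono mult_left_mono) (use assms p_nonneg in auto)
  also have "(\<Sum>i\<in>I - {j}. p y i) = 1 - p y j"
    using p_sum[of y] finite_labels assms(1) by (simp add: sum.remove)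
  also have "(1 - p y j) * b \<le> (1 - c) * b"
    using p_ge[OF assms(1)] assms(3) by (intro mult_right_mono) auto
  finally show ?thesis .
qed

subsubsection \<open>Staying in a set\<close>

text \<open>\<open>stay_prob A k y\<close> is the probability that the states \<open>0, \<dots>, k\<close> of the chain started at \<open>y\<close> lie in \<open>A\<close>.\<close>

primrec stay_prob :: "'s set \<Rightarrow> nat \<Rightarrow> 's \<Rightarrow> real" where
  "stay_prob A 0 y = indicator A y"
| "stay_prob A (Suc k) y = indicator A y * mean_step (stay_prob A k) y"

lemma stay_prob_nonneg: "0 \<le> stay_prob A k y"
  by (induction k arbitrary: y) (auto intro!: mult_nonneg_nonneg mean_step_ge)

lemma stay_prob_le_1: "stay_prob A k y \<le> 1"
proof (induction k arbitrary: y)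
  case (Suc k)
  then show ?case by (auto intro!: mean_step_le split: split_indicator)
qed (auto split: split_indicator)

lemma stay_prob_Suc_le: "stay_prob A (Suc k) y \<le> stay_prob A k y"
proof (induction k arbitrary: y)
  case 0
  then show ?case using stay_prob_le_1[of A "Suc 0" y] by (cases "y \<in> A") auto
next
  case (Suc k)
  have "mean_step (stay_prob A (Suc k)) y \<le> mean_step (stay_prob A k) y"
    using Suc by (intro mean_step_mono)
  then show ?case by (metis stay_prob.simps(2) indicator_pos_le mult_left_mono)
qed

lemma decseq_stay_prob: "decseq (\<lambda>k. stay_prob A k y)"
  by (rule decseq_SucI) (rule stay_prob_Suc_le)

definition remain_prob :: "'s set \<Rightarrow> 's \<Rightarrow> real" where
  "remain_prob A y = lim (\<lambda>k. stay_prob A k y)"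

lemma stay_prob_LIMSEQ: "(\<lambda>k. stay_prob A k y) \<longlonglongrightarrow> remain_prob A y"
  using decseq_convergent[OF decseq_stay_prob, of 0 A y] stay_prob_nonneg
  unfolding remain_prob_def by (metis limI)

lemma remain_prob_le_stay_prob: "remain_prob A y \<le> stay_prob A k y"
  by (rule decseq_ge[OF decseq_stay_prob stay_prob_LIMSEQ])

lemma remain_prob_ge: "(\<And>k. a \<le> stay_prob A k y) \<Longrightarrow> a \<le> remain_prob A y"
  by (rule LIMSEQ_le_const[OF stay_prob_LIMSEQ]) auto

lemma remain_prob_nonneg: "0 \<le> remain_prob A y"
  by (rule remain_prob_ge) (rule stay_prob_nonneg)

lemma remain_prob_le_1: "remain_prob A y \<le> 1"
  using remain_prob_le_stay_prob stay_prob_le_1 by (rule order_trans)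

lemma remain_prob_outside [simp]: "y \<notin> A \<Longrightarrow> remain_prob A y = 0"
  using remain_prob_le_stay_prob[of A y 0] remain_prob_nonneg[of A y] by auto

lemma remain_prob_harmonic:
  assumes "y \<in> A"
  shows "remain_prob A y = mean_step (remain_prob A) y"
proof -
  have "(\<lambda>k. mean_step (stay_prob A k) y) \<longlonglongrightarrow> mean_step (remain_prob A) y"
    unfolding mean_step_def by (intro tendsto_sum tendsto_mult tendsto_const stay_prob_LIMSEQ)
  moreover have "(\<lambda>k. stay_prob A (Suc k) y) \<longlonglongrightarrow> remain_prob A y"
    using stay_prob_LIMSEQ by (rule LIMSEQ_Suc)
  ultimately show ?thesis using assms LIMSEQ_unique by auto
qed

lemma remain_prob_le_superharmonic:
  assumes nonneg: "\<And>y. 0 \<le> f y" and outside: "\<And>y. y \<in> A - B \<Longrightarrow> remain_prob A y \<le> f y"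
    and inside: "\<And>y. y \<in> A \<inter> B \<Longrightarrow> mean_step f y \<le> f y"
  shows "remain_prob A y \<le> f y + remain_prob (A \<inter> B) y"
proof (rule LIMSEQ_le_const[OF tendsto_add[OF tendsto_const stay_prob_LIMSEQ]], intro exI allI impI)
  fix k
  show "remain_prob A y \<le> f y + stay_prob (A \<inter> B) k y"
  proof (induction k arbitrary: y)
    case 0
    then show ?case using nonneg[of y] outside[of y] remain_prob_le_1[of A y]
      by (cases "y \<in> A"; cases "y \<in> B") auto
  next
    case (Suc k)
    show ?case
    proof (cases "y \<in> A \<inter> B")
      case True
      have "remain_prob A y \<le> mean_step (\<lambda>z. f z + stay_prob (A \<inter> B) k z) y"
        using True Suc by (auto simp: remain_prob_harmonic intro!: mean_step_mono)
      also have "\<dots> \<le> f y + mean_step (stay_prob (A \<inter> B) k) y"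
        using inside[OF True] by (simp add: mean_step_add)
      finally show ?thesis using True by simp
    next
      case False
      then show ?thesis using nonneg[of y] outside[of y] by (cases "y \<in> A") auto
    qed
  qed
qed

subsubsection \<open>Sets that are left almost surely\<close>

definition surely_left :: "'s set \<Rightarrow> bool" where
  "surely_left A \<longleftrightarrow> (\<forall>y. remain_prob A y = 0)"

definition leaves_within :: "nat \<Rightarrow> 's set \<Rightarrow> 's \<Rightarrow> bool" where
  "leaves_within L A y \<longleftrightarrow> (\<exists>w. set w \<subseteq> I \<and> length w \<le> L \<and> foldl act y w \<notin> A)"

lemma surely_leftI: "(\<And>y. remain_prob A y \<le> 0) \<Longrightarrow> surely_left A"
  using remain_prob_nonneg unfolding surely_left_def by (meson antisym)

lemma leaves_withinI: "foldl act y w \<notin> A \<Longrightarrow> set w \<subseteq> I \<Longrightarrow> length w \<le> L \<Longrightarrow> leaves_within L A y"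
  unfolding leaves_within_def by blast

lemma leaves_within_step:
  assumes "leaves_within L A (act y i)" "i \<in> I"
  shows "leaves_within (Suc L) A y"
proof -
  obtain w where "set w \<subseteq> I" "length w \<le> L" "foldl act (act y i) w \<notin> A"
    using assms(1) by (auto simp: leaves_within_def)
  then show ?thesis using assms(2) by (intro leaves_withinI[of y "i # w"]) auto
qed

lemma leaves_within_mono:
  "leaves_within L B y \<Longrightarrow> A \<subseteq> B \<Longrightarrow> L \<le> L' \<Longrightarrow> leaves_within L' A y"
  unfolding leaves_within_def by (meson in_mono order_trans)

lemma surely_leftI_uniform:
  assumes "s < 1" and le: "\<And>z. remain_prob A z \<le> s"
  shows "surely_left A"
proof (rule surely_leftI)
  fix y
  have "remain_prob A z \<le> s * stay_prob A k z" for k z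
  proof (induction k arbitrary: z)
    case (Suc k)
    show ?case
    proof (cases "z \<in> A")
      case True
      have "remain_prob A z \<le> mean_step (\<lambda>z. s * stay_prob A k z) z"
        unfolding remain_prob_harmonic[OF True] by (rule mean_step_mono) (rule Suc)
      then show ?thesis using True by (simp add: mean_step_cmult)
    qed simp
  qed (use le in \<open>auto split: split_indicator\<close>)
  then have "remain_prob A y \<le> s * remain_prob A y"
    by (intro LIMSEQ_le_const[OF tendsto_mult[OF tendsto_const stay_prob_LIMSEQ]]) auto
  then have "(1 - s) * remain_prob A y \<le> 0" by (simp add: algebra_simps)
  then show "remain_prob A y \<le> 0" using assms(1) by (simp add: mult_le_0_iff)
qed

lemma remain_prob_le_exit_word:
  "set w \<subseteq> I \<Longrightarrow> foldl act y w \<notin> A \<Longrightarrow> remain_prob A y \<le> 1 - c ^ length w"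
proof (induction w arbitrary: y)
  case (Cons j w)
  have "c ^ length w \<le> 1 - remain_prob A (act y j)" using Cons.IH[of "act y j"] Cons.prems by simp
  then have "c * c ^ length w \<le> c * (1 - remain_prob A (act y j))"
    using c_pos by (intro mult_left_mono) auto
  also have "\<dots> \<le> mean_step (\<lambda>z. 1 - remain_prob A z) y"
    using Cons.prems remain_prob_le_1 by (intro mean_step_ge_single) auto
  finally have "mean_step (remain_prob A) y \<le> 1 - c ^ length (j # w)" by (simp add: mean_step_diff)
  then show ?case
    using c_power_le_1[of "length (j # w)"] by (cases "y \<in> A") (simp_all add: remain_prob_harmonic)
qed simp

lemma remain_prob_le_leaves_within:
  assumes "leaves_within L A y"
  shows "remain_prob A y \<le> 1 - c ^ L"
proof -
  obtain w where w: "set w \<subseteq> I" "length w \<le> L" "foldl act y w \<notin> A"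
    using assms by (auto simp: leaves_within_def)
  have "c ^ L \<le> c ^ length w" using w(2) c_pos c_le_1 by (intro power_decreasing) auto
  then show ?thesis using remain_prob_le_exit_word[OF w(1,3)] by linarith
qed

lemma surely_left_two_stage:
  assumes "surely_left (A - G)" and G: "\<And>y. y \<in> A \<Longrightarrow> y \<in> G \<Longrightarrow> leaves_within L A y"
  shows "surely_left A"
proof (rule surely_leftI_uniform)
  show "1 - c ^ L < 1" using c_pos by simp
  fix y
  have "remain_prob A y \<le> 1 - c ^ L + remain_prob (A \<inter> - G) y"
    by (rule remain_prob_le_superharmonic) (use c_power_le_1 G remain_prob_le_leaves_within in auto)
  then show "remain_prob A y \<le> 1 - c ^ L" using assms(1) by (simp add: surely_left_def Diff_eq)
qed

lemma surely_left_if_leaves_within: "(\<And>y. y \<in> A \<Longrightarrow> leaves_within L A y) \<Longrightarrow> surely_left A"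
  by (rule surely_left_two_stage[where G = A]) (auto simp: surely_left_def)

lemma surely_left_Foster:
  assumes nonneg: "\<And>y. 0 \<le> f y" and "0 < \<epsilon>" and drift: "\<And>y. y \<in> A \<Longrightarrow> mean_step f y \<le> f y - \<epsilon>"
  shows "surely_left A"
proof (rule surely_leftI)
  fix y
  have bound: "real k * remain_prob A y \<le> f y / \<epsilon>" for k y
  proof (induction k arbitrary: y)
    case (Suc k)
    show ?case
    proof (cases "y \<in> A")
      case True
      have "real k * remain_prob A y = mean_step (\<lambda>z. real k * remain_prob A z) y"
        by (simp add: mean_step_cmult remain_prob_harmonic[OF True])
      also have "\<dots> \<le> mean_step (\<lambda>z. (1 / \<epsilon>) * f z) y" by (rule mean_step_mono) (use Suc in simp)
      also have "\<dots> = mean_step f y / \<epsilon>" by (simp only: mean_step_cmult) simp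
      also have "\<dots> \<le> (f y - \<epsilon>) / \<epsilon>" using drift[OF True] assms(2) by (intro divide_right_mono) auto
      also have "\<dots> = f y / \<epsilon> - 1" using assms(2) by (simp add: field_simps)
      finally show ?thesis using remain_prob_le_1[of A y] by (simp add: algebra_simps)
    qed (use nonneg assms(2) in auto)
  qed (use nonneg assms(2) in auto)
  show "remain_prob A y \<le> 0"
  proof (rule ccontr)
    assume "\<not> remain_prob A y \<le> 0"
    then show False
      using ex_less_of_nat_mult[of "remain_prob A y" "f y / \<epsilon>"] bound by (meson not_le)
  qed
qed

subsubsection \<open>Sets kept forever with probability bounded below\<close>

definition persistent :: "'s set \<Rightarrow> bool" where
  "persistent B \<longleftrightarrow> (\<exists>d>0. \<forall>y\<in>B. d \<le> remain_prob B y)"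

lemma persistent_empty: "persistent {}"
  by (auto simp: persistent_def intro: exI[of _ 1])

lemma remain_prob_ge_superharmonic:
  assumes nonneg: "\<And>y. 0 \<le> f y" and outside: "\<And>y. y \<notin> B \<Longrightarrow> 1 \<le> f y"
    and inside: "\<And>y. y \<in> B \<Longrightarrow> mean_step f y \<le> f y"
  shows "1 - f y \<le> remain_prob B y"
proof (rule remain_prob_ge)
  fix k
  show "1 - f y \<le> stay_prob B k y"
  proof (induction k arbitrary: y)
    case 0
    then show ?case using nonneg[of y] outside[of y] by (auto split: split_indicator)
  next
    case (Suc k)
    show ?case
    proof (cases "y \<in> B")
      case True
      have "1 - f y \<le> mean_step (\<lambda>z. 1 - f z) y" using inside[OF True] by (simp add: mean_step_diff)
      also have "\<dots> \<le> mean_step (stay_prob B k) y" by (rule mean_step_mono) (rule Suc)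
      finally show ?thesis using True by simp
    qed (use outside[of y] in auto)
  qed
qed

lemma remain_prob_ge_path:
  "set w \<subseteq> I \<Longrightarrow> (\<And>i. i < length w \<Longrightarrow> foldl act y (take i w) \<in> B)
    \<Longrightarrow> c ^ length w * remain_prob B (foldl act y w) \<le> remain_prob B y"
proof (induction w arbitrary: y)
  case (Cons j w)
  have y: "y \<in> B" using Cons.prems(2)[of 0] by simp
  have "c ^ length w * remain_prob B (foldl act (act y j) w) \<le> remain_prob B (act y j)"
    using Cons.prems Cons.prems(2)[of "Suc _"] by (intro Cons.IH) auto
  then have "c * (c ^ length w * remain_prob B (foldl act (act y j) w)) \<le> c * remain_prob B (act y j)"
    using c_pos by (intro mult_left_mono) auto
  also have "\<dots> \<le> mean_step (remain_prob B) y"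
    using Cons.prems remain_prob_nonneg by (intro mean_step_ge_single) auto
  finally show ?case using remain_prob_harmonic[OF y] by simp
qed simp

lemma persistent_if_superharmonic:
  assumes w: "set w \<subseteq> I" and f: "\<And>y. 0 \<le> f y" "\<And>y. y \<notin> B \<Longrightarrow> 1 \<le> f y" "\<And>y. y \<in> B \<Longrightarrow> mean_step f y \<le> f y"
    and path: "\<And>y i. y \<in> B \<Longrightarrow> foldl act y (take i w) \<in> B"
    and half: "\<And>y. y \<in> B \<Longrightarrow> f (foldl act y w) \<le> 1 / 2"
  shows "persistent B"
  unfolding persistent_def
proof (intro exI[of _ "c ^ length w / 2"] conjI ballI)
  show "c ^ length w / 2 > 0" using c_pos by simp
  fix y assume y: "y \<in> B"
  have "1 / 2 \<le> remain_prob B (foldl act y w)"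
    using remain_prob_ge_superharmonic[of f B "foldl act y w"] f half[OF y] by fastforce
  then have "c ^ length w * (1 / 2) \<le> c ^ length w * remain_prob B (foldl act y w)"
    using c_pos by (intro mult_left_mono) auto
  also have "\<dots> \<le> remain_prob B y" by (rule remain_prob_ge_path[OF w path[OF y]])
  finally show "c ^ length w / 2 \<le> remain_prob B y" by simp
qed

subsubsection \<open>Expectations over words of labels\<close>

primrec mean_word :: "nat \<Rightarrow> 's \<Rightarrow> ('i list \<Rightarrow> real) \<Rightarrow> real" where
  "mean_word 0 y F = F []"
| "mean_word (Suc k) y F = (\<Sum>i\<in>I. p y i * mean_word k (act y i) (\<lambda>w. F (i # w)))"

lemma mean_word_mono:
  "(\<And>w. length w = k \<Longrightarrow> set w \<subseteq> I \<Longrightarrow> F w \<le> G w) \<Longrightarrow> mean_word k y F \<le> mean_word k y G"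
proof (induction k arbitrary: y F G)
  case (Suc k)
  show ?case unfolding mean_word.simps
    by (intro sum_mono mult_left_mono Suc.IH p_nonneg) (use Suc.prems in auto)
qed auto

lemma mean_word_const [simp]: "mean_word k y (\<lambda>_. a) = a"
  by (induction k arbitrary: y) (auto simp: p_sum simp flip: sum_distrib_right)

lemma mean_word_le: "(\<And>w. F w \<le> a) \<Longrightarrow> mean_word k y F \<le> a"
  using mean_word_mono[of k F "\<lambda>_. a" y] by simp

lemma mean_word_cong:
  "(\<And>w. length w = k \<Longrightarrow> set w \<subseteq> I \<Longrightarrow> F w = G w) \<Longrightarrow> mean_word k y F = mean_word k y G"
  by (intro antisym mean_word_mono) auto

lemma mean_word_add: "mean_word k y (\<lambda>w. F w + G w) = mean_word k y F + mean_word k y G"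
  by (induction k arbitrary: y F G) (auto simp: sum.distrib algebra_simps)

lemma mean_word_cmult: "mean_word k y (\<lambda>w. a * F w) = a * mean_word k y F"
  by (induction k arbitrary: y F) (auto simp: sum_distrib_left algebra_simps)

lemma mean_word_append:
  "mean_word (k + l) y F = mean_word k y (\<lambda>w. mean_word l (foldl act y w) (\<lambda>w'. F (w @ w')))"
  by (induction k arbitrary: y F) auto

lemma mean_word_snoc:
  "mean_word (Suc k) y F = mean_word k y (\<lambda>w. \<Sum>i\<in>I. p (foldl act y w) i * F (w @ [i]))"
  using mean_word_append[of k 1 y F] by simp

lemma mean_word_tendsto:
  "(\<And>w. (\<lambda>m. F m w) \<longlonglongrightarrow> G w) \<Longrightarrow> (\<lambda>m. mean_word k y (F m)) \<longlonglongrightarrow> mean_word k y G"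
proof (induction k arbitrary: y F G)
  case (Suc k)
  show ?case unfolding mean_word.simps
    by (intro tendsto_sum tendsto_mult tendsto_const Suc.IH Suc.prems)
qed auto

lemma stay_prob_eq_mean_word:
  "stay_prob A k y = mean_word k y (\<lambda>w. of_bool (\<forall>i\<le>k. foldl act y (take i w) \<in> A))"
proof (induction k arbitrary: y)
  case (Suc k)
  have path: "(\<forall>i\<le>Suc k. foldl act y (take i (j # w)) \<in> A)
     \<longleftrightarrow> y \<in> A \<and> (\<forall>i\<le>k. foldl act (act y j) (take i w) \<in> A)" for j w
    using All_less_Suc2[of "Suc k" "\<lambda>i. foldl act y (take i (j # w)) \<in> A"]
    by (auto simp: less_Suc_eq_le)
  show ?case by (cases "y \<in> A") (auto simp: path Suc mean_step_def)
qed (simp add: indicator_def)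

primrec weight :: "'s \<Rightarrow> 'i list \<Rightarrow> real" where
  "weight y [] = 1"
| "weight y (i # w) = p y i * weight (act y i) w"

lemma weight_eq_prod: "weight y w = (\<Prod>i<length w. p (foldl act y (take i w)) (w ! i))"
  by (induction w arbitrary: y) (simp_all add: prod.lessThan_Suc_shift del: prod.lessThan_Suc)

lemma mean_word_eq_sum: "mean_word k y F = (\<Sum>w | set w \<subseteq> I \<and> length w = k. weight y w * F w)"
proof (induction k arbitrary: y F)
  case (Suc k)
  have "(\<Sum>w | set w \<subseteq> I \<and> length w = Suc k. weight y w * F w)
     = (\<Sum>(w, i)\<in>{w. set w \<subseteq> I \<and> length w = k} \<times> I. weight y (i # w) * F (i # w))"
    unfolding lists_length_Suc_eq by (subst sum.reindex) (auto simp: inj_on_def case_prod_unfold)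
  also have "\<dots> = (\<Sum>i\<in>I. \<Sum>w | set w \<subseteq> I \<and> length w = k. weight y (i # w) * F (i # w))"
    by (subst sum.cartesian_product[symmetric]) (rule sum.swap)
  also have "\<dots> = (\<Sum>i\<in>I. p y i * mean_word k (act y i) (\<lambda>w. F (i # w)))"
    by (simp add: Suc sum_distrib_left mult.assoc)
  finally show ?case by simp
qed (simp add: sum.neutral_const cong: conj_cong)

text \<open>The probability of staying in \<open>B\<close> forever is subharmonic with values in \<open>[0, 1]\<close>, and each entrance
  raises it from \<open>0\<close> to at least \<open>d\<close>.\<close>

lemma expected_entrances_le:
  assumes d: "\<And>y. y \<in> B \<Longrightarrow> d \<le> remain_prob B y"
  shows "d * (\<Sum>k<m. mean_word (Suc k) y (\<lambda>w. of_bool (foldl act y (take k w) \<notin> B \<and> foldl act y w \<in> B))) \<le> 1"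
proof -
  define g where "g k = mean_word k y (\<lambda>w. remain_prob B (foldl act y w))" for k
  have gain: "remain_prob B z + (\<Sum>i\<in>I. p z i * (d * of_bool (z \<notin> B \<and> act z i \<in> B)))
      \<le> mean_step (remain_prob B) z" for z
  proof (cases "z \<in> B")
    case False
    have "d * of_bool (act z i \<in> B) \<le> remain_prob B (act z i)" for i
      using d remain_prob_nonneg by auto
    then show ?thesis
      using False unfolding mean_step_def by (auto intro!: sum_mono mult_left_mono p_nonneg)
  qed (simp add: remain_prob_harmonic)
  define entrance where "entrance k = mean_word (Suc k) y
      (\<lambda>w. of_bool (foldl act y (take k w) \<notin> B \<and> foldl act y w \<in> B))" for k
  have "g k + d * entrance k \<le> g (Suc k)" for k
  proof -
    have "g k + d * entrance k
      = mean_word k y (\<lambda>w. remain_prob B (foldl act y w) + (\<Sum>i\<in>I. p (foldl act y w) i *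
          (d * of_bool (foldl act y w \<notin> B \<and> act (foldl act y w) i \<in> B))))"
      unfolding g_def entrance_def mean_word_cmult[symmetric] mean_word_snoc mean_word_add[symmetric]
      by (rule mean_word_cong) (simp add: sum_distrib_left mult_ac)
    also have "\<dots> \<le> mean_word k y (\<lambda>w. mean_step (remain_prob B) (foldl act y w))"
      by (intro mean_word_mono gain)
    also have "\<dots> = g (Suc k)" unfolding g_def mean_word_snoc mean_step_def by simp
    finally show ?thesis .
  qed
  then have "g 0 + d * (\<Sum>k<m. entrance k) \<le> g m"
  proof (induction m)
    case (Suc m)
    show ?case
      using Suc.IH[OF Suc.prems] Suc.prems[of m] unfolding sum.lessThan_Suc distrib_left by linarith
  qed simp
  moreover have "0 \<le> g 0" by (simp add: g_def remain_prob_nonneg)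
  moreover have "g m \<le> 1" unfolding g_def by (intro mean_word_le remain_prob_le_1)
  ultimately show ?thesis unfolding entrance_def by linarith
qed

definition compensated :: "('s \<Rightarrow> real) \<Rightarrow> 'i \<Rightarrow> 's \<Rightarrow> 'i list \<Rightarrow> real" where
  "compensated f j y w = (\<Sum>k<length w. f (foldl act y (take k w)) *
     (of_bool (w ! k = j) - p (foldl act y (take k w)) j))"

lemma compensated_snoc: "compensated f j y (w @ [i]) =
    compensated f j y w + f (foldl act y w) * (of_bool (i = j) - p (foldl act y w) j)"
  unfolding compensated_def by (simp add: nth_append)

lemma abs_of_bool_minus_p_le_1: "j \<in> I \<Longrightarrow> \<bar>of_bool b - p y j\<bar> \<le> 1"
  using p_nonneg[of j y] p_le_1[of j y] by auto

lemma mean_word_compensated_square: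
  assumes j: "j \<in> I" and f: "\<And>y. \<bar>f y\<bar> \<le> 1"
  shows "mean_word k y (\<lambda>w. (compensated f j y w)\<^sup>2) \<le> real k"
proof (induction k)
  case (Suc k)
  define incr where "incr z i = f z * (of_bool (i = j) - p z j)" for z i
  have centred: "(\<Sum>i\<in>I. p z i * incr z i) = 0" for z
  proof -
    have "(\<Sum>i\<in>I. p z i * incr z i) = f z * ((\<Sum>i\<in>I. if i = j then p z i else 0) - (\<Sum>i\<in>I. p z i) * p z j)"
      unfolding incr_def sum_distrib_left sum_distrib_right sum_subtractf[symmetric]
      by (intro sum.cong) (auto simp: algebra_simps)
    then show ?thesis using finite_labels j by (simp add: p_sum)
  qed
  have bounded: "(incr z i)\<^sup>2 \<le> 1" for z i
    unfolding abs_square_le_1 incr_def abs_mult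
    using f j by (intro mult_le_one abs_of_bool_minus_p_le_1) auto
  have "mean_word (Suc k) y (\<lambda>w. (compensated f j y w)\<^sup>2) = mean_word k y (\<lambda>w.
      \<Sum>i\<in>I. p (foldl act y w) i * (compensated f j y w + incr (foldl act y w) i)\<^sup>2)"
    unfolding mean_word_snoc compensated_snoc incr_def ..
  also have "\<dots> \<le> mean_word k y (\<lambda>w. (compensated f j y w)\<^sup>2 + 1)"
  proof (rule mean_word_mono)
    fix w :: "'i list"
    define z a where "z = foldl act y w" and "a = compensated f j y w"
    have "(\<Sum>i\<in>I. p z i * (a + incr z i)\<^sup>2)
        = (\<Sum>i\<in>I. p z i) * a\<^sup>2 + 2 * a * (\<Sum>i\<in>I. p z i * incr z i) + (\<Sum>i\<in>I. p z i * (incr z i)\<^sup>2)"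
      unfolding sum_distrib_left sum_distrib_right sum.distrib[symmetric]
      by (intro sum.cong) (auto simp: power2_sum algebra_simps)
    also have "\<dots> \<le> a\<^sup>2 + (\<Sum>i\<in>I. p z i * 1)"
      unfolding centred p_sum using bounded by (simp add: sum_mono mult_left_le p_nonneg)
    finally show "(\<Sum>i\<in>I. p (foldl act y w) i * (compensated f j y w + incr (foldl act y w) i)\<^sup>2)
        \<le> (compensated f j y w)\<^sup>2 + 1" by (simp add: p_sum z_def a_def)
  qed
  also have "\<dots> \<le> real (Suc k)" using Suc by (simp add: mean_word_add)
  finally show ?case .
qed (simp add: compensated_def)

end

subsection \<open>A lazy random walk\<close>

text \<open>The law of a sum of \<open>l\<close> independent variables that are uniform on \<open>{-1, 0, 1}\<close>.\<close>

primrec lazy_walk_prob :: "nat \<Rightarrow> int \<Rightarrow> real" where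
  "lazy_walk_prob 0 e = of_bool (e = 0)"
| "lazy_walk_prob (Suc l) e =
     (lazy_walk_prob l (e - 1) + lazy_walk_prob l e + lazy_walk_prob l (e + 1)) / 3"

lemma lazy_walk_prob_nonneg: "0 \<le> lazy_walk_prob l e"
  by (induction l arbitrary: e) auto

lemma lazy_walk_prob_minus: "lazy_walk_prob l (- e) = lazy_walk_prob l e"
proof (induction l arbitrary: e)
  case (Suc l)
  have "- e - 1 = - (e + 1)" "- e + 1 = - (e - 1)" by auto
  then show ?case
    using Suc[of "e - 1"] Suc[of "e + 1"] Suc[of e]
    by (simp only: lazy_walk_prob.simps add.commute add.left_commute add.assoc)
qed auto

lemma lazy_walk_prob_unimodal: "0 \<le> e \<Longrightarrow> lazy_walk_prob l (e + 1) \<le> lazy_walk_prob l e"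
proof (induction l arbitrary: e)
  case (Suc l)
  have "lazy_walk_prob l (e + 2) \<le> lazy_walk_prob l (e - 1)"
  proof (cases "e = 0")
    case True
    then show ?thesis using Suc.IH[of 1] lazy_walk_prob_minus[of l 1] by simp
  next
    case False
    then have "0 \<le> e - 1" using Suc.prems by simp
    then have "lazy_walk_prob l (e - 1 + 1 + 1 + 1) \<le> lazy_walk_prob l (e - 1 + 1 + 1)"
      "lazy_walk_prob l (e - 1 + 1 + 1) \<le> lazy_walk_prob l (e - 1 + 1)"
      "lazy_walk_prob l (e - 1 + 1) \<le> lazy_walk_prob l (e - 1)"
      by (intro Suc.IH; simp)+
    then show ?thesis by (simp add: algebra_simps)
  qed
  then show ?case by (simp add: algebra_simps)
qed auto

lemma sum_lazy_walk_prob_le_1: "finite S \<Longrightarrow> (\<Sum>e\<in>S. lazy_walk_prob l e) \<le> 1"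
proof (induction l arbitrary: S)
  case 0
  have "(\<Sum>e\<in>S. lazy_walk_prob 0 e) = of_bool (0 \<in> S)" using 0 by (simp add: of_bool_def sum.delta)
  then show ?case by auto
next
  case (Suc l)
  have shift: "(\<Sum>e\<in>S. lazy_walk_prob l (e + a)) \<le> 1" for a
    using Suc.IH[of "(\<lambda>e. e + a) ` S"] Suc.prems
    by (simp add: sum.reindex o_def)
  show ?case using shift[of "-1"] shift[of 0] shift[of 1]
    by (simp add: sum.distrib flip: sum_divide_distrib)
qed

lemma decseq_lazy_walk_prob_0: "decseq (\<lambda>l. lazy_walk_prob l 0)"
proof (rule decseq_SucI)
  show "lazy_walk_prob (Suc l) 0 \<le> lazy_walk_prob l 0" for l
    using lazy_walk_prob_unimodal[of 0 l] lazy_walk_prob_minus[of l 1] by simp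
qed

text \<open>Solving the recursion for its outermost term propagates the limit from the return
  probability to all other values.\<close>

lemma lazy_walk_prob_common_limit: "\<exists>a. \<forall>d. (\<lambda>l. lazy_walk_prob l (int d)) \<longlonglongrightarrow> a"
proof -
  obtain a where a: "(\<lambda>l. lazy_walk_prob l 0) \<longlonglongrightarrow> a"
    using decseq_convergent[OF decseq_lazy_walk_prob_0] lazy_walk_prob_nonneg by metis
  have "(\<lambda>l. lazy_walk_prob l (int d)) \<longlonglongrightarrow> a \<and> (\<lambda>l. lazy_walk_prob l (int (Suc d))) \<longlonglongrightarrow> a" for d
  proof (induction d)
    case 0
    have "(\<lambda>l. (3 * lazy_walk_prob (Suc l) 0 - lazy_walk_prob l 0) / 2) \<longlonglongrightarrow> (3 * a - a) / 2"
      by (intro tendsto_intros a LIMSEQ_Suc[OF a]) auto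
    moreover have "(3 * lazy_walk_prob (Suc l) 0 - lazy_walk_prob l 0) / 2 = lazy_walk_prob l 1" for l
      using lazy_walk_prob_minus[of l 1] by (simp add: field_simps)
    ultimately show ?case using a by simp
  next
    case (Suc d)
    have "(\<lambda>l. 3 * lazy_walk_prob (Suc l) (int (Suc d)) - lazy_walk_prob l (int d)
        - lazy_walk_prob l (int (Suc d))) \<longlonglongrightarrow> 3 * a - a - a"
      by (intro tendsto_intros LIMSEQ_Suc[of "\<lambda>l. lazy_walk_prob l (int (Suc d))"]) (use Suc in auto)
    moreover have "3 * lazy_walk_prob (Suc l) (int (Suc d)) - lazy_walk_prob l (int d)
        - lazy_walk_prob l (int (Suc d)) = lazy_walk_prob l (int (Suc (Suc d)))" for l
      by (simp add: algebra_simps)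
    ultimately show ?case using Suc by simp
  qed
  then show ?thesis by blast
qed

lemma lazy_walk_prob_tendsto_0: "(\<lambda>l. lazy_walk_prob l e) \<longlonglongrightarrow> 0"
proof -
  obtain a where a: "\<And>d. (\<lambda>l. lazy_walk_prob l (int d)) \<longlonglongrightarrow> a"
    using lazy_walk_prob_common_limit by blast
  have "real N * a \<le> 1" for N
  proof -
    have "(\<lambda>l. \<Sum>d<N. lazy_walk_prob l (int d)) \<longlonglongrightarrow> (\<Sum>d<N. a)"
      by (intro tendsto_sum a)
    moreover have "(\<Sum>d<N. lazy_walk_prob l (int d)) \<le> 1" for l
      using sum_lazy_walk_prob_le_1[of "int ` {..<N}" l] by (simp add: sum.reindex)
    ultimately have "(\<Sum>d<N. a) \<le> 1" by (intro LIMSEQ_le_const2) auto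
    then show ?thesis by simp
  qed
  then have "a \<le> 0" using reals_Archimedean3[of a] by (meson not_le)
  moreover have "0 \<le> a" using a[of 0] lazy_walk_prob_nonneg by (intro LIMSEQ_le_const) auto
  ultimately have "(\<lambda>l. lazy_walk_prob l (int (nat \<bar>e\<bar>))) \<longlonglongrightarrow> 0" using a by (metis antisym)
  moreover have "lazy_walk_prob l e = lazy_walk_prob l (int (nat \<bar>e\<bar>))" for l
    using lazy_walk_prob_minus[of l e] by (cases "0 \<le> e") auto
  ultimately show ?thesis by presburger
qed

subsection \<open>Three exchangeable counters\<close>

text \<open>\<open>triple_mean l f a b d\<close> is the mean of \<open>f\<close> after \<open>l\<close> steps of the walk that starts at \<open>(a, b, d)\<close>
  and increments a uniformly chosen coordinate.\<close>

primrec triple_mean :: "nat \<Rightarrow> (int \<Rightarrow> int \<Rightarrow> int \<Rightarrow> real) \<Rightarrow> int \<Rightarrow> int \<Rightarrow> int \<Rightarrow> real" where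
  "triple_mean 0 f a b d = f a b d"
| "triple_mean (Suc l) f a b d =
     (triple_mean l f (a + 1) b d + triple_mean l f a (b + 1) d + triple_mean l f a b (d + 1)) / 3"

lemma triple_mean_mono:
  "(\<And>a b d. f a b d \<le> g a b d) \<Longrightarrow> triple_mean l f a b d \<le> triple_mean l g a b d"
proof (induction l arbitrary: a b d)
  case (Suc l)
  show ?case using Suc.IH[OF Suc.prems, of "a+1" b d] Suc.IH[OF Suc.prems, of a "b+1" d]
      Suc.IH[OF Suc.prems, of a b "d+1"] by simp
qed auto

lemma triple_mean_const: "triple_mean l (\<lambda>_ _ _. r) a b d = r"
  by (induction l arbitrary: a b d) auto

lemma triple_mean_nonneg: "(\<And>a b d. 0 \<le> f a b d) \<Longrightarrow> 0 \<le> triple_mean l f a b d"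
  using triple_mean_mono[of "\<lambda>_ _ _. 0" f] by (simp add: triple_mean_const)

lemma triple_mean_add:
  "triple_mean l (\<lambda>a b d. f a b d + g a b d) a b d = triple_mean l f a b d + triple_mean l g a b d"
  by (induction l arbitrary: a b d) (auto simp: field_simps)

lemma triple_mean_diff:
  "triple_mean l (\<lambda>a b d. f a b d - g a b d) a b d = triple_mean l f a b d - triple_mean l g a b d"
  by (induction l arbitrary: a b d) (auto simp flip: diff_divide_distrib)

lemma triple_mean_sum: "finite S \<Longrightarrow>
    triple_mean l (\<lambda>a b d. \<Sum>e\<in>S. f e a b d) a b d = (\<Sum>e\<in>S. triple_mean l (f e) a b d)"
  by (induction S rule: finite_induct) (auto simp: triple_mean_const triple_mean_add)

lemma triple_mean_swap12: "triple_mean l (\<lambda>a b d. f b a d) a b d = triple_mean l f b a d"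
  by (induction l arbitrary: a b d) (auto simp: algebra_simps)

lemma triple_mean_swap23: "triple_mean l (\<lambda>a b d. f a d b) a b d = triple_mean l f a d b"
  by (induction l arbitrary: a b d) (auto simp: algebra_simps)

lemma triple_mean_shift:
  "triple_mean l (\<lambda>x y z. f (a + x) (b + y) (d + z)) x y z = triple_mean l f (a + x) (b + y) (d + z)"
  by (induction l arbitrary: x y z) (auto simp: algebra_simps)

lemma triple_mean_difference_law:
  "triple_mean l (\<lambda>a b d. of_bool (a - b = e)) a b d = lazy_walk_prob l (e - (a - b))"
proof (induction l arbitrary: a b d)
  case (Suc l)
  have "e - (a + 1 - b) = e - (a - b) - 1" "e - (a - (b + 1)) = e - (a - b) + 1" by auto
  then show ?case by (simp only: triple_mean.simps lazy_walk_prob.simps Suc.IH) simp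
qed auto

lemma triple_mean_tie_tendsto_0:
  "(\<lambda>l. triple_mean l (\<lambda>a b d. of_bool (\<bar>a - b\<bar> \<le> h)) 0 0 0) \<longlonglongrightarrow> 0"
proof -
  have "(\<lambda>a b d::int. of_bool (\<bar>a - b\<bar> \<le> h) :: real)
      = (\<lambda>a b d. \<Sum>e\<in>{-h..h}. of_bool (a - b = e))"
  proof (intro ext)
    fix a b :: int
    show "of_bool (\<bar>a - b\<bar> \<le> h) = (\<Sum>e\<in>{-h..h}. of_bool (a - b = e) :: real)"
      by (subst of_bool_def, subst sum.delta') auto
  qed
  then have "triple_mean l (\<lambda>a b d. of_bool (\<bar>a - b\<bar> \<le> h)) 0 0 0 = (\<Sum>e\<in>{-h..h}. lazy_walk_prob l e)" for l
    by (simp only: triple_mean_sum[OF finite_atLeastAtMost_int] triple_mean_difference_law) simp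
  moreover have "(\<lambda>l. \<Sum>e\<in>{-h..h}. lazy_walk_prob l e) \<longlonglongrightarrow> (\<Sum>e\<in>{-h..h}. 0)"
    by (intro tendsto_sum lazy_walk_prob_tendsto_0)
  ultimately show ?thesis by simp
qed

text \<open>By exchangeability the three permuted events are equally likely, and ties up to the distance
  \<open>h\<close> become negligible, so the limiting probability is at least one third.\<close>

lemma triple_mean_ge_quarter:
  assumes cover: "\<And>a b d. \<bar>a - b\<bar> > h \<Longrightarrow> \<bar>b - d\<bar> > h \<Longrightarrow> \<bar>a - d\<bar> > h \<Longrightarrow> Q a b d \<or> Q b a d \<or> Q a d b"
  shows "\<exists>l. 1 / 4 \<le> triple_mean l (\<lambda>a b d. of_bool (Q a b d)) 0 0 0"
proof -
  define m where "m = (\<lambda>a b d. of_bool (Q a b d) :: real)"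
  define t where "t = (\<lambda>a b d :: int. of_bool (\<bar>a - b\<bar> \<le> h) :: real)"
  have exchangeable: "1 \<le> 3 * triple_mean l m 0 0 0 + 3 * triple_mean l t 0 0 0" for l
  proof -
    have "triple_mean l (\<lambda>_ _ _. 1) 0 0 0
        \<le> triple_mean l (\<lambda>a b d. m a b d + (m b a d + (m a d b + (t a b d + (t a d b + t b d a))))) 0 0 0"
    proof (rule triple_mean_mono)
      fix a b d :: int
      show "1 \<le> m a b d + (m b a d + (m a d b + (t a b d + (t a d b + t b d a))))"
        using cover[of a b d] unfolding m_def t_def not_less[symmetric] by (auto simp: of_bool_def)
    qed
    moreover have "triple_mean l (\<lambda>a b d. m b a d) 0 0 0 = triple_mean l m 0 0 0"
      "triple_mean l (\<lambda>a b d. m a d b) 0 0 0 = triple_mean l m 0 0 0"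
      "triple_mean l (\<lambda>a b d. t a d b) 0 0 0 = triple_mean l t 0 0 0"
      by (rule triple_mean_swap12 triple_mean_swap23)+
    moreover have "triple_mean l (\<lambda>a b d. t b d a) 0 0 0 = triple_mean l t 0 0 0"
      using triple_mean_swap12[of l "\<lambda>a b d. t a d b" 0 0 0] triple_mean_swap23[of l t 0 0 0]
      by simp
    ultimately show ?thesis by (simp add: triple_mean_const triple_mean_add)
  qed

  obtain l where "triple_mean l t 0 0 0 < 1 / 12"
    using order_tendstoD(2)[OF triple_mean_tie_tendsto_0[of h], of "1 / 12"]
    by (auto simp: eventually_sequentially t_def)
  then have "1 / 4 \<le> triple_mean l m 0 0 0" using exchangeable[of l] by linarith
  then show ?thesis unfolding m_def ..
qed

subsection \<open>Growing configurations\<close>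

definition bump :: "('i \<Rightarrow> nat) \<Rightarrow> 'i \<Rightarrow> ('i \<Rightarrow> nat)" where
  "bump y j = y(j := y j + 1)"

lemma bump_same [simp]: "bump y j j = y j + 1"
  and bump_other [simp]: "i \<noteq> j \<Longrightarrow> bump y j i = y i"
  by (auto simp: bump_def)

lemma bump_apply: "bump y j i = y i + (if i = j then 1 else 0)"
  by (simp add: bump_def)

lemma foldl_bump_apply: "foldl bump y w i = y i + count_list w i"
  by (induction w arbitrary: y) (auto simp: bump_apply)

lemma count_list_replicate: "count_list (replicate k s) i = (if i = s then k else 0)"
  by (induction k) auto

locale growth_chain = elliptic_chain p bump I c
  for p :: "('i \<Rightarrow> nat) \<Rightarrow> 'i \<Rightarrow> real" and I c
begin

subsubsection \<open>Pairs of sites with equal rates\<close>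

definition gap :: "'i \<Rightarrow> 'i \<Rightarrow> ('i \<Rightarrow> nat) \<Rightarrow> real" where
  "gap i j y = \<bar>real (y i) - real (y j)\<bar>"

lemma mean_step_gap_neutral:
  assumes ij: "i \<in> I" "j \<in> I" "i \<noteq> j" and "p y i = p y j" "y i \<noteq> y j"
  shows "mean_step (gap i j) y = gap i j y"
proof -
  have "mean_step (gap i j) y - gap i j y = (\<Sum>l\<in>{i, j}. p y l * (gap i j (bump y l) - gap i j y))"
    by (rule mean_step_drift) (use ij in \<open>auto simp: gap_def\<close>)
  also have "\<dots> = p y i * (gap i j (bump y i) + gap i j (bump y j) - 2 * gap i j y)"
    using ij assms(4) by (simp add: algebra_simps)
  also have "gap i j (bump y i) + gap i j (bump y j) - 2 * gap i j y = 0"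
    using assms(5) ij unfolding gap_def by (cases "y i < y j") (auto simp: bump_apply)
  finally show ?thesis by simp
qed

lemma surely_left_bounded_gap:
  assumes ij: "i \<in> I" "j \<in> I" "i \<noteq> j"
  shows "surely_left (A \<inter> {y. gap i j y < real R})"
proof (rule surely_left_if_leaves_within)
  fix y :: "'i \<Rightarrow> nat"
  define upper where "upper = (if y i < y j then j else i)"
  have "real R \<le> gap i j (foldl bump y (replicate R upper))"
    unfolding gap_def foldl_bump_apply upper_def using ij by (auto simp: count_list_replicate)
  then show "leaves_within R (A \<inter> {y. gap i j y < real R}) y"
    using ij by (intro leaves_withinI[of y "replicate R upper"]) (auto simp: upper_def)
qed

lemma surely_left_neutral_pair:
  assumes ij: "i \<in> I" "j \<in> I" "i \<noteq> j"
    and neutral: "\<And>y. y \<in> A \<Longrightarrow> p y i = p y j" and apart: "\<And>y. y \<in> A \<Longrightarrow> y i \<noteq> y j"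
  shows "surely_left A"
proof (rule surely_leftI)
  fix y
  have "remain_prob A y \<le> gap i j y / real R" if "R > 0" for R
  proof -
    have "remain_prob A y \<le> gap i j y / real R + remain_prob (A \<inter> {y. gap i j y < real R}) y"
    proof (rule remain_prob_le_superharmonic)
      fix z assume "z \<in> A - {y. gap i j y < real R}"
      then have "1 \<le> gap i j z / real R" using that by simp
      then show "remain_prob A z \<le> gap i j z / real R" using remain_prob_le_1 order_trans by blast
    next
      fix z assume "z \<in> A \<inter> {y. gap i j y < real R}"
      then show "mean_step (\<lambda>y. gap i j y / real R) z \<le> gap i j z / real R"
        using mean_step_cmult[of "1 / real R" "gap i j" z] mean_step_gap_neutral[OF ij, of z] neutral apart
        by simp
    qed (simp add: gap_def)
    then show ?thesis using surely_left_bounded_gap[OF ij] by (simp add: surely_left_def)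
  qed
  moreover have "(\<lambda>R. gap i j y / real R) \<longlonglongrightarrow> 0" by (rule lim_const_over_n)
  ultimately show "remain_prob A y \<le> 0"
    by (intro LIMSEQ_le_const[of _ 0]) (auto intro!: exI[of _ 1])
qed

subsubsection \<open>Triples of sites with equal rates\<close>

lemma mean_step_le_neutral_triple:
  assumes I: "i \<in> I" "j \<in> I" "k \<in> I" and distinct: "i \<noteq> j" "j \<noteq> k" "i \<noteq> k"
    and neutral: "p y i = p y j" "p y j = p y k" and "0 \<le> r"
    and triple: "f (bump y i) + f (bump y j) + f (bump y k) \<le> 3 * w"
    and rest: "\<And>t. t \<in> I - {i, j, k} \<Longrightarrow> f (bump y t) \<le> w + r"
  shows "mean_step f y \<le> w + (1 - c) * r"
proof -
  define T where "T = {i, j, k}"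
  have split: "(\<Sum>t\<in>I. h t) = (\<Sum>t\<in>I - T. h t) + (h i + h j + h k)" for h :: "'i \<Rightarrow> real"
    using sum.subset_diff[of T I h] finite_labels I distinct by (simp add: T_def)
  have "(\<Sum>t\<in>I - T. p y t * f (bump y t)) \<le> (\<Sum>t\<in>I - T. p y t) * (w + r)"
    unfolding sum_distrib_right
    by (intro sum_mono mult_left_mono) (use rest p_nonneg in \<open>auto simp: T_def\<close>)
  also have "(\<Sum>t\<in>I - T. p y t) = 1 - 3 * p y i" using split[of "p y"] neutral by (simp add: p_sum)
  finally have "mean_step f y
      \<le> p y i * (f (bump y i) + f (bump y j) + f (bump y k)) + (1 - 3 * p y i) * (w + r)"
    unfolding mean_step_def split using neutral by (simp add: algebra_simps)
  also have "\<dots> \<le> p y i * (3 * w) + (1 - 3 * p y i) * (w + r)"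
    using triple p_nonneg[OF I(1), of y] by (intro add_right_mono mult_left_mono)
  also have "\<dots> = w + (1 - 3 * p y i) * r" by (simp add: algebra_simps)
  also have "(1 - 3 * p y i) * r \<le> (1 - c) * r"
    using p_ge[OF I(1), of y] c_pos \<open>0 \<le> r\<close> by (intro mult_right_mono) auto
  finally show ?thesis by simp
qed

lemma remain_prob_le_triple_mean:
  assumes I: "i \<in> I" "j \<in> I" "k \<in> I" and distinct: "i \<noteq> j" "j \<noteq> k" "i \<noteq> k"
    and neutral: "\<And>y. y \<in> A \<Longrightarrow> p y i = p y j" "\<And>y. y \<in> A \<Longrightarrow> p y j = p y k"
    and h: "\<And>a b d. 0 \<le> h a b d" "\<And>y. y \<in> A \<Longrightarrow> 1 \<le> h (int (y i)) (int (y j)) (int (y k))"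
  shows "remain_prob A y \<le> triple_mean l h (int (y i)) (int (y j)) (int (y k))"
proof (induction l arbitrary: y)
  case 0
  then show ?case using remain_prob_le_1[of A y] h(1) h(2)[of y]
    by (cases "y \<in> A") (auto intro: order_trans)
next
  case (Suc l)
  define W where "W y = triple_mean (Suc l) h (int (y i)) (int (y j)) (int (y k))" for y
  have W_nonneg: "0 \<le> W y" for y unfolding W_def by (rule triple_mean_nonneg[OF h(1)])
  have "remain_prob A y - W y \<le> 0"
  proof (rule nonpos_if_contracting[where g = "\<lambda>y. remain_prob A y - W y"])
    show "0 \<le> 1 - c" "1 - c < 1" using c_pos c_le_1 by auto
    show "remain_prob A y - W y \<le> 1" for y using remain_prob_le_1[of A y] W_nonneg[of y] by linarith
    fix r y assume r: "0 \<le> r" "\<And>z. remain_prob A z - W z \<le> r"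
    show "remain_prob A y - W y \<le> (1 - c) * r"
    proof (cases "y \<in> A")
      case True
      have "mean_step (remain_prob A) y \<le> W y + (1 - c) * r"
      proof (rule mean_step_le_neutral_triple[OF I distinct neutral(1)[OF True] neutral(2)[OF True] r(1)])
        show "remain_prob A (bump y i) + remain_prob A (bump y j) + remain_prob A (bump y k) \<le> 3 * W y"
          using Suc[of "bump y i"] Suc[of "bump y j"] Suc[of "bump y k"] distinct
          by (simp add: W_def algebra_simps)
        fix t assume "t \<in> I - {i, j, k}"
        then have "W (bump y t) = W y" by (auto simp: W_def bump_apply)
        then show "remain_prob A (bump y t) \<le> W y + r" using r(2)[of "bump y t"] by simp
      qed
      then show ?thesis using remain_prob_harmonic[OF True] by simp
    next
      case False
      moreover have "0 \<le> (1 - c) * r" using r(1) c_le_1 by simp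
      ultimately show ?thesis using W_nonneg[of y] by simp
    qed
  qed
  then show ?case by (simp add: W_def)
qed

lemma surely_left_if_middle_order_avoided:
  assumes I: "i \<in> I" "j \<in> I" "k \<in> I" and distinct: "i \<noteq> j" "j \<noteq> k" "i \<noteq> k"
    and neutral: "\<And>y. y \<in> A \<Longrightarrow> p y i = p y j" "\<And>y. y \<in> A \<Longrightarrow> p y j = p y k"
    and Q: "Q = (\<lambda>a b d. b < a \<and> b < d) \<or> Q = (\<lambda>a b d. a < b \<and> d < b)"
    and avoided: "\<And>y. y \<in> A \<Longrightarrow> \<not> Q (int (y i)) (int (y j)) (int (y k))"
  shows "surely_left A"
proof (rule surely_leftI_uniform)
  show "(3/4::real) < 1" by simp
  fix y :: "'i \<Rightarrow> nat"
  define R where "R a b d = Q (int (y i) + a) (int (y j) + b) (int (y k) + d)" for a b d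
  define g where "g = \<bar>int (y i) - int (y j)\<bar> + \<bar>int (y j) - int (y k)\<bar>"
  have "\<exists>l. 1 / 4 \<le> triple_mean l (\<lambda>a b d. of_bool (R a b d)) 0 0 0"
  proof (rule triple_mean_ge_quarter[where h = g])
    fix a b d :: int
    assume "\<bar>a - b\<bar> > g" "\<bar>b - d\<bar> > g" "\<bar>a - d\<bar> > g"
    then show "R a b d \<or> R b a d \<or> R a d b"
      using Q unfolding R_def g_def by (elim disjE) (simp; smt (verit))+
  qed
  then obtain l where l: "1 / 4 \<le> triple_mean l (\<lambda>a b d. of_bool (R a b d)) 0 0 0" by blast
  have "remain_prob A y \<le> triple_mean l (\<lambda>a b d. 1 - of_bool (Q a b d)) (int (y i)) (int (y j)) (int (y k))"
    by (rule remain_prob_le_triple_mean[OF I distinct neutral]) (use avoided in auto)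
  also have "\<dots> = triple_mean l (\<lambda>a b d. 1 - of_bool (R a b d)) 0 0 0"
    using triple_mean_shift[of l "\<lambda>a b d. 1 - of_bool (Q a b d)" "int (y i)" "int (y j)" "int (y k)" 0 0 0]
    by (simp add: R_def)
  also have "\<dots> = 1 - triple_mean l (\<lambda>a b d. of_bool (R a b d)) 0 0 0"
    by (simp add: triple_mean_diff triple_mean_const)
  finally show "remain_prob A y \<le> 3 / 4" using l by simp
qed

lemma surely_left_neutral_triple_without_strict_min:
  assumes "i \<in> I" "j \<in> I" "k \<in> I" "i \<noteq> j" "j \<noteq> k" "i \<noteq> k"
    and "\<And>y. y \<in> A \<Longrightarrow> p y i = p y j" "\<And>y. y \<in> A \<Longrightarrow> p y j = p y k"
    and "\<And>y. y \<in> A \<Longrightarrow> \<not> (y j < y i \<and> y j < y k)"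
  shows "surely_left A"
  using surely_left_if_middle_order_avoided[OF assms(1-8), where Q = "\<lambda>a b d. b < a \<and> b < d"] assms(9)
  by simp

lemma surely_left_neutral_triple_without_strict_max:
  assumes "i \<in> I" "j \<in> I" "k \<in> I" "i \<noteq> j" "j \<noteq> k" "i \<noteq> k"
    and "\<And>y. y \<in> A \<Longrightarrow> p y i = p y j" "\<And>y. y \<in> A \<Longrightarrow> p y j = p y k"
    and "\<And>y. y \<in> A \<Longrightarrow> \<not> (y i < y j \<and> y k < y j)"
  shows "surely_left A"
  using surely_left_if_middle_order_avoided[OF assms(1-8), where Q = "\<lambda>a b d. a < b \<and> d < b"] assms(9)
  by simp
end

subsection \<open>Ordered pairs of sites\<close>

lemma count_list_concat_replicate: "count_list (concat (replicate k xs)) a = k * count_list xs a"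
  by (induction k) auto

definition ordered_along :: "('i \<times> 'i) set \<Rightarrow> ('i \<Rightarrow> nat) set" where
  "ordered_along N = {y. \<forall>(hi, lo)\<in>N. y lo < y hi}"

definition gap_potential :: "real \<Rightarrow> ('i \<times> 'i) set \<Rightarrow> ('i \<Rightarrow> nat) \<Rightarrow> real" where
  "gap_potential r N y = (\<Sum>(hi, lo)\<in>N. r ^ (y hi - y lo))"

lemma gap_potential_nonneg: "0 \<le> r \<Longrightarrow> 0 \<le> gap_potential r N y"
  unfolding gap_potential_def by (intro sum_nonneg) auto

lemma gap_potential_ge_1:
  assumes "finite N" "0 \<le> r" "y \<notin> ordered_along N"
  shows "1 \<le> gap_potential r N y"
proof -
  obtain hi lo where "(hi, lo) \<in> N" "y hi \<le> y lo" using assms(3) by (force simp: ordered_along_def)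
  then show ?thesis
    using member_le_sum[of "(hi, lo)" N "\<lambda>(hi, lo). r ^ (y hi - y lo)"] assms(1,2)
    by (auto simp: gap_potential_def)
qed

lemma gap_potential_le:
  assumes "0 \<le> r" "r \<le> 1" "\<And>hi lo. (hi, lo) \<in> N \<Longrightarrow> y lo + k \<le> y hi"
  shows "gap_potential r N y \<le> real (card N) * r ^ k"
proof -
  have "gap_potential r N y \<le> (\<Sum>_\<in>N. r ^ k)"
    unfolding gap_potential_def case_prod_unfold
  proof (intro sum_mono power_decreasing)
    fix e assume "e \<in> N"
    then show "k \<le> y (fst e) - y (snd e)" using assms(3)[of "fst e" "snd e"] by simp
  qed (use assms in auto)
  then show ?thesis by simp
qed

lemma ordered_along_foldl_bump:
  assumes "y \<in> ordered_along N" "set w \<inter> snd ` N = {}"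
  shows "foldl bump y w \<in> ordered_along N"
  unfolding ordered_along_def mem_Collect_eq
proof clarify
  fix hi lo assume e: "(hi, lo) \<in> N"
  then have "lo \<notin> set w" using assms(2) by force
  then show "foldl bump y w lo < foldl bump y w hi"
    using assms(1) e by (auto simp: ordered_along_def foldl_bump_apply)
qed

context growth_chain
begin

lemma mean_step_gap_power_le:
  assumes "hi \<in> I" "lo \<in> I" "y lo < y hi" "0 \<le> r" "r \<le> 1" "p y lo \<le> r * p y hi"
  shows "mean_step (\<lambda>y. r ^ (y hi - y lo)) y \<le> r ^ (y hi - y lo)"
proof -
  let ?g = "\<lambda>y. r ^ (y hi - y lo)"
  obtain a where a: "y hi = y lo + Suc a" using assms(3) less_imp_Suc_add by auto
  have ne: "hi \<noteq> lo" using assms(3) by auto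
  have "mean_step ?g y - ?g y = (\<Sum>l\<in>{hi, lo}. p y l * (?g (bump y l) - ?g y))"
    by (rule mean_step_drift) (use assms in auto)
  also have "\<dots> = (1 - r) * r ^ a * (p y lo - r * p y hi)"
    using ne a by (simp add: algebra_simps)
  also have "\<dots> \<le> 0"
    using assms by (intro mult_nonneg_nonpos mult_nonneg_nonneg) auto
  finally show ?thesis by simp
qed

lemma mean_step_gap_potential_le:
  assumes "N \<subseteq> I \<times> I" "0 \<le> r" "r \<le> 1" "y \<in> ordered_along N"
    and "\<And>hi lo. (hi, lo) \<in> N \<Longrightarrow> p y lo \<le> r * p y hi"
  shows "mean_step (gap_potential r N) y \<le> gap_potential r N y"
proof -
  have "mean_step (gap_potential r N) y = (\<Sum>e\<in>N. mean_step (\<lambda>y. r ^ (y (fst e) - y (snd e))) y)"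
    unfolding gap_potential_def[abs_def] case_prod_unfold by (rule mean_step_sum)
  also have "\<dots> \<le> (\<Sum>e\<in>N. r ^ (y (fst e) - y (snd e)))"
    by (intro sum_mono mean_step_gap_power_le) (use assms in \<open>auto simp: ordered_along_def\<close>)
  finally show ?thesis by (simp add: gap_potential_def case_prod_unfold)
qed

text \<open>The potential is a supermartingale on the ordered configurations, and bumping the upper sites
  sufficiently often makes it at most one half.\<close>

lemma persistent_ordered_along:
  assumes N: "finite N" "N \<subseteq> I \<times> I" "fst ` N \<inter> snd ` N = {}" and r: "0 \<le> r" "r < 1"
    and rates: "\<And>y hi lo. y \<in> ordered_along N \<Longrightarrow> (hi, lo) \<in> N \<Longrightarrow> p y lo \<le> r * p y hi"
  shows "persistent (ordered_along N)"
proof -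
  have "(\<lambda>k. real (card N) * r ^ k) \<longlonglongrightarrow> real (card N) * 0"
    using r by (intro tendsto_intros LIMSEQ_realpow_zero) auto
  then have "\<forall>\<^sub>F k in sequentially. real (card N) * r ^ k < 1 / 2"
    by (intro order_tendstoD(2)) auto
  then obtain k where k: "real (card N) * r ^ k < 1 / 2" by (auto simp: eventually_sequentially)
  obtain his where his: "set his = fst ` N" using finite_list[of "fst ` N"] N by auto
  define w where "w = concat (replicate k his)"
  have w: "set w \<subseteq> fst ` N" using his by (auto simp: w_def)
  have k_le: "k \<le> count_list w hi" if "(hi, lo) \<in> N" for hi lo
  proof -
    have "hi \<in> set his" using that his by force
    then have "1 \<le> count_list his hi" by (metis One_nat_def Suc_leI count_list_0_iff neq0_conv)
    then show ?thesis by (simp add: w_def count_list_concat_replicate)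
  qed
  show ?thesis
  proof (rule persistent_if_superharmonic[where w = w and f = "gap_potential r N"])
    show "set w \<subseteq> I" using w N(2) by fastforce
    fix y :: "'i \<Rightarrow> nat" assume y: "y \<in> ordered_along N"
    show "mean_step (gap_potential r N) y \<le> gap_potential r N y"
      by (rule mean_step_gap_potential_le) (use N r y rates in auto)
    show "foldl bump y (take i w) \<in> ordered_along N" for i
      by (rule ordered_along_foldl_bump[OF y]) (use w N(3) set_take_subset[of i w] in blast)
    have "gap_potential r N (foldl bump y w) \<le> real (card N) * r ^ k"
    proof (rule gap_potential_le)
      fix hi lo assume e: "(hi, lo) \<in> N"
      then have "lo \<notin> set w" using w N(3) by force
      then show "foldl bump y w lo + k \<le> foldl bump y w hi"
        using k_le[OF e] e y
        by (auto simp: ordered_along_def foldl_bump_apply intro!: add_mono less_imp_le)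
    qed (use r in auto)
    then show "gap_potential r N (foldl bump y w) \<le> 1 / 2" using k by simp
  qed (use r N in \<open>auto intro: gap_potential_nonneg gap_potential_ge_1\<close>)
qed

end

subsection \<open>The spread of a block\<close>

definition excess :: "'i set \<Rightarrow> ('i \<Rightarrow> nat) \<Rightarrow> 'i \<Rightarrow> real" where
  "excess T y i = (\<Sum>k\<in>T. real (y i) - real (y k))"

definition spread :: "'i set \<Rightarrow> ('i \<Rightarrow> nat) \<Rightarrow> real" where
  "spread T y = (\<Sum>i\<in>T. \<Sum>k\<in>T. (real (y i) - real (y k))\<^sup>2)"

lemma excess_eq: "excess T y i = real (card T) * real (y i) - (\<Sum>k\<in>T. real (y k))"
  by (simp add: excess_def sum_subtractf)

lemma sum_excess_eq_0: "(\<Sum>i\<in>T. excess T y i) = 0"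
  by (simp add: excess_eq sum_subtractf flip: sum_distrib_left)

lemma spread_nonneg: "0 \<le> spread T y"
  by (simp add: spread_def sum_nonneg)

lemma spread_eq:
  "spread T y = 2 * (real (card T) * (\<Sum>i\<in>T. (real (y i))\<^sup>2) - (\<Sum>i\<in>T. real (y i))\<^sup>2)"
proof -
  have "spread T y = (\<Sum>i\<in>T. \<Sum>k\<in>T. (real (y i))\<^sup>2 + (real (y k))\<^sup>2 - 2 * (real (y i) * real (y k)))"
    unfolding spread_def by (simp add: power2_diff mult.assoc)
  also have "\<dots> = 2 * (real (card T) * (\<Sum>i\<in>T. (real (y i))\<^sup>2)) - 2 * (\<Sum>i\<in>T. \<Sum>k\<in>T. real (y i) * real (y k))"
    by (simp add: sum_subtractf sum.distrib sum_distrib_left)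
  finally show ?thesis by (simp add: power2_eq_square sum_product)
qed

lemma sum_bump:
  assumes "finite T" "i \<in> T"
  shows "(\<Sum>k\<in>T. f (bump y i k)) = (\<Sum>k\<in>T. f (y k)) + (f (y i + 1) - f (y i) :: real)"
proof -
  have "(\<Sum>k\<in>T - {i}. f (bump y i k)) = (\<Sum>k\<in>T - {i}. f (y k))" by (intro sum.cong) auto
  then show ?thesis using assms by (simp add: sum.remove[of T i])
qed

lemma spread_bump:
  assumes "finite T" "i \<in> T"
  shows "spread T (bump y i) - spread T y = 4 * excess T y i + 2 * (real (card T) - 1)"
  using sum_bump[OF assms, of real y] sum_bump[OF assms, of "\<lambda>a. (real a)\<^sup>2" y]
  by (simp add: spread_eq excess_eq power2_eq_square algebra_simps)

lemma (in growth_chain) mean_step_spread: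
  assumes "T \<subseteq> I"
  shows "mean_step (spread T) y - spread T y = (\<Sum>i\<in>T. p y i * (4 * excess T y i + 2 * (real (card T) - 1)))"
proof -
  have T: "finite T" using assms finite_labels finite_subset by blast
  have "spread T (bump y i) = spread T y" if "i \<in> I - T" for i
  proof -
    have "bump y i a = y a" if "a \<in> T" for a using that \<open>i \<in> I - T\<close> by (metis Diff_iff bump_other)
    then show ?thesis by (simp add: spread_def)
  qed
  then have "mean_step (spread T) y - spread T y = (\<Sum>i\<in>T. p y i * (spread T (bump y i) - spread T y))"
    using assms by (intro mean_step_drift)
  then show ?thesis using T by (simp add: spread_bump)
qed

subsection \<open>Peaks and valleys\<close>

definition valleys :: "nat \<Rightarrow> (nat \<Rightarrow> nat) \<Rightarrow> nat set" where
  "valleys n y = {j. 1 < j \<and> j < n \<and> y j < y (j - 1) \<and> y j < y (j + 1)}"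

definition peaks :: "nat \<Rightarrow> (nat \<Rightarrow> nat) \<Rightarrow> nat set" where
  "peaks n y = {j. 1 \<le> j \<and> j \<le> n \<and> (1 < j \<longrightarrow> y (j - 1) < y j) \<and> (j < n \<longrightarrow> y (j + 1) < y j)}"

lemma mem_valleys_iff: "j \<in> valleys n y \<longleftrightarrow> 1 < j \<and> j < n \<and> y j < y (j - 1) \<and> y j < y (j + 1)"
  by (simp add: valleys_def)

lemma mem_peaks_iff: "j \<in> peaks n y \<longleftrightarrow>
    1 \<le> j \<and> j \<le> n \<and> (1 < j \<longrightarrow> y (j - 1) < y j) \<and> (j < n \<longrightarrow> y (j + 1) < y j)"
  by (simp add: peaks_def)

lemma valleys_not_adjacent: "j \<in> valleys n y \<Longrightarrow> j + 1 \<notin> valleys n y"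
  by (auto simp: mem_valleys_iff)

lemma peaks_not_adjacent: "j \<in> peaks n y \<Longrightarrow> j + 1 \<notin> peaks n y"
  by (auto simp: mem_peaks_iff)

lemma Vn_eq: "1 \<le> j \<Longrightarrow> j \<le> n \<Longrightarrow>
    Vn n y j = of_bool (1 < j \<and> y j < y (j - 1)) + of_bool (j < n \<and> y j < y (j + 1))"
  unfolding Vn_def ext_def by auto

lemma Vn_cases:
  obtains "Vn n y j = 0" | "Vn n y j = 1" | "Vn n y j = 2"
  using that
  unfolding Vn_def
  by (cases "ext n y j < ext n y (j - 1)"; cases "ext n y j < ext n y (j + 1)") auto

lemma Vn_eq_2_iff: "1 \<le> j \<Longrightarrow> j \<le> n \<Longrightarrow> Vn n y j = 2 \<longleftrightarrow> j \<in> valleys n y"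
  by (auto simp: Vn_eq mem_valleys_iff)

lemma Vn_eq_0_if_peak: "j \<in> peaks n y \<Longrightarrow> Vn n y j = 0"
  by (auto simp: Vn_eq mem_peaks_iff)

lemma bump_mem_peaks: "1 \<le> j \<Longrightarrow> j \<le> n \<Longrightarrow> Vn n y j = 0 \<Longrightarrow> j \<in> peaks n (bump y j)"
  by (auto simp: Vn_eq mem_peaks_iff not_less bump_apply)

subsection \<open>The crystal jump chain\<close>

locale crystal_model =
  fixes b0 b1 b2 :: real and n :: nat
  assumes b_pos: "0 < b0" "0 < b1" "0 < b2" and n_ge: "2 \<le> n"
begin

abbreviation V :: "(nat \<Rightarrow> nat) \<Rightarrow> nat \<Rightarrow> nat" where "V \<equiv> Vn n"
abbreviation site_rate :: "(nat \<Rightarrow> nat) \<Rightarrow> nat \<Rightarrow> real" where "site_rate \<equiv> rate b0 b1 b2 n"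
abbreviation q :: "(nat \<Rightarrow> nat) \<Rightarrow> real" where "q \<equiv> total_rate b0 b1 b2 n"
abbreviation valleys_at :: "nat set \<Rightarrow> (nat \<Rightarrow> nat) set" where "valleys_at W \<equiv> {y. valleys n y = W}"
abbreviation peaks_at :: "nat set \<Rightarrow> (nat \<Rightarrow> nat) set" where "peaks_at P \<equiv> {y. peaks n y = P}"

definition min_rate :: real where "min_rate = min b0 (min b1 b2)"
definition max_rate :: real where "max_rate = max b0 (max b1 b2)"
definition jump_prob :: "(nat \<Rightarrow> nat) \<Rightarrow> nat \<Rightarrow> real" where "jump_prob y j = site_rate y j / q y"

lemma site_rate_eq:
  "V y j = 0 \<Longrightarrow> site_rate y j = b0" "V y j = 1 \<Longrightarrow> site_rate y j = b1" "V y j = 2 \<Longrightarrow> site_rate y j = b2"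
  by (simp_all add: rate_def beta_def)

lemma min_rate_pos: "0 < min_rate" and max_rate_pos: "0 < max_rate"
  using b_pos by (auto simp: min_rate_def max_rate_def)

lemma site_rate_ge: "min_rate \<le> site_rate y j" and site_rate_le: "site_rate y j \<le> max_rate"
  by (auto simp: rate_def beta_def min_rate_def max_rate_def)

lemma site_rate_pos: "0 < site_rate y j"
  using site_rate_ge[of y j] min_rate_pos by linarith

lemma q_ge: "real n * min_rate \<le> q y"
  using sum_mono[of "{1..n}" "\<lambda>_. min_rate" "site_rate y"] site_rate_ge
  by (simp add: total_rate_def)

lemma q_le: "q y \<le> real n * max_rate"
  using sum_mono[of "{1..n}" "site_rate y" "\<lambda>_. max_rate"] site_rate_le
  by (simp add: total_rate_def)

lemma n_min_rate_pos: "0 < real n * min_rate" and n_max_rate_pos: "0 < real n * max_rate"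
  using n_ge min_rate_pos max_rate_pos by auto

lemma q_pos: "0 < q y"
  using q_ge[of y] n_min_rate_pos by linarith

sublocale growth_chain jump_prob "{1..n}" "min_rate / (real n * max_rate)"
proof unfold_locales
  show "0 < min_rate / (real n * max_rate)" using min_rate_pos n_max_rate_pos by simp
  show "min_rate / (real n * max_rate) \<le> jump_prob y i" for y i
    unfolding jump_prob_def
    using site_rate_ge[of y i] q_le[of y] q_pos[of y] min_rate_pos by (intro frac_le) auto
  show "(\<Sum>i\<in>{1..n}. jump_prob y i) = 1" for y
    using q_pos[of y] by (simp add: jump_prob_def total_rate_def flip: sum_divide_distrib)
qed auto

lemma jump_prob_le: "site_rate y i \<le> r * site_rate y j \<Longrightarrow> jump_prob y i \<le> r * jump_prob y j"
  unfolding jump_prob_def using q_pos[of y] by (simp add: divide_right_mono)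

lemma jump_prob_eq: "site_rate y i = site_rate y j \<Longrightarrow> jump_prob y i = jump_prob y j"
  by (simp add: jump_prob_def)

subsubsection \<open>Persistence of valleys and peaks\<close>

lemma valleys_persistent:
  assumes "b2 < b0" "b2 < b1"
  shows "persistent {y. j \<in> valleys n y}"
proof (cases "1 < j \<and> j < n")
  case False
  then have "{y. j \<in> valleys n y} = {}" by (auto simp: mem_valleys_iff)
  then show ?thesis using persistent_empty by metis
next
  case True
  define N where "N = {(j - 1, j), (j + 1, j)}"
  have N: "{y. j \<in> valleys n y} = ordered_along N"
    using True by (auto simp: mem_valleys_iff N_def ordered_along_def)
  show ?thesis
    unfolding N
  proof (rule persistent_ordered_along[where r = "b2 / min b0 b1"])
    fix y :: "nat \<Rightarrow> nat" and hi lo assume y: "y \<in> ordered_along N" and e: "(hi, lo) \<in> N"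
    have "j \<in> valleys n y" using y unfolding N[symmetric] by simp
    then have lo_rate: "site_rate y lo = b2"
      using True e Vn_eq_2_iff[of j n y] by (auto simp: site_rate_eq N_def)
    have "hi \<notin> valleys n y" using y e by (auto simp: N_def ordered_along_def mem_valleys_iff)
    moreover have "1 \<le> hi" "hi \<le> n" using True e by (auto simp: N_def)
    ultimately have "V y hi \<noteq> 2" using Vn_eq_2_iff by blast
    then have "min b0 b1 \<le> site_rate y hi"
      by (cases rule: Vn_cases[of n y hi]) (auto simp: site_rate_eq)
    then have "b2 \<le> b2 / min b0 b1 * site_rate y hi"
      using b_pos by (auto simp: field_simps min_def split: if_splits)
    then show "jump_prob y lo \<le> b2 / min b0 b1 * jump_prob y hi"
      using lo_rate by (intro jump_prob_le) simp
  qed (use True b_pos assms in \<open>auto simp: N_def\<close>)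
qed

lemma peaks_persistent:
  assumes "b1 < b0" "b2 < b0"
  shows "persistent {y. j \<in> peaks n y}"
proof (cases "1 \<le> j \<and> j \<le> n")
  case False
  then have "{y. j \<in> peaks n y} = {}" by (auto simp: mem_peaks_iff)
  then show ?thesis using persistent_empty by metis
next
  case True
  define N where "N = (if 1 < j then {(j, j - 1)} else {}) \<union> (if j < n then {(j, j + 1)} else {})"
  have N: "{y. j \<in> peaks n y} = ordered_along N"
    using True by (auto simp: mem_peaks_iff N_def ordered_along_def)
  show ?thesis
    unfolding N
  proof (rule persistent_ordered_along[where r = "max b1 b2 / b0"])
    fix y :: "nat \<Rightarrow> nat" and hi lo assume y: "y \<in> ordered_along N" and e: "(hi, lo) \<in> N"
    have "j \<in> peaks n y" using y unfolding N[symmetric] by simp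
    then have "site_rate y hi = b0"
      using e Vn_eq_0_if_peak by (auto simp: site_rate_eq N_def split: if_splits)
    moreover have "V y lo \<noteq> 0"
      using True y e by (auto simp: N_def ordered_along_def Vn_eq split: if_splits)
    then have "site_rate y lo \<le> max b1 b2"
      by (cases rule: Vn_cases[of n y lo]) (auto simp: site_rate_eq)
    ultimately show "jump_prob y lo \<le> max b1 b2 / b0 * jump_prob y hi"
      using b_pos by (intro jump_prob_le) simp
  qed (use True b_pos assms in \<open>auto simp: N_def split: if_splits\<close>)
qed

subsubsection \<open>Sites with equal rates\<close>

lemma leaves_peaks_at:
  "j \<in> peaks n (foldl bump y w) \<Longrightarrow> j \<notin> P \<Longrightarrow> set w \<subseteq> {1..n} \<Longrightarrow> length w \<le> L \<Longrightarrow> leaves_within L (peaks_at P) y"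
  by (rule leaves_withinI) auto

lemma leaves_valleys_at:
  "j \<in> valleys n (foldl bump y w) \<Longrightarrow> j \<notin> W \<Longrightarrow> set w \<subseteq> {1..n} \<Longrightarrow> length w \<le> L \<Longrightarrow> leaves_within L (valleys_at W) y"
  by (rule leaves_withinI) auto

lemma leaves_peaks_at_if_V_eq_0:
  "1 \<le> j \<Longrightarrow> j \<le> n \<Longrightarrow> V y j = 0 \<Longrightarrow> j \<notin> P \<Longrightarrow> leaves_within 1 (peaks_at P) y"
  using leaves_peaks_at[of j y "[j]"] bump_mem_peaks[of j n y] by simp

lemma surely_left_adjacent_unlabelled:
  assumes j: "1 \<le> j" "j + 1 \<le> n" and unlabelled: "j \<notin> P" "j + 1 \<notin> P" "j \<notin> W" "j + 1 \<notin> W"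
  shows "surely_left (peaks_at P \<inter> valleys_at W)"
proof (rule surely_left_two_stage[where G = "{y. V y j = 0 \<or> V y (j + 1) = 0 \<or> y j = y (j + 1)}" and L = 1])
  show "surely_left (peaks_at P \<inter> valleys_at W - {y. V y j = 0 \<or> V y (j + 1) = 0 \<or> y j = y (j + 1)})"
  proof (rule surely_left_neutral_pair[of j "j + 1"])
    fix y assume y: "y \<in> peaks_at P \<inter> valleys_at W - {y. V y j = 0 \<or> V y (j + 1) = 0 \<or> y j = y (j + 1)}"
    then have "V y j \<noteq> 2" "V y (j + 1) \<noteq> 2"
      using j unlabelled Vn_eq_2_iff[of j n y] Vn_eq_2_iff[of "j + 1" n y] by auto
    then have "V y j = 1" "V y (j + 1) = 1"
      using y by (cases rule: Vn_cases[of n y j]; cases rule: Vn_cases[of n y "j + 1"]; auto)+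
    then show "jump_prob y j = jump_prob y (j + 1)" by (simp add: jump_prob_eq site_rate_eq)
  qed (use j in auto)
next
  fix y assume "y \<in> {y. V y j = 0 \<or> V y (j + 1) = 0 \<or> y j = y (j + 1)}"
  then consider "V y j = 0" | "V y (j + 1) = 0" | "V y (j + 1) \<noteq> 0" "y j = y (j + 1)" by auto
  then show "leaves_within 1 (peaks_at P \<inter> valleys_at W) y"
  proof cases
    case 1
    then have "leaves_within 1 (peaks_at P) y"
      using j unlabelled by (intro leaves_peaks_at_if_V_eq_0) auto
    then show ?thesis by (rule leaves_within_mono) auto
  next
    case 2
    then have "leaves_within 1 (peaks_at P) y"
      using j unlabelled by (intro leaves_peaks_at_if_V_eq_0[of "j + 1"]) auto
    then show ?thesis by (rule leaves_within_mono) auto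
  next
    case 3
    then have "j + 1 \<in> valleys n (foldl bump y [j])" using j
      by (auto simp: Vn_eq mem_valleys_iff bump_apply split: if_splits)
    then have "leaves_within 1 (valleys_at W) y"
      by (rule leaves_valleys_at) (use j unlabelled in auto)
    then show ?thesis by (rule leaves_within_mono) auto
  qed
qed

lemma surely_left_edge_without_peak:
  assumes edge: "(i = 1 \<and> j = 2) \<or> (i = n \<and> j = n - 1)" and P: "i \<notin> P" "j \<notin> P"
  shows "surely_left (peaks_at P)"
proof (rule surely_left_two_stage[where G = "{y. V y i = 0 \<or> V y j = 0}" and L = 1])
  show "surely_left (peaks_at P - {y. V y i = 0 \<or> V y j = 0})"
  proof (rule surely_left_neutral_pair[of i j])
    fix y assume y: "y \<in> peaks_at P - {y. V y i = 0 \<or> V y j = 0}"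
    then have lt: "y i < y j" using edge n_ge by (auto simp: Vn_eq numeral_2_eq_2)
    then show "y i \<noteq> y j" by simp
    have "V y i = 1" "V y j = 1" using edge n_ge y lt by (auto simp: Vn_eq numeral_2_eq_2)
    then show "jump_prob y i = jump_prob y j" by (simp add: jump_prob_eq site_rate_eq)
  qed (use edge n_ge in auto)
next
  fix y assume "y \<in> {y. V y i = 0 \<or> V y j = 0}"
  then show "leaves_within 1 (peaks_at P) y"
    using leaves_peaks_at_if_V_eq_0[of i y P] leaves_peaks_at_if_V_eq_0[of j y P] edge P n_ge
    by auto
qed

lemma surely_left_neutral_block_without_peak:
  assumes "b1 = b2" and j: "1 \<le> j" "j + 2 \<le> n" and P: "j \<notin> P" "j + 1 \<notin> P" "j + 2 \<notin> P"
  shows "surely_left (peaks_at P)"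
proof (rule surely_left_two_stage[where G = "{y. \<exists>k\<in>{j, j + 1, j + 2}. V y k = 0}" and L = 1])
  show "surely_left (peaks_at P - {y. \<exists>k\<in>{j, j + 1, j + 2}. V y k = 0})"
  proof (rule surely_left_neutral_triple_without_strict_max[of j "j + 1" "j + 2"])
    fix y assume y: "y \<in> peaks_at P - {y. \<exists>k\<in>{j, j + 1, j + 2}. V y k = 0}"
    have "site_rate y k = b2" if "k \<in> {j, j + 1, j + 2}" for k
      using y that assms(1) by (cases rule: Vn_cases[of n y k]) (auto simp: rate_def beta_def)
    then show "jump_prob y j = jump_prob y (j + 1)" "jump_prob y (j + 1) = jump_prob y (j + 2)"
      by (simp_all add: jump_prob_eq)
    show "\<not> (y j < y (j + 1) \<and> y (j + 2) < y (j + 1))" using y j P by (auto simp: mem_peaks_iff)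
  qed (use j in auto)
next
  fix y assume "y \<in> {y. \<exists>k\<in>{j, j + 1, j + 2}. V y k = 0}"
  then obtain k where "k \<in> {j, j + 1, j + 2}" "V y k = 0" by auto
  then show "leaves_within 1 (peaks_at P) y" using leaves_peaks_at_if_V_eq_0[of k y P] j P by auto
qed

lemma surely_left_neutral_block_without_valley:
  assumes "b0 = b1" and j: "1 \<le> j" "j + 2 \<le> n" and W: "j \<notin> W" "j + 1 \<notin> W" "j + 2 \<notin> W"
  shows "surely_left (valleys_at W)"
proof (rule surely_left_neutral_triple_without_strict_min[of j "j + 1" "j + 2"])
  fix y assume y: "y \<in> valleys_at W"
  have "site_rate y k = b1" if k: "k \<in> {j, j + 1, j + 2}" for k
  proof -
    have "V y k \<noteq> 2" using k j W y Vn_eq_2_iff[of k n y] by auto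
    then show ?thesis
      using assms(1) by (cases rule: Vn_cases[of n y k]) (auto simp: rate_def beta_def)
  qed
  then show "jump_prob y j = jump_prob y (j + 1)" "jump_prob y (j + 1) = jump_prob y (j + 2)"
    by (simp_all add: jump_prob_eq)
  show "\<not> (y (j + 1) < y j \<and> y (j + 1) < y (j + 2))" using y j W by (auto simp: mem_valleys_iff)
qed (use j in auto)

end

subsection \<open>Contracting blocks\<close>

definition balanced :: "'i set \<Rightarrow> nat \<Rightarrow> ('i \<Rightarrow> nat) \<Rightarrow> bool" where
  "balanced T C y \<longleftrightarrow> (\<forall>i\<in>T. \<forall>k\<in>T. y i \<le> y k + C)"

lemma excess_nonneg_at_max: "(\<And>k. k \<in> T \<Longrightarrow> y k \<le> y i) \<Longrightarrow> 0 \<le> excess T y i"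
  unfolding excess_def by (intro sum_nonneg) auto

lemma excess_ge_at_max:
  assumes "finite T" "\<And>k. k \<in> T \<Longrightarrow> y k \<le> y i" "\<not> balanced T C y"
  shows "real C \<le> excess T y i"
proof -
  obtain j k where jk: "j \<in> T" "k \<in> T" "y k + C < y j"
    using assms(3) by (auto simp: balanced_def not_le)
  have "real C \<le> real (y i) - real (y k)" using assms(2)[OF jk(1)] jk(3) by linarith
  also have "\<dots> \<le> excess T y i"
    unfolding excess_def by (rule member_le_sum) (use assms jk in auto)
  finally show ?thesis .
qed

lemma count_list_distinct: "distinct xs \<Longrightarrow> count_list xs a = of_bool (a \<in> set xs)"
  by (induction xs) auto

context crystal_model
begin

lemma q_mult_spread_drift:
  assumes "T \<subseteq> {1..n}"
  shows "q y * (mean_step (spread T) y - spread T y) =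
    4 * (\<Sum>i\<in>T. site_rate y i * excess T y i) + 2 * (real (card T) - 1) * (\<Sum>i\<in>T. site_rate y i)"
proof -
  have "q y * jump_prob y i = site_rate y i" for i using q_pos[of y] by (simp add: jump_prob_def)
  then have "q y * (mean_step (spread T) y - spread T y)
      = (\<Sum>i\<in>T. site_rate y i * (4 * excess T y i + 2 * (real (card T) - 1)))"
    unfolding mean_step_spread[OF assms] sum_distrib_left mult.assoc[symmetric] by simp
  then show ?thesis
    by (simp add: distrib_left sum.distrib sum_distrib_left sum_distrib_right mult_ac)
qed

lemma q_mult_spread_drift_le:
  assumes T: "T \<subseteq> {1..n}" "T \<noteq> {}" and rate_le: "\<And>i. i \<in> T \<Longrightarrow> site_rate y i \<le> r"
    and contraction: "(\<Sum>i\<in>T. site_rate y i * excess T y i) \<le> - s"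
  shows "q y * (mean_step (spread T) y - spread T y) \<le> 2 * (real (card T))\<^sup>2 * r - 4 * s"
proof -
  have "1 \<le> card T" using T finite_subset[OF T(1)] by (simp add: Suc_le_eq card_gt_0_iff)
  moreover have "(\<Sum>i\<in>T. site_rate y i) \<le> real (card T) * r"
    using sum_mono[of T "site_rate y" "\<lambda>_. r"] rate_le by simp
  ultimately have "2 * (real (card T) - 1) * (\<Sum>i\<in>T. site_rate y i) \<le> 2 * real (card T) * (real (card T) * r)"
    using site_rate_pos by (intro mult_mono) (auto intro: sum_nonneg less_imp_le)
  then show ?thesis
    unfolding q_mult_spread_drift[OF T(1)] using contraction by (simp add: power2_eq_square)
qed

text \<open>The excesses sum to zero, so only the deviation of the rates from a constant matters.\<close>

lemma sum_rate_mult_excess: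
  "(\<Sum>i\<in>T. site_rate y i * excess T y i) = (\<Sum>i\<in>T. (site_rate y i - r) * excess T y i)"
  using sum_excess_eq_0[of T y]
  by (simp add: left_diff_distrib sum_subtractf flip: sum_distrib_left)

subsubsection \<open>Blocks without valleys\<close>

lemma leaves_valleys_at_between:
  assumes "1 \<le> u" "u < v" "v < w" "w \<le> n" "y v < y u" "y v < y w" and W: "W \<inter> {u<..<w} = {}"
  shows "leaves_within n (valleys_at W) y"
proof -
  have v: "v \<in> {u<..<w}" using assms by simp
  then have "{u<..<w} \<noteq> {}" by blast
  then obtain v0 where v0: "v0 \<in> {u<..<w}" "Min (y ` {u<..<w}) = y v0"
    by (rule obtains_MIN[OF finite_greaterThanLessThan])
  have le: "y v0 \<le> y k" if "k \<in> {u<..<w}" for k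
    unfolding v0(2)[symmetric] using that by (intro Min_le) auto
  define Z where "Z = {z \<in> {u<..<w}. y z = y v0} - {v0}"
  have Z: "finite Z" "Z \<subseteq> {1..n}" using assms by (auto simp: Z_def)
  obtain zs where zs: "set zs = Z" "distinct zs" using finite_distinct_list[OF Z(1)] by auto
  have raised: "foldl bump y zs k = y k + of_bool (k \<in> Z)" for k
    using zs by (simp add: foldl_bump_apply count_list_distinct)
  have neighbour: "y v0 < foldl bump y zs k" if k: "k = v0 - 1 \<or> k = v0 + 1" for k
  proof -
    have "k = u \<or> k = w \<or> k \<in> {u<..<w}" using k v0(1) by auto
    moreover have "y v0 < foldl bump y zs k" if "k \<in> {u<..<w}"
      using le[OF that] k v0(1) that by (cases "y k = y v0") (auto simp: raised Z_def)
    ultimately show ?thesis using assms le[OF v] by (auto simp: raised)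
  qed
  show ?thesis
  proof (rule leaves_valleys_at)
    show "v0 \<in> valleys n (foldl bump y zs)"
      using neighbour[of "v0 - 1"] neighbour[of "v0 + 1"] v0 assms
      by (auto simp: mem_valleys_iff raised[of v0] Z_def)
    show "v0 \<notin> W" using v0(1) W by blast
    show "set zs \<subseteq> {1..n}" using zs Z by simp
    show "length zs \<le> n" using card_mono[OF _ Z(2)] zs distinct_card[of zs] by simp
  qed
qed

lemma leaves_valleys_at_low_top:
  assumes T: "{a..b} \<subseteq> {1..n}" "W \<inter> {a..b} = {}" and i: "i \<in> {a..b}" "V y i = 0" and k: "k \<in> {a..b}" "y i < y k"
  shows "leaves_within (Suc n) (valleys_at W) y"
proof (rule leaves_within_step)
  have range: "1 \<le> i" "i \<le> n" "1 \<le> k" "k \<le> n" "i \<noteq> k" using i k T by auto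
  show "leaves_within n (valleys_at W) (bump y i)"
  proof (cases "i < k")
    case True
    then have "y (i + 1) \<le> y i" using i range by (auto simp: Vn_eq)
    moreover from this have "i + 1 \<noteq> k" using k by auto
    ultimately show ?thesis
      by (intro leaves_valleys_at_between[of i "i + 1" k]) (use range True i k T in \<open>auto simp: bump_apply\<close>)
  next
    case False
    then have "k < i" using range by simp
    then have "y (i - 1) \<le> y i" using i range by (auto simp: Vn_eq)
    moreover from this have "i - 1 \<noteq> k" using k by auto
    ultimately show ?thesis
      by (intro leaves_valleys_at_between[of k "i - 1" i]) (use range \<open>k < i\<close> i k T in \<open>auto simp: bump_apply\<close>)
  qed
  show "i \<in> {1..n}" using range by simp
qed

lemma leaves_valleys_at_balanced:
  assumes ab: "1 \<le> a" "a + 2 \<le> b" "b \<le> n" and W: "W \<inter> {a..b} = {}" and balanced: "balanced {a..b} C y"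
  shows "leaves_within (2 * (C + 1)) (valleys_at W) y"
proof (rule leaves_valleys_at)
  have "y (a + 1) \<le> y a + C" "y (a + 1) \<le> y (a + 2) + C"
    using balanced ab by (auto simp: balanced_def)
  then show "a + 1 \<in> valleys n (foldl bump y (replicate (C + 1) a @ replicate (C + 1) (a + 2)))"
    using ab by (auto simp: mem_valleys_iff foldl_bump_apply count_list_replicate)
qed (use ab W in auto)

lemma V_eq_0_at_block_max:
  assumes "{a..b} \<subseteq> {1..n}" and ends: "a = 1 \<or> a - 1 \<in> valleys n y" "b = n \<or> b + 1 \<in> valleys n y"
    and i: "i \<in> {a..b}" and max: "\<And>k. k \<in> {a..b} \<Longrightarrow> y k \<le> y i"
  shows "V y i = 0"
proof -
  have "y (i - 1) \<le> y i" if "1 < i"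
  proof (cases "i = a")
    case True
    then show ?thesis using ends(1) that by (auto simp: mem_valleys_iff)
  next
    case False
    then show ?thesis using i by (intro max) auto
  qed
  moreover have "y (i + 1) \<le> y i" if "i < n"
  proof (cases "i = b")
    case True
    then show ?thesis using ends(2) that by (auto simp: mem_valleys_iff)
  next
    case False
    then show ?thesis using i by (intro max) auto
  qed
  moreover have "1 \<le> i" "i \<le> n" using i assms(1) by auto
  ultimately show ?thesis by (auto simp: Vn_eq)
qed

lemma sum_rate_mult_excess_le_at_tops:
  assumes "b0 < b1" "finite T" and V: "\<And>i. i \<in> T \<Longrightarrow> V y i = 0 \<or> V y i = 1"
    and top: "\<And>i k. i \<in> T \<Longrightarrow> V y i = 0 \<Longrightarrow> k \<in> T \<Longrightarrow> y k \<le> y i"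
    and i0: "i0 \<in> T" "V y i0 = 0" and "\<not> balanced T C y"
  shows "(\<Sum>i\<in>T. site_rate y i * excess T y i) \<le> - ((b1 - b0) * real C)"
proof -
  have "(b1 - b0) * real C \<le> (b1 - site_rate y i0) * excess T y i0"
    unfolding site_rate_eq(1)[OF i0(2)]
    using assms(1) excess_ge_at_max[OF assms(2) top[OF i0] assms(7)] by (intro mult_left_mono) auto
  also have "\<dots> \<le> (\<Sum>i\<in>T. (b1 - site_rate y i) * excess T y i)"
  proof (rule member_le_sum)
    fix i assume i: "i \<in> T - {i0}"
    have "0 \<le> excess T y i" if "V y i = 0" using i that top by (intro excess_nonneg_at_max) auto
    then show "0 \<le> (b1 - site_rate y i) * excess T y i"
      using V[of i] i assms(1) by (auto simp: site_rate_eq)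
  qed (use i0 assms(2) in auto)
  finally show ?thesis
    unfolding sum_rate_mult_excess[where r = b1] by (simp add: left_diff_distrib sum_subtractf)
qed

lemma spread_drift_without_valley:
  assumes "b0 < b1" and T: "{a..b} \<subseteq> {1..n}" "a \<le> b"
    and ends: "a = 1 \<or> a - 1 \<in> valleys n y" "b = n \<or> b + 1 \<in> valleys n y"
    and no_valley: "valleys n y \<inter> {a..b} = {}"
    and top: "\<And>i k. i \<in> {a..b} \<Longrightarrow> V y i = 0 \<Longrightarrow> k \<in> {a..b} \<Longrightarrow> y k \<le> y i"
    and unbalanced: "\<not> balanced {a..b} C y"
  shows "q y * (mean_step (spread {a..b}) y - spread {a..b} y)
    \<le> 2 * (real (card {a..b}))\<^sup>2 * b1 - 4 * ((b1 - b0) * real C)"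
proof -
  have V: "V y i = 0 \<or> V y i = 1" if "i \<in> {a..b}" for i
  proof -
    have "1 \<le> i" "i \<le> n" "i \<notin> valleys n y" using that T no_valley by auto
    then have "V y i \<noteq> 2" using Vn_eq_2_iff by blast
    then show ?thesis by (cases rule: Vn_cases[of n y i]) auto
  qed
  have nonempty: "{a..b} \<noteq> {}" using T(2) by simp
  then obtain i0 where i0: "i0 \<in> {a..b}" "Max (y ` {a..b}) = y i0"
    by (rule obtains_MAX[OF finite_atLeastAtMost])
  have "y k \<le> y i0" if "k \<in> {a..b}" for k
    unfolding i0(2)[symmetric] using that by (intro Max_ge) auto
  then have "V y i0 = 0" by (rule V_eq_0_at_block_max[OF T(1) ends i0(1)])
  then have "(\<Sum>i\<in>{a..b}. site_rate y i * excess {a..b} y i) \<le> - ((b1 - b0) * real C)"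
    by (intro sum_rate_mult_excess_le_at_tops[OF assms(1) _ V top i0(1)] unbalanced finite_atLeastAtMost)
  moreover have "site_rate y i \<le> b1" if "i \<in> {a..b}" for i
    using V[OF that] assms(1) by (auto simp: site_rate_eq)
  ultimately show ?thesis by (intro q_mult_spread_drift_le[OF T(1) nonempty])
qed

definition valley_exit_states :: "nat set \<Rightarrow> nat \<Rightarrow> (nat \<Rightarrow> nat) set" where
  "valley_exit_states T C = {y. (\<exists>i\<in>T. V y i = 0 \<and> (\<exists>k\<in>T. y i < y k)) \<or> balanced T C y}"

lemma leaves_valleys_at_exit_states:
  assumes ab: "1 \<le> a" "a + 2 \<le> b" "b \<le> n" and W: "W \<inter> {a..b} = {}" and y: "y \<in> valley_exit_states {a..b} C"
  shows "leaves_within (n + 1 + 2 * (C + 1)) (valleys_at W) y"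
proof -
  consider i k where "i \<in> {a..b}" "V y i = 0" "k \<in> {a..b}" "y i < y k" | "balanced {a..b} C y"
    using y unfolding valley_exit_states_def by blast
  then show ?thesis
  proof cases
    case (1 i k)
    then have "leaves_within (Suc n) (valleys_at W) y"
      by (intro leaves_valleys_at_low_top[of a b W i y k] W) (use ab in auto)
    then show ?thesis by (rule leaves_within_mono) auto
  next
    case 2
    then have "leaves_within (2 * (C + 1)) (valleys_at W) y"
      by (rule leaves_valleys_at_balanced[OF ab W])
    then show ?thesis by (rule leaves_within_mono) auto
  qed
qed

lemma surely_left_contracting_block_without_valley:
  assumes "b0 < b1" and ab: "1 \<le> a" "a + 2 \<le> b" "b \<le> n" and W: "W \<inter> {a..b} = {}"
    and ends: "a = 1 \<or> a - 1 \<in> W" "b = n \<or> b + 1 \<in> W"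
  shows "surely_left (valleys_at W)"
proof -
  define T where "T = {a..b}"
  obtain C :: nat where C: "2 * (real (card T))\<^sup>2 * b1 + 1 \<le> real C * (4 * (b1 - b0))"
    using ex_less_of_nat_mult[of "4 * (b1 - b0)" "2 * (real (card T))\<^sup>2 * b1 + 1"] assms(1)
    by (auto intro: less_imp_le)
  show ?thesis
  proof (rule surely_left_two_stage[where G = "valley_exit_states T C"])
    show "surely_left (valleys_at W - valley_exit_states T C)"
    proof (rule surely_left_Foster[where f = "spread T" and \<epsilon> = "1 / (real n * max_rate)"])
      fix y assume y: "y \<in> valleys_at W - valley_exit_states T C"
      have "q y * (mean_step (spread T) y - spread T y)
          \<le> 2 * (real (card T))\<^sup>2 * b1 - 4 * ((b1 - b0) * real C)"
        unfolding T_def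
      proof (rule spread_drift_without_valley)
        show "y k \<le> y i" if "i \<in> {a..b}" "V y i = 0" "k \<in> {a..b}" for i k
          using y that[folded T_def] by (auto simp: valley_exit_states_def not_less)
      qed (use assms y in \<open>auto simp: T_def valley_exit_states_def\<close>)
      then have "mean_step (spread T) y - spread T y \<le> - 1 / q y"
        using C q_pos[of y] by (simp add: field_simps)
      also have "\<dots> \<le> - 1 / (real n * max_rate)" using q_le[of y] q_pos[of y] by (simp add: frac_le)
      finally show "mean_step (spread T) y \<le> spread T y - 1 / (real n * max_rate)" by simp
    qed (use n_max_rate_pos spread_nonneg in auto)
  next
    fix y assume "y \<in> valley_exit_states T C"
    then show "leaves_within (n + 1 + 2 * (C + 1)) (valleys_at W) y"
      unfolding T_def by (rule leaves_valleys_at_exit_states[OF ab W])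
  qed
qed

end

subsubsection \<open>Blocks without peaks\<close>

definition elevation :: "'i set \<Rightarrow> ('i \<Rightarrow> nat) \<Rightarrow> real" where
  "elevation T y = (\<Sum>k\<in>T. real (y k) - real (Min (y ` T)))"

lemma elevation_nonneg: "finite T \<Longrightarrow> 0 \<le> elevation T y"
  unfolding elevation_def by (intro sum_nonneg) auto

lemma elevation_bump_le:
  assumes "finite T" "T \<noteq> {}"
  shows "elevation T (bump y i) \<le> elevation T y + 1"
proof -
  have "Min (y ` T) \<le> Min (bump y i ` T)"
  proof (rule Min.boundedI)
    fix a assume "a \<in> bump y i ` T"
    then obtain k where "k \<in> T" "a = bump y i k" by blast
    then show "Min (y ` T) \<le> a" using assms(1) by (auto simp: bump_apply intro: le_SucI)
  qed (use assms in auto)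
  then have "elevation T (bump y i) \<le> (\<Sum>k\<in>T. (real (y k) - real (Min (y ` T))) + (if k = i then 1 else 0))"
    unfolding elevation_def by (intro sum_mono) (auto simp: bump_apply)
  also have "\<dots> \<le> elevation T y + 1" using assms by (simp add: sum.distrib elevation_def)
  finally show ?thesis .
qed

lemma excess_at_min:
  assumes "finite T" "i \<in> T" "\<And>k. k \<in> T \<Longrightarrow> y i \<le> y k"
  shows "excess T y i = - elevation T y"
proof -
  have "Min (y ` T) = y i" using assms by (intro Min_eqI) auto
  then show ?thesis by (simp add: excess_def elevation_def flip: sum_negf)
qed

lemma elevation_ge_if_not_balanced:
  assumes "finite T" "\<not> balanced T C y"
  shows "real C \<le> elevation T y"
proof -
  obtain i k where ik: "i \<in> T" "k \<in> T" "y k + C < y i"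
    using assms(2) by (auto simp: balanced_def not_le)
  have "Min (y ` T) \<le> y k" using assms(1) ik(2) by simp
  then have "real C \<le> real (y i) - real (Min (y ` T))" using ik(3) by linarith
  also have "\<dots> \<le> elevation T y"
    unfolding elevation_def by (rule member_le_sum) (use ik assms(1) in auto)
  finally show ?thesis .
qed

lemma bump_plateau_mem_valleys:
  assumes "Vn n y j = 1" "y i = y j" "i = j + 1 \<or> j = i + 1" "1 < j" "j < n"
  shows "j \<in> valleys n (bump y i)"
  using assms(3)
proof
  assume i: "i = j + 1"
  have "\<not> y j < y (j + 1)" unfolding i[symmetric] assms(2) by (rule less_irrefl)
  then have "y j < y (j - 1)" using assms(1,4,5) by (cases "y j < y (j - 1)") (auto simp: Vn_eq)
  moreover have "bump y i j = y j" "bump y i (j - 1) = y (j - 1)" using i by simp_all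
  moreover have "bump y i (j + 1) = y j + 1" unfolding i[symmetric] by (simp add: assms(2))
  ultimately show ?thesis using assms(4,5) by (simp only: mem_valleys_iff) simp
next
  assume i: "j = i + 1"
  then have pred: "j - 1 = i" by simp
  have "\<not> y j < y (j - 1)" unfolding pred assms(2) by (rule less_irrefl)
  then have "y j < y (j + 1)" using assms(1,4,5) by (cases "y j < y (j + 1)") (auto simp: Vn_eq)
  moreover have "bump y i j = y j" "bump y i (j + 1) = y (j + 1)" using i by simp_all
  moreover have "bump y i (j - 1) = y j + 1" unfolding pred by (simp add: assms(2))
  ultimately show ?thesis using assms(4,5) by (simp only: mem_valleys_iff) simp
qed

context crystal_model
begin

lemma leaves_peaks_at_between:
  assumes "1 \<le> u" "u < v" "v < w" "w \<le> n" "y u < y v" "y w < y v" and P: "P \<inter> {u<..<w} = {}"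
  shows "leaves_within 1 (peaks_at P) y"
proof -
  have v: "v \<in> {u<..<w}" using assms by simp
  then have "{u<..<w} \<noteq> {}" by blast
  then obtain v0 where v0: "v0 \<in> {u<..<w}" "Max (y ` {u<..<w}) = y v0"
    by (rule obtains_MAX[OF finite_greaterThanLessThan])
  have le: "y k \<le> y v0" if "k \<in> {u<..<w}" for k
    unfolding v0(2)[symmetric] using that by (intro Max_ge) auto
  have neighbour: "y k \<le> y v0" if k: "k = v0 - 1 \<or> k = v0 + 1" for k
  proof -
    have "k = u \<or> k = w \<or> k \<in> {u<..<w}" using k v0(1) by auto
    then show ?thesis using assms le[OF v] le[of k] by auto
  qed
  have "v0 \<in> peaks n (foldl bump y [v0])"
    using v0(1) assms neighbour[of "v0 - 1"] neighbour[of "v0 + 1"]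
    by (auto simp: mem_peaks_iff bump_apply less_Suc_eq_le)
  then show ?thesis by (rule leaves_peaks_at) (use v0(1) assms P in auto)
qed

lemma leaves_peaks_at_high_valley:
  assumes T: "1 < a" "b < n" "P \<inter> {a..b} = {}" and i: "i \<in> {a..b}" "V y i = 2" and k: "k \<in> {a..b}" "y k < y i"
  shows "leaves_within 1 (peaks_at P) y"
proof -
  have "i \<in> valleys n y" using i T by (subst Vn_eq_2_iff[symmetric]) auto
  then have higher: "y i < y (i - 1)" "y i < y (i + 1)" by (auto simp: mem_valleys_iff)
  then have "i \<noteq> k" "i + 1 \<noteq> k" "i - 1 \<noteq> k" using k by auto
  then consider "i + 1 < k" | "k < i - 1" by linarith
  then show ?thesis
  proof cases
    case 1
    then show ?thesis using higher i k T by (intro leaves_peaks_at_between[of i "i + 1" k]) auto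
  next
    case 2
    then show ?thesis using higher i k T by (intro leaves_peaks_at_between[of k "i - 1" i]) auto
  qed
qed

lemma leaves_peaks_at_balanced:
  assumes ab: "1 < a" "a + 2 \<le> b" "b < n" and P: "P \<inter> {a..b} = {}" and balanced: "balanced {a..b} C y"
  shows "leaves_within (C + 1) (peaks_at P) y"
proof (rule leaves_peaks_at)
  have "y a \<le> y (a + 1) + C" "y (a + 2) \<le> y (a + 1) + C"
    using balanced ab by (auto simp: balanced_def)
  then show "a + 1 \<in> peaks n (foldl bump y (replicate (C + 1) (a + 1)))"
    using ab by (auto simp: mem_peaks_iff foldl_bump_apply count_list_replicate)
qed (use ab P in auto)

lemma sum_rate_mult_excess_le_at_valleys:
  assumes "b1 < b2" "finite T" and V: "\<And>i. i \<in> T \<Longrightarrow> V y i = 1 \<or> V y i = 2"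
    and bottom: "\<And>i k. i \<in> T \<Longrightarrow> V y i = 2 \<Longrightarrow> k \<in> T \<Longrightarrow> y i \<le> y k"
    and i0: "i0 \<in> T" "V y i0 = 2"
  shows "(\<Sum>i\<in>T. site_rate y i * excess T y i) \<le> - ((b2 - b1) * elevation T y)"
proof -
  have nonneg: "0 \<le> (b1 - site_rate y i) * excess T y i" if "i \<in> T" for i
    using V[OF that]
  proof
    assume "V y i = 2"
    moreover from this have "excess T y i = - elevation T y"
      using that by (intro excess_at_min assms(2) bottom)
    ultimately show ?thesis
      using assms(1) elevation_nonneg[OF assms(2), of y]
      by (simp add: site_rate_eq mult_nonpos_nonneg)
  qed (simp add: site_rate_eq)
  have "(b2 - b1) * elevation T y = (b1 - site_rate y i0) * excess T y i0"
    using excess_at_min[of T i0 y] bottom assms(2) i0 by (simp add: site_rate_eq algebra_simps)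
  also have "\<dots> \<le> (\<Sum>i\<in>T. (b1 - site_rate y i) * excess T y i)"
    by (rule member_le_sum) (use nonneg i0 assms(2) in auto)
  finally show ?thesis
    unfolding sum_rate_mult_excess[where r = b1] by (simp add: left_diff_distrib sum_subtractf)
qed

lemma spread_drift_at_valleys:
  assumes "b1 < b2" and T: "T \<subseteq> {1..n}" and V: "\<And>i. i \<in> T \<Longrightarrow> V y i = 1 \<or> V y i = 2"
    and bottom: "\<And>i k. i \<in> T \<Longrightarrow> V y i = 2 \<Longrightarrow> k \<in> T \<Longrightarrow> y i \<le> y k"
    and i0: "i0 \<in> T" "V y i0 = 2"
  shows "mean_step (spread T) y - spread T y
    \<le> 2 * (real (card T))\<^sup>2 * b2 / (real n * min_rate)
      - 2 * (2 * (b2 - b1) / (real n * max_rate) * elevation T y)"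
proof -
  have fin: "finite T" using T by (rule finite_subset) simp
  have "site_rate y i \<le> b2" if "i \<in> T" for i using V[OF that] assms(1) by (auto simp: site_rate_eq)
  then have "q y * (mean_step (spread T) y - spread T y)
      \<le> 2 * (real (card T))\<^sup>2 * b2 - 4 * ((b2 - b1) * elevation T y)"
    using i0 by (intro q_mult_spread_drift_le[OF T]
        sum_rate_mult_excess_le_at_valleys[OF assms(1) fin V bottom i0]) auto
  then have "mean_step (spread T) y - spread T y
      \<le> (2 * (real (card T))\<^sup>2 * b2 - 4 * ((b2 - b1) * elevation T y)) / q y"
    using q_pos[of y] by (simp add: pos_le_divide_eq mult.commute)
  also have "\<dots> = 2 * (real (card T))\<^sup>2 * b2 / q y - 4 * (b2 - b1) * elevation T y / q y"
    by (simp add: diff_divide_distrib)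
  also have "\<dots> \<le> 2 * (real (card T))\<^sup>2 * b2 / (real n * min_rate)
      - 4 * (b2 - b1) * elevation T y / (real n * max_rate)"
    using q_le[of y] q_ge[of y] q_pos[of y] n_min_rate_pos assms(1) b_pos elevation_nonneg[OF fin, of y]
    by (intro diff_mono divide_left_mono) auto
  also have "4 * (b2 - b1) * elevation T y / (real n * max_rate)
      = 2 * (2 * (b2 - b1) / (real n * max_rate) * elevation T y)" by argo
  finally show ?thesis .
qed

lemma spread_drift_at_plateau:
  assumes T: "T \<subseteq> {1..n}" "T \<noteq> {}" and V: "\<And>i. i \<in> T \<Longrightarrow> V y i = 1"
  shows "mean_step (spread T) y - spread T y \<le> 2 * (real (card T) - 1)"
proof -
  have "1 \<le> card T" using T finite_subset[OF T(1)] by (simp add: Suc_le_eq card_gt_0_iff)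
  moreover have "(\<Sum>i\<in>T. site_rate y i * excess T y i) = 0"
    unfolding sum_rate_mult_excess[where r = b1] using V by (simp add: site_rate_eq)
  moreover have "(\<Sum>i\<in>T. site_rate y i) \<le> q y"
    unfolding total_rate_def using T site_rate_pos by (intro sum_mono2) (auto intro: less_imp_le)
  ultimately have "q y * (mean_step (spread T) y - spread T y) \<le> 2 * (real (card T) - 1) * q y"
    unfolding q_mult_spread_drift[OF T(1)] by (simp add: mult_left_mono)
  then show ?thesis using q_pos[of y] by (simp add: mult.commute)
qed

lemma plateau_bump_creates_valley:
  assumes ab: "1 < a" "a \<le> b" "b < n" and ends: "a - 1 \<in> peaks n y" "b + 1 \<in> peaks n y"
    and V: "\<And>i. i \<in> {a..b} \<Longrightarrow> V y i = 1"
  shows "\<exists>z\<in>{a..b}. \<exists>z'\<in>{a..b}. V (bump y z) z' = 2"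
proof -
  have "{a..b} \<noteq> {}" using ab by simp
  then obtain z where z: "z \<in> {a..b}" "Min (y ` {a..b}) = y z"
    by (rule obtains_MIN[OF finite_atLeastAtMost])
  have min: "y z \<le> y k" if "k \<in> {a..b}" for k
    unfolding z(2)[symmetric] using that by (intro Min_le) auto
  have outer: "y a < y (a - 1)" "y b < y (b + 1)" using ends ab by (auto simp: mem_peaks_iff)
  have zn: "1 \<le> z" "z \<le> n" using z ab by auto
  obtain z' where z': "z' \<in> {a..b}" "y z = y z'" "z = z' + 1 \<or> z' = z + 1"
  proof (cases "y z < y (z + 1)")
    case True
    then have "y (z - 1) \<le> y z" using V[OF z(1)] zn ab z(1) by (auto simp: Vn_eq split: if_splits)
    moreover from this have "z - 1 \<in> {a..b}" using outer z(1) by (cases "z = a") auto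
    ultimately show ?thesis using that[of "z - 1"] min[of "z - 1"] z(1) ab by auto
  next
    case False
    then have "z + 1 \<in> {a..b}" using outer z(1) by (cases "z = b") auto
    then show ?thesis using that[of "z + 1"] min[of "z + 1"] False by auto
  qed
  have "z' \<in> valleys n (bump y z)"
    by (rule bump_plateau_mem_valleys[OF V[OF z'(1)] z'(2,3)]) (use z' ab in auto)
  then have "V (bump y z) z' = 2" using z' ab by (subst Vn_eq_2_iff) auto
  then show ?thesis using z(1) z'(1) by blast
qed

text \<open>If the minimum of a block is attained on a plateau, then no site of the block has the high
  rate \<open>b2\<close> and the spread does not decrease on average. The plateau cost makes these states
  expensive; it is lost as soon as a suitable plateau site jumps.\<close>

definition plateau_cost :: "real \<Rightarrow> nat set \<Rightarrow> (nat \<Rightarrow> nat) \<Rightarrow> real" where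
  "plateau_cost \<kappa> T y = (if \<exists>i\<in>T. V y i = 2 then 0 else \<kappa> * elevation T y)"

lemma plateau_cost_nonneg: "0 \<le> \<kappa> \<Longrightarrow> finite T \<Longrightarrow> 0 \<le> plateau_cost \<kappa> T y"
  using elevation_nonneg[of T y] by (simp add: plateau_cost_def)

lemma plateau_cost_bump_le:
  assumes "0 \<le> \<kappa>" "finite T" "T \<noteq> {}"
  shows "plateau_cost \<kappa> T (bump y i) \<le> \<kappa> * (elevation T y + 1)"
  using assms elevation_bump_le[OF assms(2,3), of y i] elevation_nonneg[OF assms(2), of y]
  by (auto simp: plateau_cost_def intro: mult_left_mono)

lemma plateau_cost_drift_at_plateau:
  assumes "0 \<le> \<kappa>" and ab: "1 < a" "a \<le> b" "b < n" and ends: "a - 1 \<in> peaks n y" "b + 1 \<in> peaks n y"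
    and V: "\<And>i. i \<in> {a..b} \<Longrightarrow> V y i = 1"
  shows "mean_step (plateau_cost \<kappa> {a..b}) y - plateau_cost \<kappa> {a..b} y
    \<le> \<kappa> - min_rate / (real n * max_rate) * (\<kappa> * elevation {a..b} y)"
proof -
  define c where "c = min_rate / (real n * max_rate)"
  have c: "0 < c" using c_pos by (simp add: c_def)
  have T: "finite {a..b}" "{a..b} \<noteq> {}" using ab by auto
  define t where "t = \<kappa> * elevation {a..b} y"
  have t: "0 \<le> t" using assms(1) elevation_nonneg[OF T(1), of y] by (simp add: t_def)
  have cost_le: "plateau_cost \<kappa> {a..b} (bump y i) \<le> t + \<kappa>" for i
    using plateau_cost_bump_le[OF assms(1) T, of y i] by (simp add: t_def algebra_simps)
  obtain z z' where z: "z \<in> {a..b}" "z' \<in> {a..b}" "V (bump y z) z' = 2"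
    using plateau_bump_creates_valley[OF ab ends V] by blast
  have "mean_step (plateau_cost \<kappa> {a..b}) y \<le> (1 - c) * (t + \<kappa>)"
    unfolding c_def
  proof (rule mean_step_le_if_vanishing)
    show "plateau_cost \<kappa> {a..b} (bump y z) = 0" using z(2,3) unfolding plateau_cost_def by metis
  qed (use z(1) ab t assms(1) cost_le in auto)
  also have "\<dots> \<le> t - c * t + \<kappa>" using c assms(1) by (simp add: algebra_simps)
  finally have "mean_step (plateau_cost \<kappa> {a..b}) y \<le> t - c * t + \<kappa>" .
  moreover have "plateau_cost \<kappa> {a..b} y = t" using V by (simp add: plateau_cost_def t_def)
  ultimately show ?thesis by (simp add: t_def c_def)
qed

lemma spread_plus_plateau_cost_drift:
  fixes a b :: nat and y :: "nat \<Rightarrow> nat"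
  defines "T \<equiv> {a..b}" and "\<kappa> \<equiv> 2 * (b2 - b1) / (real n * max_rate)" and "c \<equiv> min_rate / (real n * max_rate)"
  assumes "b1 < b2" and ab: "1 < a" "a \<le> b" "b < n" and ends: "a - 1 \<in> peaks n y" "b + 1 \<in> peaks n y"
    and V: "\<And>i. i \<in> T \<Longrightarrow> V y i = 1 \<or> V y i = 2"
    and bottom: "\<And>i k. i \<in> T \<Longrightarrow> V y i = 2 \<Longrightarrow> k \<in> T \<Longrightarrow> y i \<le> y k"
  shows "(mean_step (spread T) y - spread T y) + (mean_step (plateau_cost \<kappa> T) y - plateau_cost \<kappa> T y)
    \<le> 2 * (real (card T))\<^sup>2 * b2 / (real n * min_rate) + 2 * real (card T) + \<kappa> - c * (\<kappa> * elevation T y)"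
proof -
  have T: "T \<subseteq> {1..n}" "finite T" "T \<noteq> {}" using ab by (auto simp: T_def)
  have \<kappa>: "0 \<le> \<kappa>" using assms(4) n_max_rate_pos by (simp add: \<kappa>_def)
  have c: "0 \<le> c" "c \<le> 1" using c_pos c_le_1 by (simp_all add: c_def)
  have S: "0 \<le> 2 * (real (card T))\<^sup>2 * b2 / (real n * min_rate)" using b_pos n_min_rate_pos by simp
  show ?thesis
  proof (cases "\<exists>i\<in>T. V y i = 2")
    case True
    then obtain i0 where i0: "i0 \<in> T" "V y i0 = 2" by blast
    have "mean_step (spread T) y - spread T y
        \<le> 2 * (real (card T))\<^sup>2 * b2 / (real n * min_rate) - 2 * (\<kappa> * elevation T y)"
      unfolding \<kappa>_def by (rule spread_drift_at_valleys[OF assms(4) T(1) V bottom i0])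
    moreover have "mean_step (plateau_cost \<kappa> T) y \<le> \<kappa> * (elevation T y + 1)"
      by (rule mean_step_le) (rule plateau_cost_bump_le[OF \<kappa> T(2,3)])
    moreover have "plateau_cost \<kappa> T y = 0" using True by (simp add: plateau_cost_def)
    moreover have "c * (\<kappa> * elevation T y) \<le> \<kappa> * elevation T y"
      using c \<kappa> elevation_nonneg[OF T(2), of y] by (simp add: mult_left_le_one_le)
    ultimately show ?thesis by (simp add: distrib_left)
  next
    case False
    then have V1: "V y i = 1" if "i \<in> T" for i using V that by blast
    have "mean_step (spread T) y - spread T y \<le> 2 * (real (card T) - 1)"
      by (rule spread_drift_at_plateau[OF T(1,3) V1])
    moreover have "mean_step (plateau_cost \<kappa> T) y - plateau_cost \<kappa> T y \<le> \<kappa> - c * (\<kappa> * elevation T y)"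
      unfolding T_def c_def by (rule plateau_cost_drift_at_plateau[OF \<kappa> ab ends V1[unfolded T_def]])
    ultimately show ?thesis using S by simp
  qed
qed

definition peak_exit_states :: "nat set \<Rightarrow> nat \<Rightarrow> (nat \<Rightarrow> nat) set" where
  "peak_exit_states T C =
    {y. (\<exists>i\<in>T. V y i = 0) \<or> (\<exists>i\<in>T. V y i = 2 \<and> (\<exists>k\<in>T. y k < y i)) \<or> balanced T C y}"

lemma leaves_peaks_at_exit_states:
  assumes ab: "1 < a" "a + 2 \<le> b" "b < n" and P: "P \<inter> {a..b} = {}" and y: "y \<in> peak_exit_states {a..b} C"
  shows "leaves_within (C + 1) (peaks_at P) y"
proof -
  consider i where "i \<in> {a..b}" "V y i = 0" | i k where "i \<in> {a..b}" "V y i = 2" "k \<in> {a..b}" "y k < y i"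
    | "balanced {a..b} C y" using y unfolding peak_exit_states_def by blast
  then show ?thesis
  proof cases
    case (1 i)
    then have "leaves_within 1 (peaks_at P) y"
      using ab P by (intro leaves_peaks_at_if_V_eq_0[of i]) auto
    then show ?thesis by (rule leaves_within_mono) auto
  next
    case (2 i k)
    then have "leaves_within 1 (peaks_at P) y" by (rule leaves_peaks_at_high_valley[OF ab(1,3) P])
    then show ?thesis by (rule leaves_within_mono) auto
  next
    case 3
    then show ?thesis by (rule leaves_peaks_at_balanced[OF ab P])
  qed
qed

lemma surely_left_contracting_block_without_peak:
  assumes "b1 < b2" and ab: "1 < a" "a + 2 \<le> b" "b < n" and P: "P \<inter> {a..b} = {}"
    and ends: "a - 1 \<in> P" "b + 1 \<in> P"
  shows "surely_left (peaks_at P)"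
proof -
  define T where "T = {a..b}"
  have T: "T \<subseteq> {1..n}" "finite T" using ab by (auto simp: T_def)
  define \<kappa> where "\<kappa> = 2 * (b2 - b1) / (real n * max_rate)"
  define c where "c = min_rate / (real n * max_rate)"
  have pos: "0 < \<kappa>" "0 < c" using assms(1) n_max_rate_pos c_pos by (auto simp: \<kappa>_def c_def)
  define S where "S = 2 * (real (card T))\<^sup>2 * b2 / (real n * min_rate) + 2 * real (card T) + \<kappa>"
  obtain C :: nat where C: "S + 1 \<le> real C * (c * \<kappa>)"
    using ex_less_of_nat_mult[of "c * \<kappa>" "S + 1"] pos by (auto intro: less_imp_le)
  let ?f = "\<lambda>y. spread T y + plateau_cost \<kappa> T y"
  show ?thesis
  proof (rule surely_left_two_stage[where G = "peak_exit_states T C"])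
    show "surely_left (peaks_at P - peak_exit_states T C)"
    proof (rule surely_left_Foster[where f = ?f and \<epsilon> = 1])
      fix y assume y: "y \<in> peaks_at P - peak_exit_states T C"
      have "(mean_step (spread T) y - spread T y) + (mean_step (plateau_cost \<kappa> T) y - plateau_cost \<kappa> T y)
          \<le> S - c * (\<kappa> * elevation T y)"
        unfolding S_def c_def \<kappa>_def T_def
      proof (rule spread_plus_plateau_cost_drift)
        show "V y i = 1 \<or> V y i = 2" if "i \<in> {a..b}" for i
          using y that[folded T_def]
          by (cases rule: Vn_cases[of n y i]) (auto simp: peak_exit_states_def)
        show "y i \<le> y k" if "i \<in> {a..b}" "V y i = 2" "k \<in> {a..b}" for i k
          using y that[folded T_def] by (auto simp: peak_exit_states_def not_less)
      qed (use assms y in auto)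
      moreover have "real C * (c * \<kappa>) \<le> elevation T y * (c * \<kappa>)"
        using elevation_ge_if_not_balanced[OF T(2), of C y] y pos
        by (intro mult_right_mono) (auto simp: peak_exit_states_def)
      ultimately show "mean_step ?f y \<le> ?f y - 1"
        unfolding mean_step_add using C by (simp add: mult_ac)
    qed (use plateau_cost_nonneg spread_nonneg pos T in \<open>auto intro!: add_nonneg_nonneg\<close>)
  next
    fix y assume "y \<in> peak_exit_states T C"
    then show "leaves_within (C + 1) (peaks_at P) y"
      unfolding T_def by (rule leaves_peaks_at_exit_states[OF ab P])
  qed
qed

end

subsection \<open>Sublinear sequences\<close>

lemma smallo_real_iff:
  fixes f :: "nat \<Rightarrow> real"
  shows "f \<in> o(\<lambda>k. real k) \<longleftrightarrow> (\<lambda>k. f k / real k) \<longlonglongrightarrow> 0"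
proof
  assume "(\<lambda>k. f k / real k) \<longlonglongrightarrow> 0"
  then show "f \<in> o(\<lambda>k. real k)"
    by (rule smalloI_tendsto) (use eventually_gt_at_top[of "0 :: nat"] in \<open>auto elim: eventually_mono\<close>)
qed (rule smalloD_tendsto)

lemma const_in_smallo_real: "(\<lambda>_. a) \<in> o(\<lambda>k. real k)" for a :: real
  unfolding smallo_real_iff by (rule lim_const_over_n)

lemma cmult_in_smallo: "f \<in> o[F](g) \<Longrightarrow> (\<lambda>x. a * f x) \<in> o[F](g)" for a :: real
  by (cases "a = 0") simp_all

lemma smallo_real_if_eventually_offset:
  fixes f g :: "nat \<Rightarrow> real"
  assumes "f \<in> o(\<lambda>k. real k)" "\<And>k. K \<le> k \<Longrightarrow> g k = f k + a"
  shows "g \<in> o(\<lambda>k. real k)"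
proof -
  have "\<forall>\<^sub>F k in sequentially. g k = f k + a" using assms(2) by (auto simp: eventually_sequentially)
  moreover have "(\<lambda>k. f k + a) \<in> o(\<lambda>k. real k)"
    by (intro sum_in_smallo assms(1) const_in_smallo_real)
  ultimately show ?thesis using landau_o.small.in_cong[of g "\<lambda>k. f k + a"] by simp
qed

lemma smallo_real_Suc:
  fixes f :: "nat \<Rightarrow> real"
  assumes "f \<in> o(\<lambda>k. real k)"
  shows "(\<lambda>k. f (Suc k)) \<in> o(\<lambda>k. real k)"
proof -
  have "(\<lambda>k. f (Suc k)) \<in> o(\<lambda>k. real (Suc k))"
    using landau_o.small.compose[OF assms filterlim_Suc] .
  moreover have "(\<lambda>k. real (Suc k)) \<in> O(\<lambda>k. real k)"
    by (rule landau_o.bigI[of 2]) (auto simp: eventually_sequentially intro!: exI[of _ 1])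
  ultimately show ?thesis by (rule landau_o.small_big_trans)
qed

lemma smallo_real_linear_bound:
  fixes f :: "nat \<Rightarrow> real"
  assumes "f \<in> o(\<lambda>k. real k)" "0 < d"
  shows "\<exists>C. \<forall>k. \<bar>f k\<bar> \<le> d * real k + C"
proof -
  obtain N where N: "\<And>k. N \<le> k \<Longrightarrow> \<bar>f k\<bar> \<le> d * real k"
    using landau_o.smallD[OF assms] by (auto simp: eventually_sequentially)
  have "\<bar>f k\<bar> \<le> d * real k + (\<Sum>i\<le>N. \<bar>f i\<bar>)" for k
  proof (cases "k \<le> N")
    case True
    then have "\<bar>f k\<bar> \<le> (\<Sum>i\<le>N. \<bar>f i\<bar>)" by (intro member_le_sum) auto
    then show ?thesis using assms(2) by (simp add: add_increasing)
  next
    case False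
    then show ?thesis using N[of k] by (simp add: add_increasing2 sum_nonneg)
  qed
  then show ?thesis by blast
qed

text \<open>Since the last time at which \<open>D\<close> was at most \<open>b\<close>, it has grown no faster than \<open>\<epsilon>\<close>.\<close>

lemma smallo_real_if_reflected:
  fixes \<epsilon> D :: "nat \<Rightarrow> real"
  assumes \<epsilon>: "\<epsilon> \<in> o(\<lambda>k. real k)" and nonneg: "\<And>k. 0 \<le> D k" and "D 0 \<le> b"
    and step: "\<And>k. D (Suc k) \<le> b \<or> D (Suc k) - D k \<le> \<epsilon> (Suc k) - \<epsilon> k"
  shows "D \<in> o(\<lambda>k. real k)"
proof (rule landau_o.smallI)
  fix r :: real assume r: "0 < r"
  have last_reset: "\<exists>i\<le>k. D k \<le> b + (\<epsilon> k - \<epsilon> i)" for k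
  proof (induction k)
    case (Suc k)
    then obtain i where i: "i \<le> k" "D k \<le> b + (\<epsilon> k - \<epsilon> i)" by blast
    from step[of k] show ?case
    proof
      assume "D (Suc k) \<le> b"
      then show ?thesis by (intro exI[of _ "Suc k"]) simp
    next
      assume "D (Suc k) - D k \<le> \<epsilon> (Suc k) - \<epsilon> k"
      then show ?thesis using i by (intro exI[of _ i]) simp
    qed
  qed (use assms(3) in simp)
  obtain C where C: "\<And>k. \<bar>\<epsilon> k\<bar> \<le> r / 4 * real k + C"
    using smallo_real_linear_bound[OF \<epsilon>, of "r / 4"] r by auto
  have "\<forall>\<^sub>F k in sequentially. norm (b + 2 * C) \<le> r / 2 * norm (real k)"
    using landau_o.smallD[OF const_in_smallo_real, of "r / 2"] r by simp
  then show "\<forall>\<^sub>F k in sequentially. norm (D k) \<le> r * norm (real k)"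
  proof eventually_elim
    case (elim k)
    obtain i where i: "i \<le> k" "D k \<le> b + (\<epsilon> k - \<epsilon> i)" using last_reset by blast
    have "r / 4 * real i \<le> r / 4 * real k" using i(1) r by (intro mult_left_mono) auto
    moreover have "b + 2 * C \<le> r / 2 * real k" using elim abs_ge_self[of "b + 2 * C"] by simp
    moreover have "r * real k = r / 4 * real k + r / 4 * real k + r / 2 * real k" by simp
    ultimately have "D k \<le> r * real k" using i(2) C[of k] C[of i] by linarith
    then show ?case using nonneg[of k] by simp
  qed
qed

lemma abs_diff_le_sum_increments:
  fixes S :: "nat \<Rightarrow> real"
  assumes "\<And>k. \<bar>S (Suc k) - S k\<bar> \<le> w k" "k \<le> l"
  shows "\<bar>S l - S k\<bar> \<le> (\<Sum>i\<in>{k..<l}. w i)"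
proof -
  have "\<bar>S l - S k\<bar> = \<bar>\<Sum>i\<in>{k..<l}. S (Suc i) - S i\<bar>" using assms(2) by (simp add: sum_Suc_diff')
  also have "\<dots> \<le> (\<Sum>i\<in>{k..<l}. \<bar>S (Suc i) - S i\<bar>)" by (rule sum_abs)
  also have "\<dots> \<le> (\<Sum>i\<in>{k..<l}. w i)" by (intro sum_mono assms(1))
  finally show ?thesis .
qed

lemma filterlim_floor_sqrt: "filterlim floor_sqrt at_top sequentially"
  unfolding filterlim_at_top eventually_sequentially
  by (metis le_floor_sqrt_iff power2_nat_le_imp_le order_trans)

lemma smallo_real_if_squares:
  fixes S w :: "nat \<Rightarrow> real"
  assumes increment: "\<And>k. \<bar>S (Suc k) - S k\<bar> \<le> w k"
    and squares: "(\<lambda>r. S (r\<^sup>2) / real (r\<^sup>2)) \<longlonglongrightarrow> 0"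
    and between: "(\<lambda>r. (\<Sum>i\<in>{r\<^sup>2..<(Suc r)\<^sup>2}. w i) / real (r\<^sup>2)) \<longlonglongrightarrow> 0"
  shows "S \<in> o(\<lambda>k. real k)"
  unfolding smallo_real_iff
proof (rule Lim_null_comparison)
  define b where "b r = \<bar>S (r\<^sup>2) / real (r\<^sup>2)\<bar> + (\<Sum>i\<in>{r\<^sup>2..<(Suc r)\<^sup>2}. w i) / real (r\<^sup>2)" for r
  have "b \<longlonglongrightarrow> 0" unfolding b_def using tendsto_add[OF tendsto_rabs[OF squares] between] by simp
  then show "(\<lambda>k. b (floor_sqrt k)) \<longlonglongrightarrow> 0" by (rule filterlim_compose) (rule filterlim_floor_sqrt)
  have "\<bar>S k / real k\<bar> \<le> b (floor_sqrt k)" if "k > 0" for k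
  proof -
    define r where "r = floor_sqrt k"
    have r: "r > 0" "r\<^sup>2 \<le> k" "k < (Suc r)\<^sup>2"
      using that Suc_floor_sqrt_power2_gt[of k] by (auto simp: r_def)
    have w_nonneg: "0 \<le> w i" for i using increment[of i] by linarith
    have "\<bar>S k - S (r\<^sup>2)\<bar> \<le> (\<Sum>i\<in>{r\<^sup>2..<k}. w i)"
      using abs_diff_le_sum_increments[of S w "r\<^sup>2" k] increment r(2) by blast
    also have "\<dots> \<le> (\<Sum>i\<in>{r\<^sup>2..<(Suc r)\<^sup>2}. w i)" using r w_nonneg by (intro sum_mono2) auto
    finally have "\<bar>S k\<bar> \<le> \<bar>S (r\<^sup>2)\<bar> + (\<Sum>i\<in>{r\<^sup>2..<(Suc r)\<^sup>2}. w i)" by linarith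
    then have "\<bar>S k\<bar> / real k \<le> (\<bar>S (r\<^sup>2)\<bar> + (\<Sum>i\<in>{r\<^sup>2..<(Suc r)\<^sup>2}. w i)) / real (r\<^sup>2)"
      using r that
      by (intro frac_le) (auto intro!: add_nonneg_nonneg sum_nonneg w_nonneg simp del: of_nat_power)
    then show ?thesis by (simp add: b_def r_def add_divide_distrib)
  qed
  then show "\<forall>\<^sub>F k in sequentially. norm (S k / real k) \<le> b (floor_sqrt k)"
    by (auto simp: eventually_sequentially intro!: exI[of _ 1])
qed

lemma const_between_squares_tendsto_0:
  "(\<lambda>r. (\<Sum>i\<in>{r\<^sup>2..<(Suc r)\<^sup>2}. a) / real (r\<^sup>2)) \<longlonglongrightarrow> (0::real)"
proof -
  have "(\<Sum>i\<in>{r\<^sup>2..<(Suc r)\<^sup>2}. a) / real (r\<^sup>2) = a * (2 * (1 / real r) + (1 / real r) * (1 / real r))" for r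
  proof (cases "r = 0")
    case False
    have "(Suc r)\<^sup>2 - r\<^sup>2 = 2 * r + 1" by (simp add: power2_eq_square)
    then show ?thesis using False by (simp add: power2_eq_square field_simps)
  qed simp
  moreover have "(\<lambda>r. a * (2 * (1 / real r) + (1 / real r) * (1 / real r))) \<longlonglongrightarrow> a * (2 * 0 + 0 * 0)"
    by (intro tendsto_intros lim_const_over_n)
  ultimately show ?thesis by simp
qed

lemma diff_of_squares_tendsto_0:
  fixes S :: "nat \<Rightarrow> real"
  assumes squares: "(\<lambda>r. S (r\<^sup>2) / real (r\<^sup>2)) \<longlonglongrightarrow> 0"
  shows "(\<lambda>r. (S ((Suc r)\<^sup>2) - S (r\<^sup>2)) / real (r\<^sup>2)) \<longlonglongrightarrow> 0"
proof -
  have "(\<lambda>r. S ((Suc r)\<^sup>2) / real ((Suc r)\<^sup>2) * (1 + 1 / real r)\<^sup>2 - S (r\<^sup>2) / real (r\<^sup>2)) \<longlonglongrightarrow> 0 * (1 + 0)\<^sup>2 - 0"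
    by (intro tendsto_intros squares LIMSEQ_Suc[OF squares] lim_const_over_n)
  then have "(\<lambda>r. S ((Suc r)\<^sup>2) / real ((Suc r)\<^sup>2) * (1 + 1 / real r)\<^sup>2 - S (r\<^sup>2) / real (r\<^sup>2)) \<longlonglongrightarrow> 0"
    by simp
  then show ?thesis
  proof (rule Lim_transform_eventually)
    show "\<forall>\<^sub>F r in sequentially. S ((Suc r)\<^sup>2) / real ((Suc r)\<^sup>2) * (1 + 1 / real r)\<^sup>2 - S (r\<^sup>2) / real (r\<^sup>2)
        = (S ((Suc r)\<^sup>2) - S (r\<^sup>2)) / real (r\<^sup>2)"
      using eventually_gt_at_top[of 0]
    proof eventually_elim
      case (elim r)
      then have "(1 + 1 / real r)\<^sup>2 = real ((Suc r)\<^sup>2) / real (r\<^sup>2)"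
        by (simp add: field_simps power2_eq_square)
      moreover have "real ((Suc r)\<^sup>2) \<noteq> 0" by simp
      ultimately show ?case by (simp add: diff_divide_distrib)
    qed
  qed
qed

subsection \<open>Event times and counting processes\<close>

locale event_times =
  fixes T :: "nat \<Rightarrow> real"
  assumes incseq_T: "incseq T" and T_0 [simp]: "T 0 = 0" and T_at_top: "filterlim T at_top sequentially"
begin

definition event_count :: "real \<Rightarrow> nat" where
  "event_count t = card {k. 0 < k \<and> T k \<le> t}"

lemma event_count_bounds:
  assumes "0 \<le> t"
  shows "T (event_count t) \<le> t" "t < T (Suc (event_count t))"
proof -
  define m where "m = (LEAST k. t < T k)"
  have "\<exists>k. t < T k"
    using T_at_top unfolding filterlim_at_top_dense by (meson eventually_happens' sequentially_bot)
  then have m: "t < T m" unfolding m_def by (rule LeastI_ex)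
  have before: "T k \<le> t" if "k < m" for k
    using not_less_Least[OF that[unfolded m_def]] by simp
  have after: "t < T k" if "m \<le> k" for k using m incseqD[OF incseq_T that] by linarith
  have "k \<in> {k. 0 < k \<and> T k \<le> t} \<longleftrightarrow> k \<in> {0<..<m}" for k
    using before[of k] after[of k] by (cases "k < m") auto
  then have "{k. 0 < k \<and> T k \<le> t} = {0<..<m}" by blast
  moreover have "m \<noteq> 0" using m assms by (cases m) auto
  ultimately show "T (event_count t) \<le> t" "t < T (Suc (event_count t))"
    using m before[of "m - 1"] by (simp_all add: event_count_def)
qed

lemma filterlim_event_count: "filterlim event_count at_top at_top"
  unfolding filterlim_at_top
proof
  fix k
  show "\<forall>\<^sub>F t in at_top. k \<le> event_count t"
    using eventually_ge_at_top[of "max 0 (T k)"]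
  proof eventually_elim
    case (elim t)
    then have "T k < T (Suc (event_count t))" using event_count_bounds(2)[of t] by simp
    then have "\<not> Suc (event_count t) \<le> k" using incseqD[OF incseq_T] by (meson not_less)
    then show ?case by simp
  qed
qed

lemma eventually_T_event_count_pos: "\<forall>\<^sub>F t in at_top. 0 < T (event_count t)"
proof -
  have "\<forall>\<^sub>F k in sequentially. 0 < T k" using T_at_top by (simp add: filterlim_at_top_dense)
  then show ?thesis using filterlim_event_count by (rule eventually_compose_filterlim)
qed

lemma T_event_count_over_t:
  assumes "(\<lambda>k. T (Suc k) / T k) \<longlonglongrightarrow> 1"
  shows "((\<lambda>t. T (event_count t) / t) \<longlongrightarrow> 1) at_top"
proof (rule tendsto_sandwich)
  show "((\<lambda>t. inverse (T (Suc (event_count t)) / T (event_count t))) \<longlongrightarrow> 1) at_top"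
    using tendsto_inverse[OF filterlim_compose[OF assms filterlim_event_count]] by simp
  show "\<forall>\<^sub>F t in at_top. inverse (T (Suc (event_count t)) / T (event_count t)) \<le> T (event_count t) / t"
    using eventually_T_event_count_pos eventually_gt_at_top[of 0]
  proof eventually_elim
    case (elim t)
    then have "T (event_count t) / T (Suc (event_count t)) \<le> T (event_count t) / t"
      using event_count_bounds[of t] by (intro divide_left_mono) auto
    then show ?case by simp
  qed
  show "\<forall>\<^sub>F t in at_top. T (event_count t) / t \<le> 1"
    using eventually_gt_at_top[of 0]
  proof eventually_elim
    case (elim t)
    then show ?case using event_count_bounds(1)[of t] by simp
  qed
qed simp

lemma tendsto_at_event_count:
  assumes ratio: "(\<lambda>k. T (Suc k) / T k) \<longlonglongrightarrow> 1" and a: "(\<lambda>k. a k / T k) \<longlonglongrightarrow> b"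
  shows "((\<lambda>t. a (event_count t) / t) \<longlongrightarrow> b) at_top"
proof -
  have "((\<lambda>t. (a (event_count t) / T (event_count t)) * (T (event_count t) / t)) \<longlongrightarrow> b * 1) at_top"
    by (intro tendsto_mult filterlim_compose[OF a filterlim_event_count] T_event_count_over_t ratio)
  then have "((\<lambda>t. (a (event_count t) / T (event_count t)) * (T (event_count t) / t)) \<longlongrightarrow> b) at_top"
    by simp
  then show ?thesis
    by (rule Lim_transform_eventually) (use eventually_T_event_count_pos in \<open>eventually_elim, simp\<close>)
qed

end

subsection \<open>Speeds along a path\<close>

text \<open>A trajectory \<open>y\<close> whose \<open>k\<close>-th jump is at site \<open>js k\<close> after the holding time \<open>h k\<close>; \<open>r\<close> is the
  rate function. The law of large numbers concerns the jumps at \<open>j\<close> from states satisfying \<open>P\<close>.\<close>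

definition jump_LLN :: "(nat \<Rightarrow> 's) \<Rightarrow> (nat \<Rightarrow> 'i) \<Rightarrow> (nat \<Rightarrow> real) \<Rightarrow> ('s \<Rightarrow> 'i \<Rightarrow> real)
    \<Rightarrow> ('s \<Rightarrow> bool) \<Rightarrow> 'i \<Rightarrow> bool" where
  "jump_LLN y js h r P j \<longleftrightarrow>
     (\<lambda>k. \<Sum>i<k. of_bool (P (y i)) * (of_bool (js i = j) - r (y i) j * h i)) \<in> o(\<lambda>k. real k)"

locale growth_path =
  fixes y :: "nat \<Rightarrow> nat \<Rightarrow> nat" and js :: "nat \<Rightarrow> nat" and h :: "nat \<Rightarrow> real"
    and r :: "(nat \<Rightarrow> nat) \<Rightarrow> nat \<Rightarrow> real"
  assumes y_Suc: "\<And>k. y (Suc k) = bump (y k) (js k)" and h_nonneg: "\<And>k. 0 \<le> h k"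
begin

abbreviation LLN :: "((nat \<Rightarrow> nat) \<Rightarrow> bool) \<Rightarrow> nat \<Rightarrow> bool" where "LLN \<equiv> jump_LLN y js h r"

definition time :: "nat \<Rightarrow> real" where "time k = (\<Sum>i<k. h i)"

definition jumps :: "((nat \<Rightarrow> nat) \<Rightarrow> bool) \<Rightarrow> nat \<Rightarrow> nat \<Rightarrow> real" where
  "jumps P j k = (\<Sum>i<k. of_bool (P (y i)) * of_bool (js i = j))"

definition occupation :: "((nat \<Rightarrow> nat) \<Rightarrow> bool) \<Rightarrow> nat \<Rightarrow> real" where
  "occupation P k = (\<Sum>i<k. of_bool (P (y i)) * h i)"

lemma jumps_approx_occupation:
  assumes LLN: "LLN P j" and rate: "\<And>k. K \<le> k \<Longrightarrow> P (y k) \<Longrightarrow> r (y k) j = b"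
  shows "(\<lambda>k. jumps P j k - b * occupation P k) \<in> o(\<lambda>k. real k)"
proof (rule smallo_real_if_eventually_offset[OF LLN[unfolded jump_LLN_def]])
  define R where "R k = (\<Sum>i<k. of_bool (P (y i)) * ((r (y i) j - b) * h i))" for k
  fix k assume k: "K \<le> k"
  have "R k = R K" using k
  proof (induction k rule: dec_induct)
    case (step m)
    then have "P (y m) \<Longrightarrow> r (y m) j = b" using rate by simp
    then have "R (Suc m) = R m" by (cases "P (y m)") (simp_all add: R_def)
    then show ?case using step by simp
  qed simp
  moreover have "jumps P j k - b * occupation P k
      = (\<Sum>i<k. of_bool (P (y i)) * (of_bool (js i = j) - r (y i) j * h i)) + R k"
    unfolding jumps_def occupation_def R_def sum_distrib_left sum_subtractf[symmetric] sum.distrib[symmetric]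
    by (intro sum.cong refl) (simp add: algebra_simps)
  ultimately show "jumps P j k - b * occupation P k
      = (\<Sum>i<k. of_bool (P (y i)) * (of_bool (js i = j) - r (y i) j * h i)) + R K" by simp
qed

lemma height_eq_jumps: "real (y k j) = jumps (\<lambda>_. True) j k + real (y 0 j)"
  by (induction k) (auto simp: jumps_def y_Suc bump_apply)

lemma single_speed:
  assumes LLN: "LLN (\<lambda>_. True) j" and rate: "\<forall>\<^sub>F k in sequentially. r (y k) j = b"
  shows "(\<lambda>k. real (y k j) - b * time k) \<in> o(\<lambda>k. real k)"
proof -
  obtain K where K: "\<And>k. K \<le> k \<Longrightarrow> r (y k) j = b" using rate by (auto simp: eventually_sequentially)
  have "(\<lambda>k. jumps (\<lambda>_. True) j k - b * occupation (\<lambda>_. True) k) \<in> o(\<lambda>k. real k)"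
    by (rule jumps_approx_occupation[OF LLN K])
  then show ?thesis
  proof (rule smallo_real_if_eventually_offset[where K = 0 and a = "real (y 0 j)"])
    fix k
    show "real (y k j) - b * time k = jumps (\<lambda>_. True) j k - b * occupation (\<lambda>_. True) k + real (y 0 j)"
      using height_eq_jumps[of k j] by (simp add: occupation_def time_def)
  qed
qed

lemma truncated_gap_Suc:
  assumes "u \<noteq> v"
  shows "real (y (Suc k) u - y (Suc k) v) = real (y k u - y k v) + of_bool (y k u = y k v) * of_bool (js k = u)
      + of_bool (y k v < y k u) * (of_bool (js k = u) - of_bool (js k = v))"
proof -
  have up: "real (Suc a - b) = real (a - b) + of_bool (a = b) + of_bool (b < a)" for a b :: nat
    by (cases a b rule: linorder_cases) (simp_all add: Suc_diff_le)
  have down: "real (a - Suc b) = real (a - b) - of_bool (b < a)" for a b :: nat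
    by (cases a b rule: linorder_cases) (simp_all add: of_nat_diff)
  consider "js k = u" | "js k = v" | "js k \<noteq> u" "js k \<noteq> v" by blast
  then show ?thesis
    by cases (use assms in \<open>simp_all add: y_Suc bump_apply up down\<close>)
qed

lemma truncated_gap_eq_jumps:
  assumes "u \<noteq> v"
  shows "real (y k u - y k v) = real (y 0 u - y 0 v) + jumps (\<lambda>y. y u = y v) u k
      + (jumps (\<lambda>y. y v < y u) u k - jumps (\<lambda>y. y v < y u) v k)"
  by (induction k) (simp_all add: truncated_gap_Suc[OF assms] jumps_def algebra_simps)

lemma truncated_gap_sublinear:
  assumes uv: "u \<noteq> v" and "\<alpha> \<le> \<gamma>"
    and LLN: "LLN (\<lambda>y. y v < y u) u" "LLN (\<lambda>y. y v < y u) v"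
    and rates: "\<And>k. K \<le> k \<Longrightarrow> y k v < y k u \<Longrightarrow> r (y k) u = \<alpha> \<and> r (y k) v = \<gamma>"
  shows "(\<lambda>k. real (y k u - y k v)) \<in> o(\<lambda>k. real k)"
proof -
  let ?G = "\<lambda>y :: nat \<Rightarrow> nat. y v < y u"
  define \<epsilon> where "\<epsilon> k = (jumps ?G u k - \<alpha> * occupation ?G k) - (jumps ?G v k - \<gamma> * occupation ?G k)" for k
  have \<epsilon>: "\<epsilon> \<in> o(\<lambda>k. real k)"
    unfolding \<epsilon>_def
    by (intro sum_in_smallo jumps_approx_occupation[of _ _ K] LLN) (use rates in auto)
  show ?thesis
  proof (rule smallo_real_if_reflected[OF \<epsilon>, where b = "real (y 0 u - y 0 v) + 1"])
    fix k
    show "real (y (Suc k) u - y (Suc k) v) \<le> real (y 0 u - y 0 v) + 1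
        \<or> real (y (Suc k) u - y (Suc k) v) - real (y k u - y k v) \<le> \<epsilon> (Suc k) - \<epsilon> k"
    proof (cases "?G (y k)")
      case True
      then have "real (y (Suc k) u - y (Suc k) v) - real (y k u - y k v) = \<epsilon> (Suc k) - \<epsilon> k + (\<alpha> - \<gamma>) * h k"
        unfolding truncated_gap_Suc[OF uv]
        by (simp add: \<epsilon>_def jumps_def occupation_def algebra_simps)
      also have "\<dots> \<le> \<epsilon> (Suc k) - \<epsilon> k"
        using assms(2) h_nonneg[of k] by (simp add: mult_nonpos_nonneg)
      finally show ?thesis by blast
    next
      case False
      then have "real (y (Suc k) u - y (Suc k) v) \<le> 1" unfolding truncated_gap_Suc[OF uv] by simp
      then show ?thesis by linarith
    qed
  qed simp_all
qed

lemma pair_occupation_balance: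
  assumes uv: "u \<noteq> v" and "\<alpha> \<le> \<gamma>"
    and LLN: "LLN (\<lambda>y. y u = y v) u" "LLN (\<lambda>y. y v < y u) u" "LLN (\<lambda>y. y v < y u) v"
    and rates: "\<And>k. K \<le> k \<Longrightarrow> y k u = y k v \<Longrightarrow> r (y k) u = \<alpha>"
      "\<And>k. K \<le> k \<Longrightarrow> y k v < y k u \<Longrightarrow> r (y k) u = \<alpha> \<and> r (y k) v = \<gamma>"
  shows "(\<lambda>k. \<alpha> * occupation (\<lambda>y. y u = y v) k + (\<alpha> - \<gamma>) * occupation (\<lambda>y. y v < y u) k) \<in> o(\<lambda>k. real k)"
proof -
  let ?E = "\<lambda>y :: nat \<Rightarrow> nat. y u = y v" and ?G = "\<lambda>y :: nat \<Rightarrow> nat. y v < y u"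
  have "real (y k u - y k v) - real (y 0 u - y 0 v) - (jumps ?E u k - \<alpha> * occupation ?E k)
      - (jumps ?G u k - \<alpha> * occupation ?G k) + (jumps ?G v k - \<gamma> * occupation ?G k)
      = \<alpha> * occupation ?E k + (\<alpha> - \<gamma>) * occupation ?G k" for k
    using truncated_gap_eq_jumps[OF uv, of k] by (simp add: algebra_simps)
  moreover have "(\<lambda>k. real (y k u - y k v) - real (y 0 u - y 0 v) - (jumps ?E u k - \<alpha> * occupation ?E k)
      - (jumps ?G u k - \<alpha> * occupation ?G k) + (jumps ?G v k - \<gamma> * occupation ?G k)) \<in> o(\<lambda>k. real k)"
    by (intro sum_in_smallo truncated_gap_sublinear[OF uv assms(2) LLN(2,3) rates(2)] const_in_smallo_real
        jumps_approx_occupation[of _ _ K] LLN) (use rates in auto)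
  ultimately show ?thesis by (simp only:)
qed

text \<open>Let \<open>s\<^sub>0\<close>, \<open>s\<^sub>1\<close>, \<open>s\<^sub>2\<close> be the times spent in the three orderings of a pair. Balance gives
  \<open>\<alpha> s\<^sub>0 + (\<alpha> - \<gamma>) s\<^sub>1 \<approx> 0 \<approx> \<alpha> s\<^sub>0 + (\<alpha> - \<gamma>) s\<^sub>2\<close>; a linear combination of the two
  identifies the speed without dividing by \<open>\<gamma> - \<alpha>\<close>, which may vanish.\<close>

lemma pair_speed:
  assumes uv: "u \<noteq> v" and \<alpha>\<gamma>: "0 < \<alpha>" "\<alpha> \<le> \<gamma>"
    and LLN: "\<And>j. j \<in> {u, v} \<Longrightarrow> LLN (\<lambda>y. y u = y v) j"
      "\<And>j. j \<in> {u, v} \<Longrightarrow> LLN (\<lambda>y. y v < y u) j" "\<And>j. j \<in> {u, v} \<Longrightarrow> LLN (\<lambda>y. y u < y v) j"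
    and rates: "\<forall>\<^sub>F k in sequentially. r (y k) u = (if y k u < y k v then \<gamma> else \<alpha>) \<and>
      r (y k) v = (if y k v < y k u then \<gamma> else \<alpha>)"
  shows "(\<lambda>k. real (y k u) - vel \<alpha> \<gamma> * time k) \<in> o(\<lambda>k. real k)"
proof -
  obtain K where K: "\<And>k. K \<le> k \<Longrightarrow> r (y k) u = (if y k u < y k v then \<gamma> else \<alpha>) \<and>
      r (y k) v = (if y k v < y k u then \<gamma> else \<alpha>)"
    using rates unfolding eventually_sequentially by blast
  let ?E = "\<lambda>y :: nat \<Rightarrow> nat. y u = y v" and ?G = "\<lambda>y :: nat \<Rightarrow> nat. y v < y u"
    and ?L = "\<lambda>y :: nat \<Rightarrow> nat. y u < y v"
  define s0 where "s0 = occupation ?E"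
  define s1 where "s1 = occupation ?G"
  define s2 where "s2 = occupation ?L"
  have swap: "(\<lambda>y :: nat \<Rightarrow> nat. y v = y u) = ?E" by auto
  have balance: "(\<lambda>k. \<alpha> * s0 k + (\<alpha> - \<gamma>) * s1 k) \<in> o(\<lambda>k. real k)"
      "(\<lambda>k. \<alpha> * s0 k + (\<alpha> - \<gamma>) * s2 k) \<in> o(\<lambda>k. real k)"
    unfolding s0_def s1_def s2_def
    using pair_occupation_balance[OF uv \<alpha>\<gamma>(2), of K] pair_occupation_balance[OF uv[symmetric] \<alpha>\<gamma>(2), of K]
      LLN K unfolding swap by auto
  have approx: "(\<lambda>k. jumps ?E u k - \<alpha> * s0 k) \<in> o(\<lambda>k. real k)" "(\<lambda>k. jumps ?G u k - \<alpha> * s1 k) \<in> o(\<lambda>k. real k)"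
      "(\<lambda>k. jumps ?L u k - \<gamma> * s2 k) \<in> o(\<lambda>k. real k)"
    unfolding s0_def s1_def s2_def by (rule jumps_approx_occupation[of _ _ K]; use LLN K in auto)+
  have "time k = s0 k + s1 k + s2 k" for k
    unfolding time_def s0_def s1_def s2_def occupation_def sum.distrib[symmetric]
    by (intro sum.cong refl) (auto simp: of_bool_def)
  moreover have "jumps (\<lambda>_. True) u k = jumps ?E u k + jumps ?G u k + jumps ?L u k" for k
    unfolding jumps_def sum.distrib[symmetric] by (intro sum.cong refl) (auto simp: of_bool_def)
  moreover have "\<alpha> * a + \<alpha> * b + \<gamma> * d - vel \<alpha> \<gamma> * (a + b + d)
      = \<alpha> / (\<alpha> + \<gamma>) * (\<alpha> * a + (\<alpha> - \<gamma>) * b) - \<gamma> / (\<alpha> + \<gamma>) * (\<alpha> * a + (\<alpha> - \<gamma>) * d)" for a b d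
    using \<alpha>\<gamma> by (simp add: vel_def divide_simps) (simp add: algebra_simps)
  ultimately have "real (y k u) - vel \<alpha> \<gamma> * time k = (jumps ?E u k - \<alpha> * s0 k) + (jumps ?G u k - \<alpha> * s1 k)
      + (jumps ?L u k - \<gamma> * s2 k) + \<alpha> / (\<alpha> + \<gamma>) * (\<alpha> * s0 k + (\<alpha> - \<gamma>) * s1 k)
      - \<gamma> / (\<alpha> + \<gamma>) * (\<alpha> * s0 k + (\<alpha> - \<gamma>) * s2 k) + real (y 0 u)" for k
    unfolding height_eq_jumps[of k u] by (smt (verit))
  then show ?thesis
    by (simp only:) (intro sum_in_smallo approx balance cmult_in_smallo const_in_smallo_real)
qed

lemma incseq_time: "incseq time"
  unfolding time_def by (rule incseq_SucI) (simp add: h_nonneg)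

lemma speed_in_continuous_time:
  assumes linear: "0 < c" "\<forall>\<^sub>F k in sequentially. c * real k \<le> time k"
    and h: "h \<in> o(\<lambda>k. real k)" and a: "(\<lambda>k. a k - b * time k) \<in> o(\<lambda>k. real k)"
  shows "((\<lambda>t. a (card {k. 0 < k \<and> time k \<le> t}) / t) \<longlongrightarrow> b) at_top"
proof -
  have at_top: "filterlim time at_top sequentially"
    by (rule filterlim_at_top_mono
        [OF filterlim_tendsto_pos_mult_at_top[OF tendsto_const linear(1) filterlim_real_sequentially] linear(2)])
  interpret event_times time
    by unfold_locales (use incseq_time at_top in \<open>auto simp: time_def\<close>)
  have positive: "\<forall>\<^sub>F k in sequentially. 0 < time k"
    using at_top by (simp add: filterlim_at_top_dense)
  have real_le: "(\<lambda>k. real k) \<in> O(time)"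
  proof (rule landau_o.bigI[of "1 / c"])
    show "\<forall>\<^sub>F k in sequentially. norm (real k) \<le> 1 / c * norm (time k)"
      using linear(2) positive by eventually_elim (use linear(1) in \<open>simp add: field_simps\<close>)
  qed (use linear(1) in simp)
  have quotient: "(\<lambda>k. f k / time k) \<longlonglongrightarrow> 0" if "f \<in> o(\<lambda>k. real k)" for f
    by (rule smalloD_tendsto[OF landau_o.small_big_trans[OF that real_le]])
  have "(\<lambda>k. (a k - b * time k) / time k + b) \<longlonglongrightarrow> 0 + b"
    by (intro tendsto_add quotient a tendsto_const)
  then have "(\<lambda>k. a k / time k) \<longlonglongrightarrow> 0 + b"
    by (rule Lim_transform_eventually) (use positive in \<open>eventually_elim, simp add: diff_divide_distrib\<close>)
  moreover have "(\<lambda>k. 1 + h k / time k) \<longlonglongrightarrow> 1 + 0" by (intro tendsto_add tendsto_const quotient h)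
  then have "(\<lambda>k. time (Suc k) / time k) \<longlonglongrightarrow> 1 + 0"
    by (rule Lim_transform_eventually)
      (use positive in \<open>eventually_elim, simp add: time_def add_divide_distrib\<close>)
  ultimately show ?thesis using tendsto_at_event_count[of a b] by (simp add: event_count_def)
qed

end

subsection \<open>The site selection\<close>

context crystal_model
begin

definition cumulative_rate :: "(nat \<Rightarrow> nat) \<Rightarrow> nat \<Rightarrow> real" where
  "cumulative_rate y j = (\<Sum>i=1..j. site_rate y i)"

lemma cumulative_rate_0 [simp]: "cumulative_rate y 0 = 0"
  by (simp add: cumulative_rate_def)

lemma cumulative_rate_Suc: "cumulative_rate y (Suc j) = cumulative_rate y j + site_rate y (Suc j)"
  by (simp add: cumulative_rate_def)

lemma cumulative_rate_n: "cumulative_rate y n = q y"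
  by (simp add: cumulative_rate_def total_rate_def)

lemma cumulative_rate_mono: "i \<le> j \<Longrightarrow> cumulative_rate y i \<le> cumulative_rate y j"
  by (rule lift_Suc_mono_le[of "cumulative_rate y"])
    (use site_rate_pos in \<open>auto simp: cumulative_rate_Suc less_imp_le\<close>)

lemma choose_site_eq_Least:
  "choose_site b0 b1 b2 n y u = (LEAST j. 1 \<le> j \<and> (n \<le> j \<or> u * q y \<le> cumulative_rate y j))"
proof -
  define P where "P j \<longleftrightarrow> 1 \<le> j \<and> j \<le> n \<and> u * q y \<le> cumulative_rate y j" for j
  define Q where "Q j \<longleftrightarrow> 1 \<le> j \<and> (n \<le> j \<or> u * q y \<le> cumulative_rate y j)" for j
  have "choose_site b0 b1 b2 n y u = (if \<exists>j. P j then LEAST j. P j else n)"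
    unfolding choose_site_def P_def cumulative_rate_def ..
  also have "\<dots> = (LEAST j. Q j)"
  proof (cases "\<exists>j. P j")
    case True
    then have least: "P (LEAST j. P j)" by (rule LeastI_ex)
    have "(LEAST j. P j) \<le> j" if "Q j" for j
      using that least Least_le[of P j] by (cases "j \<le> n") (auto simp: P_def Q_def)
    then have "(LEAST j. Q j) = (LEAST j. P j)"
      using least by (intro Least_equality) (auto simp: P_def Q_def)
    then show ?thesis using True by simp
  next
    case False
    then have "n \<le> j" if "Q j" for j using that by (cases "j \<le> n") (auto simp: P_def Q_def)
    then have "(LEAST j. Q j) = n" using n_ge by (intro Least_equality) (auto simp: Q_def)
    then show ?thesis using False by simp
  qed
  finally show ?thesis unfolding Q_def .
qed

lemma choose_site_range: "choose_site b0 b1 b2 n y u \<in> {1..n}"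
proof -
  let ?Q = "\<lambda>j. 1 \<le> j \<and> (n \<le> j \<or> u * q y \<le> cumulative_rate y j)"
  have n: "?Q n" using n_ge by simp
  then have "?Q (LEAST j. ?Q j)" by (rule LeastI)
  moreover have "(LEAST j. ?Q j) \<le> n" using n by (rule Least_le)
  ultimately show ?thesis unfolding choose_site_eq_Least by simp
qed

lemma choose_site_eq_iff:
  assumes "1 \<le> j" "j \<le> n"
  shows "choose_site b0 b1 b2 n y u = j \<longleftrightarrow>
    (j = 1 \<or> cumulative_rate y (j - 1) < u * q y) \<and> (u * q y \<le> cumulative_rate y j \<or> j = n)"
proof -
  define Q where "Q j \<longleftrightarrow> 1 \<le> j \<and> (n \<le> j \<or> u * q y \<le> cumulative_rate y j)" for j
  have Q_mono: "Q k" if "Q i" "i \<le> k" for i k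
    using that cumulative_rate_mono[of i k y] by (auto simp: Q_def)
  have "Q n" using n_ge by (simp add: Q_def)
  have "(LEAST j. Q j) = j \<longleftrightarrow> Q j \<and> \<not> Q (j - 1)"
  proof
    assume "(LEAST j. Q j) = j"
    then show "Q j \<and> \<not> Q (j - 1)"
      using LeastI[of Q, OF \<open>Q n\<close>] not_less_Least[of "j - 1" Q] assms(1) by auto
  next
    assume j: "Q j \<and> \<not> Q (j - 1)"
    then have "j \<le> i" if "Q i" for i using Q_mono[of i "j - 1"] that by linarith
    then show "(LEAST j. Q j) = j" using j by (intro Least_equality) auto
  qed
  moreover have "Q (j - 1) \<longleftrightarrow> j \<noteq> 1 \<and> u * q y \<le> cumulative_rate y (j - 1)"
    using assms by (auto simp: Q_def)
  moreover have "Q j \<longleftrightarrow> u * q y \<le> cumulative_rate y j \<or> j = n" using assms by (auto simp: Q_def)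
  ultimately show ?thesis unfolding choose_site_eq_Least Q_def[symmetric] by (auto simp: not_le)
qed

lemma choose_site_borel: "1 \<le> j \<Longrightarrow> j \<le> n \<Longrightarrow> {u. choose_site b0 b1 b2 n y u = j} \<in> sets borel"
  by (simp add: choose_site_eq_iff)

lemma measure_choose_site:
  assumes j: "1 \<le> j" "j \<le> n"
  shows "measure (uniform_measure lborel {0..1}) {u. choose_site b0 b1 b2 n y u = j} = jump_prob y j"
proof -
  define S where "S = {u. choose_site b0 b1 b2 n y u = j}"
  define l where "l = cumulative_rate y (j - 1) / q y"
  define r where "r = cumulative_rate y j / q y"
  have S: "S \<in> sets borel" unfolding S_def by (rule choose_site_borel[OF j])
  have mem_S_iff: "u \<in> S \<longleftrightarrow> (j = 1 \<or> l < u) \<and> (u \<le> r \<or> j = n)" for u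
    unfolding S_def mem_Collect_eq choose_site_eq_iff[OF j] l_def r_def
    using q_pos[of y] by (simp add: pos_divide_less_eq pos_le_divide_eq)
  have "j = 1 \<Longrightarrow> l = 0" "j = n \<Longrightarrow> r = 1"
    using q_pos[of y] by (simp_all add: l_def r_def cumulative_rate_n)
  moreover have lr: "0 \<le> l" "r \<le> 1" "l \<le> r"
    using cumulative_rate_mono[of 0 "j - 1" y] cumulative_rate_mono[of j n y] cumulative_rate_mono[of "j - 1" j y]
      q_pos[of y] j by (simp_all add: l_def r_def cumulative_rate_n divide_right_mono)
  ultimately have "{l<..r} \<subseteq> {0..1} \<inter> S" "{0..1} \<inter> S \<subseteq> {l..r}" by (auto simp: mem_S_iff)
  then have "emeasure lborel {l<..r} \<le> emeasure lborel ({0..1} \<inter> S)"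
    "emeasure lborel ({0..1} \<inter> S) \<le> emeasure lborel {l..r}"
    using S by (auto intro!: emeasure_mono)
  then have "emeasure (uniform_measure lborel {0..1}) S = ennreal (r - l)"
    using S lr by (simp add: emeasure_uniform_measure divide_ennreal_def)
  moreover have "r - l = jump_prob y j"
    using cumulative_rate_Suc[of y "j - 1"] j
    by (simp add: l_def r_def jump_prob_def flip: diff_divide_distrib)
  ultimately show ?thesis using lr by (simp add: measure_def S_def)
qed

end

subsection \<open>The crystal process\<close>

lemma AE_tendsto_0_if_summable_second_moments:
  fixes X :: "nat \<Rightarrow> 'a \<Rightarrow> real"
  assumes [measurable]: "\<And>r. X r \<in> borel_measurable M" and int: "\<And>r. integrable M (\<lambda>\<omega>. (X r \<omega>)\<^sup>2)"
    and summable: "summable (\<lambda>r. \<integral>\<omega>. (X r \<omega>)\<^sup>2 \<partial>M)"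
  shows "AE \<omega> in M. (\<lambda>r. X r \<omega>) \<longlonglongrightarrow> 0"
proof -
  have "(\<integral>\<^sup>+ \<omega>. (\<Sum>r. ennreal ((X r \<omega>)\<^sup>2)) \<partial>M) = (\<Sum>r. \<integral>\<^sup>+ \<omega>. ennreal ((X r \<omega>)\<^sup>2) \<partial>M)"
    by (rule nn_integral_suminf) measurable
  also have "\<dots> = (\<Sum>r. ennreal (\<integral>\<omega>. (X r \<omega>)\<^sup>2 \<partial>M))"
    by (simp add: nn_integral_eq_integral[OF int])
  also have "\<dots> \<noteq> \<infinity>" using summable by (subst suminf_ennreal2) auto
  finally have "AE \<omega> in M. (\<Sum>r. ennreal ((X r \<omega>)\<^sup>2)) \<noteq> \<infinity>"
    by (intro nn_integral_noteq_infinite) auto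
  then show ?thesis
  proof eventually_elim
    case (elim \<omega>)
    then have "summable (\<lambda>r. (X r \<omega>)\<^sup>2)" by (intro summable_suminf_not_top) auto
    then have "(\<lambda>r. (X r \<omega>)\<^sup>2) \<longlonglongrightarrow> 0" by (rule summable_LIMSEQ_zero)
    then have "(\<lambda>r. \<bar>X r \<omega>\<bar>) \<longlonglongrightarrow> 0" using tendsto_real_sqrt[of "\<lambda>r. (X r \<omega>)\<^sup>2" 0] by simp
    then show ?case by (rule tendsto_rabs_zero_cancel)
  qed
qed

lemma AE_squares_tendsto_0:
  fixes S :: "nat \<Rightarrow> 'a \<Rightarrow> real"
  assumes "\<And>k. S k \<in> borel_measurable M" and int: "\<And>k. integrable M (\<lambda>\<omega>. (S k \<omega>)\<^sup>2)"
    and moment: "\<And>k. (\<integral>\<omega>. (S k \<omega>)\<^sup>2 \<partial>M) \<le> real k"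
  shows "AE \<omega> in M. (\<lambda>r. S (r\<^sup>2) \<omega> / real (r\<^sup>2)) \<longlonglongrightarrow> 0"
proof (rule AE_tendsto_0_if_summable_second_moments)
  show "(\<lambda>\<omega>. S (r\<^sup>2) \<omega> / real (r\<^sup>2)) \<in> borel_measurable M" for r using assms(1) by measurable
  show "integrable M (\<lambda>\<omega>. (S (r\<^sup>2) \<omega> / real (r\<^sup>2))\<^sup>2)" for r
    unfolding power_divide by (intro integrable_divide_zero int)
  show "summable (\<lambda>r. \<integral>\<omega>. (S (r\<^sup>2) \<omega> / real (r\<^sup>2))\<^sup>2 \<partial>M)"
  proof (rule summable_comparison_test')
    show "summable (\<lambda>r. inverse (real r ^ 2))" by (rule inverse_power_summable) simp
    fix r
    have "(\<integral>\<omega>. (S (r\<^sup>2) \<omega> / real (r\<^sup>2))\<^sup>2 \<partial>M) \<le> real (r\<^sup>2) / (real (r\<^sup>2))\<^sup>2"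
      using moment[of "r\<^sup>2"] by (simp add: power_divide divide_right_mono)
    also have "\<dots> = inverse (real r ^ 2)"
      by (cases "r = 0") (auto simp: field_simps power2_eq_square)
    finally show "norm (\<integral>\<omega>. (S (r\<^sup>2) \<omega> / real (r\<^sup>2))\<^sup>2 \<partial>M) \<le> inverse (real r ^ 2)" by simp
  qed
qed

lemma eventually_constant_if_no_entrances:
  assumes "\<forall>\<^sub>F k in sequentially. \<not> (\<not> P k \<and> P (Suc k))"
  shows "(\<forall>\<^sub>F k in sequentially. P k) \<or> (\<forall>\<^sub>F k in sequentially. \<not> P k)"
proof -
  obtain K where K: "\<And>k. K \<le> k \<Longrightarrow> \<not> P k \<Longrightarrow> \<not> P (Suc k)"
    using assms by (auto simp: eventually_sequentially)
  show ?thesis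
  proof (cases "\<exists>k0\<ge>K. \<not> P k0")
    case True
    then obtain k0 where k0: "K \<le> k0" "\<not> P k0" by blast
    have "\<not> P k" if "k0 \<le> k" for k using that
      by (induction k rule: dec_induct) (use k0 K in auto)
    then show ?thesis by (auto simp: eventually_sequentially)
  qed (auto simp: eventually_sequentially)
qed

lemma eventually_constant_set:
  fixes S :: "nat \<Rightarrow> 'b set"
  assumes "finite A" "\<And>k. S k \<subseteq> A"
    and "\<And>a. a \<in> A \<Longrightarrow> (\<forall>\<^sub>F k in sequentially. a \<in> S k) \<or> (\<forall>\<^sub>F k in sequentially. a \<notin> S k)"
  obtains S' where "S' \<subseteq> A" "\<forall>\<^sub>F k in sequentially. S k = S'"
proof
  define S' where "S' = {a \<in> A. \<forall>\<^sub>F k in sequentially. a \<in> S k}"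
  show "S' \<subseteq> A" by (auto simp: S'_def)
  have "\<forall>\<^sub>F k in sequentially. a \<in> S k \<longleftrightarrow> a \<in> S'" if "a \<in> A" for a
    using assms(3)[OF that] that
    by (cases "\<forall>\<^sub>F k in sequentially. a \<in> S k") (auto simp: S'_def elim: eventually_mono)
  then have "\<forall>\<^sub>F k in sequentially. \<forall>a\<in>A. a \<in> S k \<longleftrightarrow> a \<in> S'"
    using assms(1) by (intro eventually_ball_finite) auto
  then show "\<forall>\<^sub>F k in sequentially. S k = S'"
    by eventually_elim (use assms(2) in \<open>auto simp: S'_def\<close>)
qed

locale crystal_process = crystal_model b0 b1 b2 n + prob_space M
  for b0 b1 b2 :: real and n :: nat and M :: "'a measure" +
  fixes E U :: "nat \<Rightarrow> 'a \<Rightarrow> real" and x :: "nat \<Rightarrow> nat"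
  assumes E_exp: "\<And>k. distributed M lborel (E k) (exponential_density 1)"
    and U_meas: "\<And>k. U k \<in> borel_measurable M"
    and U_unif: "\<And>k. distr M lborel (U k) = uniform_measure lborel {0..1}"
    and EU_indep: "indep_vars (\<lambda>_. borel) (\<lambda>i. case i of Inl k \<Rightarrow> E k | Inr k \<Rightarrow> U k) UNIV"
begin

definition state :: "nat \<Rightarrow> 'a \<Rightarrow> nat \<Rightarrow> nat" where
  "state k \<omega> = jump_chain b0 b1 b2 n x (\<lambda>k. U k \<omega>) k"

definition site :: "nat \<Rightarrow> 'a \<Rightarrow> nat" where
  "site k \<omega> = choose_site b0 b1 b2 n (state k \<omega>) (U k \<omega>)"

definition history :: "nat \<Rightarrow> 'a \<Rightarrow> nat list" where
  "history k \<omega> = map (\<lambda>i. site i \<omega>) [0..<k]"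

lemma state_Suc: "state (Suc k) \<omega> = bump (state k \<omega>) (site k \<omega>)"
  by (simp add: state_def site_def Let_def bump_def)

lemma site_range: "site k \<omega> \<in> {1..n}"
  unfolding site_def by (rule choose_site_range)

lemma history_0 [simp]: "history 0 \<omega> = []"
  by (simp add: history_def)

lemma history_Suc: "history (Suc k) \<omega> = history k \<omega> @ [site k \<omega>]"
  by (simp add: history_def)

lemma length_history [simp]: "length (history k \<omega>) = k"
  by (simp add: history_def)

lemma set_history: "set (history k \<omega>) \<subseteq> {1..n}"
  using site_range by (auto simp: history_def)

lemma nth_history: "i < k \<Longrightarrow> history k \<omega> ! i = site i \<omega>"
  by (simp add: history_def)

lemma take_history: "i \<le> k \<Longrightarrow> take i (history k \<omega>) = history i \<omega>"
  by (simp add: history_def take_map)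

lemma state_eq_foldl: "state k \<omega> = foldl bump x (history k \<omega>)"
  by (induction k) (auto simp: state_Suc history_Suc, simp add: state_def)

lemma history_eq_iff:
  assumes "length w = k"
  shows "history k \<omega> = w \<longleftrightarrow>
    (\<forall>i<k. choose_site b0 b1 b2 n (foldl bump x (take i w)) (U i \<omega>) = w ! i)"
proof
  assume w: "history k \<omega> = w"
  show "\<forall>i<k. choose_site b0 b1 b2 n (foldl bump x (take i w)) (U i \<omega>) = w ! i"
    unfolding w[symmetric] by (simp add: take_history nth_history site_def flip: state_eq_foldl)
next
  assume sites: "\<forall>i<k. choose_site b0 b1 b2 n (foldl bump x (take i w)) (U i \<omega>) = w ! i"
  have "history i \<omega> = take i w" if "i \<le> k" for i using that
  proof (induction i)
    case (Suc i)
    then have IH: "history i \<omega> = take i w" by simp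
    have "site i \<omega> = w ! i" using sites Suc.prems unfolding site_def state_eq_foldl IH by simp
    then show ?case using Suc.prems assms by (simp add: history_Suc IH take_Suc_conv_app_nth)
  qed simp
  from this[of k] show "history k \<omega> = w" using assms by simp
qed

subsubsection \<open>The joint law of the history and the clocks\<close>

lemma E_meas: "E k \<in> borel_measurable M"
  using distributed_measurable[OF E_exp, of k] by simp

lemma prob_choose_site:
  assumes "j \<in> {1..n}"
  shows "(\<integral>\<omega>. indicator {u. choose_site b0 b1 b2 n y u = j} (U k \<omega>) \<partial>M) = jump_prob y j"
proof -
  let ?S = "{u. choose_site b0 b1 b2 n y u = j}"
  have S: "?S \<in> sets borel" using assms by (intro choose_site_borel) auto
  have "U k \<in> measurable M lborel" using U_meas[of k] by simp
  then have "(\<integral>\<omega>. indicator ?S (U k \<omega>) \<partial>M) = (\<integral>u. indicator ?S u \<partial>distr M lborel (U k) :: real)"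
    by (rule integral_distr[symmetric]) (use S in simp)
  also have "\<dots> = measure (uniform_measure lborel {0..1}) ?S"
    using S by (subst Bochner_Integration.integral_indicator) (simp_all add: U_unif)
  also have "\<dots> = jump_prob y j" using assms by (intro measure_choose_site) auto
  finally show ?thesis .
qed

lemma product_clocks_draws:
  fixes \<phi> \<psi> :: "nat \<Rightarrow> real \<Rightarrow> real"
  assumes fin: "finite L" "finite K"
    and meas: "\<And>l. \<phi> l \<in> borel_measurable borel" "\<And>i. \<psi> i \<in> borel_measurable borel"
    and int: "\<And>l. integrable M (\<lambda>\<omega>. \<phi> l (E l \<omega>))" "\<And>i. integrable M (\<lambda>\<omega>. \<psi> i (U i \<omega>))"
  shows "integrable M (\<lambda>\<omega>. (\<Prod>i\<in>K. \<psi> i (U i \<omega>)) * (\<Prod>l\<in>L. \<phi> l (E l \<omega>)))"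
    and "(\<integral>\<omega>. (\<Prod>i\<in>K. \<psi> i (U i \<omega>)) * (\<Prod>l\<in>L. \<phi> l (E l \<omega>)) \<partial>M)
      = (\<Prod>i\<in>K. \<integral>\<omega>. \<psi> i (U i \<omega>) \<partial>M) * (\<Prod>l\<in>L. \<integral>\<omega>. \<phi> l (E l \<omega>) \<partial>M)"
proof -
  define T where "T = Inl ` L \<union> (Inr ` K :: (nat + nat) set)"
  define g where "g = case_sum \<phi> \<psi>"
  define X where "X s = (\<lambda>\<omega>. g s ((case s of Inl k \<Rightarrow> E k | Inr k \<Rightarrow> U k) \<omega>))" for s
  have T: "finite T" using fin by (simp add: T_def)
  have "indep_vars (\<lambda>_. borel) X T"
    unfolding X_def
    by (rule indep_vars_subset[OF indep_vars_compose2[OF EU_indep]]) (use meas in \<open>auto simp: g_def split: sum.split\<close>)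
  moreover have "integrable M (X s)" for s using int by (cases s) (simp_all add: X_def g_def)
  ultimately have "integrable M (\<lambda>\<omega>. \<Prod>s\<in>T. X s \<omega>)"
    and "(\<integral>\<omega>. (\<Prod>s\<in>T. X s \<omega>) \<partial>M) = (\<Prod>s\<in>T. \<integral>\<omega>. X s \<omega> \<partial>M)"
    using T by (auto intro: indep_vars_integrable indep_vars_lebesgue_integral)
  moreover have "(\<Prod>s\<in>T. f s) = (\<Prod>i\<in>K. f (Inr i)) * (\<Prod>l\<in>L. f (Inl l))" for f :: "nat + nat \<Rightarrow> real"
    unfolding T_def using fin by (subst prod.union_disjoint) (auto simp: prod.reindex mult.commute)
  ultimately show "integrable M (\<lambda>\<omega>. (\<Prod>i\<in>K. \<psi> i (U i \<omega>)) * (\<Prod>l\<in>L. \<phi> l (E l \<omega>)))"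
    and "(\<integral>\<omega>. (\<Prod>i\<in>K. \<psi> i (U i \<omega>)) * (\<Prod>l\<in>L. \<phi> l (E l \<omega>)) \<partial>M)
      = (\<Prod>i\<in>K. \<integral>\<omega>. \<psi> i (U i \<omega>) \<partial>M) * (\<Prod>l\<in>L. \<integral>\<omega>. \<phi> l (E l \<omega>) \<partial>M)"
    by (simp_all add: X_def g_def)
qed

lemma history_event_times_clocks:
  fixes \<phi> :: "nat \<Rightarrow> real \<Rightarrow> real"
  assumes w: "set w \<subseteq> {1..n}" "length w = k" and L: "finite L"
    and \<phi>: "\<And>l. \<phi> l \<in> borel_measurable borel" "\<And>l. integrable M (\<lambda>\<omega>. \<phi> l (E l \<omega>))"
  shows "integrable M (\<lambda>\<omega>. of_bool (history k \<omega> = w) * (\<Prod>l\<in>L. \<phi> l (E l \<omega>)))"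
    and "(\<integral>\<omega>. of_bool (history k \<omega> = w) * (\<Prod>l\<in>L. \<phi> l (E l \<omega>)) \<partial>M)
      = weight x w * (\<Prod>l\<in>L. \<integral>\<omega>. \<phi> l (E l \<omega>) \<partial>M)"
proof -
  define D where "D i =
    (if i < k then {u. choose_site b0 b1 b2 n (foldl bump x (take i w)) u = w ! i} else {})" for i
  have site: "w ! i \<in> {1..n}" if "i < k" for i using w that nth_mem by blast
  have D: "D i \<in> sets borel" for i using site[of i] by (auto simp: D_def intro: choose_site_borel)
  have int: "integrable M (\<lambda>\<omega>. indicator (D i) (U i \<omega>) :: real)" for i
  proof (rule integrable_const_bound[of _ 1])
    show "(\<lambda>\<omega>. indicator (D i) (U i \<omega>) :: real) \<in> borel_measurable M"
      using D[of i] U_meas[of i] by measurable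
  qed (auto split: split_indicator)
  have eq: "(\<Prod>i<k. indicator (D i) (U i \<omega>)) = (of_bool (history k \<omega> = w) :: real)" for \<omega>
  proof -
    have "(\<Prod>i<k. indicator (D i) (U i \<omega>)) = (of_bool (\<forall>i<k. U i \<omega> \<in> D i) :: real)"
      by (induction k) (auto simp: less_Suc_eq indicator_def)
    then show ?thesis unfolding history_eq_iff[OF w(2)] by (simp add: D_def)
  qed
  have "(\<Prod>i<k. \<integral>\<omega>. indicator (D i) (U i \<omega>) \<partial>M) = weight x w"
    unfolding weight_eq_prod w(2)
    by (intro prod.cong refl) (use prob_choose_site[OF site] in \<open>simp add: D_def\<close>)
  then show "integrable M (\<lambda>\<omega>. of_bool (history k \<omega> = w) * (\<Prod>l\<in>L. \<phi> l (E l \<omega>)))"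
    and "(\<integral>\<omega>. of_bool (history k \<omega> = w) * (\<Prod>l\<in>L. \<phi> l (E l \<omega>)) \<partial>M)
      = weight x w * (\<Prod>l\<in>L. \<integral>\<omega>. \<phi> l (E l \<omega>) \<partial>M)"
    using product_clocks_draws[of L "{..<k}" \<phi> "\<lambda>i. indicator (D i)"] L \<phi> D int
    by (simp_all add: eq)
qed

lemma history_function_times_clocks:
  fixes \<phi> :: "nat \<Rightarrow> real \<Rightarrow> real" and F :: "nat list \<Rightarrow> real"
  assumes L: "finite L"
    and \<phi>: "\<And>l. \<phi> l \<in> borel_measurable borel" "\<And>l. integrable M (\<lambda>\<omega>. \<phi> l (E l \<omega>))"
  shows "integrable M (\<lambda>\<omega>. F (history k \<omega>) * (\<Prod>l\<in>L. \<phi> l (E l \<omega>)))"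
    and "(\<integral>\<omega>. F (history k \<omega>) * (\<Prod>l\<in>L. \<phi> l (E l \<omega>)) \<partial>M)
      = mean_word k x F * (\<Prod>l\<in>L. \<integral>\<omega>. \<phi> l (E l \<omega>) \<partial>M)"
proof -
  define Ws where "Ws = {w. set w \<subseteq> {1..n} \<and> length w = k}"
  have fin: "finite Ws" unfolding Ws_def by (rule finite_lists_length_eq) simp
  let ?g = "\<lambda>w \<omega>. of_bool (history k \<omega> = w) * (\<Prod>l\<in>L. \<phi> l (E l \<omega>))"
  have eq: "F (history k \<omega>) * (\<Prod>l\<in>L. \<phi> l (E l \<omega>)) = (\<Sum>w\<in>Ws. F w * ?g w \<omega>)" for \<omega>
  proof -
    have "(\<Sum>w\<in>Ws. F w * ?g w \<omega>) = (\<Sum>w\<in>Ws. if w = history k \<omega> then F w * (\<Prod>l\<in>L. \<phi> l (E l \<omega>)) else 0)"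
      by (intro sum.cong) auto
    also have "\<dots> = F (history k \<omega>) * (\<Prod>l\<in>L. \<phi> l (E l \<omega>))"
      using fin set_history[of k \<omega>] by (simp add: Ws_def)
    finally show ?thesis by simp
  qed
  have int: "integrable M (?g w)" and law: "(\<integral>\<omega>. ?g w \<omega> \<partial>M) = weight x w * (\<Prod>l\<in>L. \<integral>\<omega>. \<phi> l (E l \<omega>) \<partial>M)"
    if "w \<in> Ws" for w
    using that history_event_times_clocks[of w k L \<phi>] L \<phi> by (auto simp: Ws_def)
  show "integrable M (\<lambda>\<omega>. F (history k \<omega>) * (\<Prod>l\<in>L. \<phi> l (E l \<omega>)))"
    unfolding eq using int by auto
  have "(\<integral>\<omega>. (\<Sum>w\<in>Ws. F w * ?g w \<omega>) \<partial>M) = (\<Sum>w\<in>Ws. \<integral>\<omega>. F w * ?g w \<omega> \<partial>M)"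
    by (intro Bochner_Integration.integral_sum integrable_mult_right int)
  also have "\<dots> = (\<Sum>w\<in>Ws. F w * (weight x w * (\<Prod>l\<in>L. \<integral>\<omega>. \<phi> l (E l \<omega>) \<partial>M)))"
    by (intro sum.cong refl) (use law in simp)
  also have "\<dots> = mean_word k x F * (\<Prod>l\<in>L. \<integral>\<omega>. \<phi> l (E l \<omega>) \<partial>M)"
    unfolding mean_word_eq_sum Ws_def by (simp add: sum_distrib_left mult_ac)
  finally show "(\<integral>\<omega>. F (history k \<omega>) * (\<Prod>l\<in>L. \<phi> l (E l \<omega>)) \<partial>M)
      = mean_word k x F * (\<Prod>l\<in>L. \<integral>\<omega>. \<phi> l (E l \<omega>) \<partial>M)" unfolding eq .
qed

lemma integrable_history: "integrable M (\<lambda>\<omega>. F (history k \<omega>) :: real)"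
proof -
  have "integrable M (\<lambda>\<omega>. F (history k \<omega>) * (\<Prod>l\<in>{}. (\<lambda>_ _. 0) l (E l \<omega>)))"
    by (rule history_function_times_clocks(1)) auto
  then show ?thesis by (simp only: prod.empty mult_1_right)
qed

lemma integral_history: "(\<integral>\<omega>. F (history k \<omega>) \<partial>M) = mean_word k x F"
proof -
  have "(\<integral>\<omega>. F (history k \<omega>) * (\<Prod>l\<in>{}. (\<lambda>_ _. 0) l (E l \<omega>)) \<partial>M)
      = mean_word k x F * (\<Prod>l\<in>{}. \<integral>\<omega>. (\<lambda>_ _. 0) l (E l \<omega>) \<partial>M)"
    by (rule history_function_times_clocks(2)) auto
  then show ?thesis by (simp only: prod.empty mult_1_right)
qed

lemma history_measurable: "(\<lambda>\<omega>. F (history k \<omega>) :: real) \<in> borel_measurable M"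
  using integrable_history by (rule borel_measurable_integrable)

lemma history_events: "{\<omega> \<in> space M. P (history k \<omega>)} \<in> events"
proof -
  have "{\<omega> \<in> space M. (of_bool (P (history k \<omega>)) :: real) = 1} \<in> events"
    using history_measurable[of "\<lambda>w. of_bool (P w)" k] by measurable
  then show ?thesis by simp
qed

lemma prob_history: "prob {\<omega> \<in> space M. P (history k \<omega>)} = mean_word k x (\<lambda>w. of_bool (P w))"
proof -
  have "mean_word k x (\<lambda>w. of_bool (P w)) = (\<integral>\<omega>. indicator {\<omega> \<in> space M. P (history k \<omega>)} \<omega> \<partial>M)"
    unfolding integral_history[symmetric]
    by (intro Bochner_Integration.integral_cong) (auto simp: indicator_def)
  then show ?thesis using history_events[of P k] by simp
qed

subsubsection \<open>Almost sure behaviour of the jump chain\<close>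

lemma AE_eventually_constant:
  assumes "persistent B"
  shows "AE \<omega> in M. (\<forall>\<^sub>F k in sequentially. state k \<omega> \<in> B) \<or> (\<forall>\<^sub>F k in sequentially. state k \<omega> \<notin> B)"
proof -
  obtain d where d: "0 < d" "\<And>y. y \<in> B \<Longrightarrow> d \<le> remain_prob B y"
    using assms unfolding persistent_def by blast
  define entrance where "entrance k = {\<omega> \<in> space M. state k \<omega> \<notin> B \<and> state (Suc k) \<omega> \<in> B}" for k
  have entrance_eq: "entrance k =
    {\<omega> \<in> space M. (\<lambda>w. foldl bump x (take k w) \<notin> B \<and> foldl bump x w \<in> B) (history (Suc k) \<omega>)}" for k
    unfolding entrance_def by (simp add: take_history state_eq_foldl)
  have events: "entrance k \<in> events" for k unfolding entrance_eq by (rule history_events)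
  have "prob (entrance k) =
    mean_word (Suc k) x (\<lambda>w. of_bool (foldl bump x (take k w) \<notin> B \<and> foldl bump x w \<in> B))" for k
    unfolding entrance_eq by (rule prob_history)
  then have "d * (\<Sum>k<m. prob (entrance k)) \<le> 1" for m
    using expected_entrances_le[where B = B and d = d and m = m and y = x] d(2) by (simp only:)
  then have "(\<Sum>k<m. prob (entrance k)) \<le> 1 / d" for m
    using d(1) by (simp add: pos_le_divide_eq mult.commute)
  then have "summable (\<lambda>k. prob (entrance k))" by (intro summableI_nonneg_bounded) auto
  then have "AE \<omega> in M. \<forall>\<^sub>F k in sequentially. \<omega> \<in> space M - entrance k"
    using events by (intro borel_cantelli_AE1) (auto simp: emeasure_eq_measure)
  then show ?thesis
  proof eventually_elim
    case (elim \<omega>)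
    then have "\<forall>\<^sub>F k in sequentially. \<not> (state k \<omega> \<notin> B \<and> state (Suc k) \<omega> \<in> B)"
      by eventually_elim (simp add: entrance_def)
    then show ?case by (rule eventually_constant_if_no_entrances)
  qed
qed

lemma stays_from_eq_history_event:
  "{\<omega> \<in> space M. \<forall>i\<le>l. state (k + i) \<omega> \<in> A}
    = {\<omega> \<in> space M. (\<lambda>w. \<forall>i\<le>l. foldl bump x (take (k + i) w) \<in> A) (history (k + l) \<omega>)}"
  by (simp add: take_history state_eq_foldl)

lemma prob_stays_from:
  "prob {\<omega> \<in> space M. \<forall>i\<le>l. state (k + i) \<omega> \<in> A} = mean_word k x (\<lambda>w. stay_prob A l (foldl bump x w))"
proof -
  have "prob {\<omega> \<in> space M. \<forall>i\<le>l. state (k + i) \<omega> \<in> A}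
      = mean_word (k + l) x (\<lambda>w. of_bool (\<forall>i\<le>l. foldl bump x (take (k + i) w) \<in> A))"
    unfolding stays_from_eq_history_event by (rule prob_history)
  also have "\<dots> = mean_word k x (\<lambda>w. mean_word l (foldl bump x w)
      (\<lambda>w'. of_bool (\<forall>i\<le>l. foldl bump x (take (k + i) (w @ w')) \<in> A)))"
    by (rule mean_word_append)
  also have "\<dots> = mean_word k x (\<lambda>w. stay_prob A l (foldl bump x w))"
    unfolding stay_prob_eq_mean_word by (rule mean_word_cong) simp
  finally show ?thesis .
qed

lemma AE_not_eventually_in:
  assumes "surely_left A"
  shows "AE \<omega> in M. \<not> (\<forall>\<^sub>F k in sequentially. state k \<omega> \<in> A)"
proof -
  have "AE \<omega> in M. \<not> (\<forall>i. state (k + i) \<omega> \<in> A)" for k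
  proof -
    define N where "N l = {\<omega> \<in> space M. \<forall>i\<le>l. state (k + i) \<omega> \<in> A}" for l
    have N: "N l \<in> events" for l
      unfolding N_def stays_from_eq_history_event by (rule history_events)
    have "(\<lambda>l. prob (N l)) \<longlonglongrightarrow> mean_word k x (\<lambda>w. 0)"
      unfolding N_def prob_stays_from
      by (rule mean_word_tendsto) (use stay_prob_LIMSEQ assms in \<open>metis surely_left_def\<close>)
    then have "(\<lambda>l. prob (N l)) \<longlonglongrightarrow> 0" unfolding mean_word_const .
    moreover have "prob (\<Inter>l. N l) \<le> prob (N l)" for l using N by (intro finite_measure_mono) auto
    ultimately have "prob (\<Inter>l. N l) \<le> 0" by (intro LIMSEQ_le_const) auto
    then have "prob (\<Inter>l. N l) = 0" by (rule antisym) (rule measure_nonneg)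
    then have "AE \<omega> in M. \<omega> \<notin> (\<Inter>l. N l)" using N by (subst prob_eq_0[symmetric]) auto
    then show ?thesis using AE_space by eventually_elim (auto simp: N_def)
  qed
  then have "AE \<omega> in M. \<forall>k. \<not> (\<forall>i. state (k + i) \<omega> \<in> A)" by (simp add: AE_all_countable)
  then show ?thesis by eventually_elim (auto simp: eventually_sequentially le_iff_add)
qed

subsubsection \<open>Laws of large numbers\<close>

lemma AE_compensated_jumps:
  assumes j: "j \<in> {1..n}" and f: "\<And>y. \<bar>f y\<bar> \<le> 1"
  shows "AE \<omega> in M. (\<lambda>k. \<Sum>i<k. f (state i \<omega>) * (of_bool (site i \<omega> = j) - jump_prob (state i \<omega>) j))
    \<in> o(\<lambda>k. real k)"
proof -
  define S where "S k \<omega> = compensated f j x (history k \<omega>)" for k \<omega>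
  have S_Suc: "S (Suc k) \<omega> =
    S k \<omega> + f (state k \<omega>) * (of_bool (site k \<omega> = j) - jump_prob (state k \<omega>) j)" for k \<omega>
    unfolding S_def history_Suc compensated_snoc by (simp flip: state_eq_foldl)
  have S_eq: "(\<Sum>i<k. f (state i \<omega>) * (of_bool (site i \<omega> = j) - jump_prob (state i \<omega>) j)) = S k \<omega>" for k \<omega>
    by (induction k) (simp_all add: S_Suc, simp add: S_def compensated_def)
  have "AE \<omega> in M. (\<lambda>r. S (r\<^sup>2) \<omega> / real (r\<^sup>2)) \<longlonglongrightarrow> 0"
    unfolding S_def
  proof (intro AE_squares_tendsto_0 history_measurable integrable_history)
    show "(\<integral>\<omega>. (compensated f j x (history k \<omega>))\<^sup>2 \<partial>M) \<le> real k" for k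
      unfolding integral_history[of "\<lambda>w. (compensated f j x w)\<^sup>2"]
      by (rule mean_word_compensated_square[OF j f])
  qed
  then show ?thesis
    unfolding S_eq
  proof eventually_elim
    case (elim \<omega>)
    have "\<bar>f (state k \<omega>)\<bar> * \<bar>of_bool (site k \<omega> = j) - jump_prob (state k \<omega>) j\<bar> \<le> 1" for k
      by (intro mult_le_one f abs_of_bool_minus_p_le_1[OF j] abs_ge_zero)
    then have "\<bar>S (Suc k) \<omega> - S k \<omega>\<bar> \<le> 1" for k by (simp add: S_Suc abs_mult)
    then show ?case by (rule smallo_real_if_squares[OF _ elim const_between_squares_tendsto_0])
  qed
qed

lemma E_centred: "integrable M (\<lambda>\<omega>. E k \<omega> - 1)" "(\<integral>\<omega>. E k \<omega> - 1 \<partial>M) = 0"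
  and E_variance: "integrable M (\<lambda>\<omega>. (E k \<omega> - 1)\<^sup>2)" "(\<integral>\<omega>. (E k \<omega> - 1)\<^sup>2 \<partial>M) = 1"
proof -
  have int: "integrable M (E k)" "integrable M (\<lambda>\<omega>. (E k \<omega>)\<^sup>2)"
    using erlang_ith_moment_integrable[OF _ E_exp[of k], where i = 1]
      erlang_ith_moment_integrable[OF _ E_exp[of k], where i = 2] by simp_all
  have moments: "expectation (E k) = 1" "expectation (\<lambda>\<omega>. (E k \<omega>)\<^sup>2) = 2"
    using erlang_ith_moment[OF _ E_exp[of k], where i = 1]
      erlang_ith_moment[OF _ E_exp[of k], where i = 2] by (simp_all add: fact_numeral)
  have square: "(E k \<omega> - 1)\<^sup>2 = (E k \<omega>)\<^sup>2 - 2 * E k \<omega> + 1" for \<omega> by (simp add: power2_diff)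
  show "integrable M (\<lambda>\<omega>. E k \<omega> - 1)" "integrable M (\<lambda>\<omega>. (E k \<omega> - 1)\<^sup>2)"
    "(\<integral>\<omega>. E k \<omega> - 1 \<partial>M) = 0" "(\<integral>\<omega>. (E k \<omega> - 1)\<^sup>2 \<partial>M) = 1"
    unfolding square using int moments by (simp_all add: prob_space)
qed

lemma AE_E_nonneg: "AE \<omega> in M. \<forall>k. 0 \<le> E k \<omega>"
proof -
  have "AE \<omega> in M. 0 \<le> E k \<omega>" for k
    by (subst distributed_AE2[OF E_exp]) (auto simp: exponential_density_def)
  then show ?thesis by (simp add: AE_all_countable)
qed

lemma compensated_clocks_correlation:
  assumes g: "\<And>w. \<bar>g i w\<bar> \<le> 1"
  shows "integrable M (\<lambda>\<omega>. (g i (history k \<omega>) * g l (history k \<omega>)) * ((E i \<omega> - 1) * (E l \<omega> - 1)))"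
    and "(\<integral>\<omega>. (g i (history k \<omega>) * g l (history k \<omega>)) * ((E i \<omega> - 1) * (E l \<omega> - 1)) \<partial>M) \<le> of_bool (i = l)"
proof -
  let ?t = "\<lambda>\<omega>. (g i (history k \<omega>) * g l (history k \<omega>)) * ((E i \<omega> - 1) * (E l \<omega> - 1))"
  have "integrable M ?t \<and> integral\<^sup>L M ?t \<le> of_bool (i = l)"
  proof (cases "i = l")
    case True
    have "mean_word k x (\<lambda>w. (g i w)\<^sup>2) \<le> 1"
      by (rule mean_word_le) (use g in \<open>simp add: abs_square_le_1\<close>)
    then show ?thesis
      using history_function_times_clocks[of "{i}" "\<lambda>_ e. (e - 1)\<^sup>2" "\<lambda>w. (g i w)\<^sup>2" k] E_variance True
      by (simp add: power2_eq_square)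
  next
    case False
    then show ?thesis
      using history_function_times_clocks[of "{i, l}" "\<lambda>_ e. e - 1" "\<lambda>w. g i w * g l w" k] E_centred
      by simp
  qed
  then show "integrable M ?t" "integral\<^sup>L M ?t \<le> of_bool (i = l)" by auto
qed

lemma AE_compensated_clocks_squares:
  assumes g: "\<And>y. \<bar>g y\<bar> \<le> 1"
  shows "AE \<omega> in M. (\<lambda>r. (\<Sum>i<r\<^sup>2. g (state i \<omega>) * (E i \<omega> - 1)) / real (r\<^sup>2)) \<longlonglongrightarrow> 0"
proof (rule AE_squares_tendsto_0)
  fix k
  define G where "G i w = g (foldl bump x (take i w))" for i w
  let ?S = "\<lambda>\<omega>. \<Sum>i<k. g (state i \<omega>) * (E i \<omega> - 1)"
  let ?t = "\<lambda>i l \<omega>. (G i (history k \<omega>) * G l (history k \<omega>)) * ((E i \<omega> - 1) * (E l \<omega> - 1))"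
  have S_eq: "?S \<omega> = (\<Sum>i<k. G i (history k \<omega>) * (E i \<omega> - 1))" for \<omega>
    by (intro sum.cong refl) (simp add: G_def state_eq_foldl take_history)
  have square: "(?S \<omega>)\<^sup>2 = (\<Sum>i<k. \<Sum>l<k. ?t i l \<omega>)" for \<omega>
    unfolding S_eq power2_eq_square sum_product by (intro sum.cong refl) (simp add: mult_ac)
  have corr: "integrable M (?t i l)" "integral\<^sup>L M (?t i l) \<le> of_bool (i = l)" for i l
    using compensated_clocks_correlation[where g = G and i = i and l = l and k = k] g
    by (auto simp: G_def)
  show "?S \<in> borel_measurable M"
    unfolding S_eq using history_measurable[of "G _" k] E_meas by measurable
  show "integrable M (\<lambda>\<omega>. (?S \<omega>)\<^sup>2)" unfolding square using corr by auto
  have "(\<integral>\<omega>. (?S \<omega>)\<^sup>2 \<partial>M) = (\<Sum>i<k. \<Sum>l<k. integral\<^sup>L M (?t i l))"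
    unfolding square using corr by (simp add: Bochner_Integration.integral_sum)
  also have "\<dots> \<le> (\<Sum>i<k. \<Sum>l<k. if l = i then 1 else 0)"
    by (intro sum_mono order_trans[OF corr(2)]) auto
  finally show "(\<integral>\<omega>. (?S \<omega>)\<^sup>2 \<partial>M) \<le> real k" by simp
qed

lemma clocks_between_squares_tendsto_0:
  fixes e :: "nat \<Rightarrow> real"
  assumes "(\<lambda>r. (\<Sum>i<r\<^sup>2. e i - 1) / real (r\<^sup>2)) \<longlonglongrightarrow> 0"
  shows "(\<lambda>r. (\<Sum>i\<in>{r\<^sup>2..<(Suc r)\<^sup>2}. 1 + e i) / real (r\<^sup>2)) \<longlonglongrightarrow> 0"
proof -
  have "(\<Sum>i\<in>{r\<^sup>2..<(Suc r)\<^sup>2}. 1 + e i)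
      = ((\<Sum>i<(Suc r)\<^sup>2. e i - 1) - (\<Sum>i<r\<^sup>2. e i - 1)) + (\<Sum>i\<in>{r\<^sup>2..<(Suc r)\<^sup>2}. 2)" for r
  proof -
    have "r\<^sup>2 \<le> (Suc r)\<^sup>2" by (simp add: power_mono)
    then have "(\<Sum>i<(Suc r)\<^sup>2. e i - 1) - (\<Sum>i<r\<^sup>2. e i - 1) = (\<Sum>i\<in>{r\<^sup>2..<(Suc r)\<^sup>2}. e i - 1)"
      using sum_diff_nat_ivl[of 0 "r\<^sup>2" "(Suc r)\<^sup>2" "\<lambda>i. e i - 1"] by (simp add: lessThan_atLeast0)
    then show ?thesis by (simp only: sum.distrib[symmetric]) simp
  qed
  then show ?thesis
    using tendsto_add[OF diff_of_squares_tendsto_0[OF assms] const_between_squares_tendsto_0[of 2]]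
    by (simp add: add_divide_distrib)
qed

lemma AE_compensated_clocks:
  assumes g: "\<And>y. \<bar>g y\<bar> \<le> 1"
  shows "AE \<omega> in M. (\<lambda>k. \<Sum>i<k. g (state i \<omega>) * (E i \<omega> - 1)) \<in> o(\<lambda>k. real k)"
proof -
  have "AE \<omega> in M. (\<lambda>r. (\<Sum>i<r\<^sup>2. E i \<omega> - 1) / real (r\<^sup>2)) \<longlonglongrightarrow> 0"
    using AE_compensated_clocks_squares[of "\<lambda>_. 1"] by simp
  then show ?thesis using AE_compensated_clocks_squares[of g, OF g] AE_E_nonneg
  proof eventually_elim
    case (elim \<omega>)
    have "\<bar>(\<Sum>i<Suc k. g (state i \<omega>) * (E i \<omega> - 1)) - (\<Sum>i<k. g (state i \<omega>) * (E i \<omega> - 1))\<bar> \<le> 1 + E k \<omega>" for k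
    proof -
      have "\<bar>g (state k \<omega>)\<bar> * \<bar>E k \<omega> - 1\<bar> \<le> 1 * \<bar>E k \<omega> - 1\<bar>" using g by (intro mult_right_mono) auto
      moreover have "0 \<le> E k \<omega>" using elim(3) by blast
      ultimately show ?thesis by (simp add: abs_mult)
    qed
    then show ?case
      by (rule smallo_real_if_squares[OF _ elim(2) clocks_between_squares_tendsto_0[OF elim(1)]])
  qed
qed

lemma AE_jump_LLN:
  assumes j: "j \<in> {1..n}"
  shows "AE \<omega> in M. jump_LLN (\<lambda>k. state k \<omega>) (\<lambda>k. site k \<omega>) (\<lambda>k. E k \<omega> / q (state k \<omega>)) site_rate P j"
proof -
  have "\<bar>of_bool (P y) * jump_prob y j\<bar> \<le> 1" for y
    using p_nonneg[OF j, of y] p_le_1[OF j, of y] by auto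
  then have "AE \<omega> in M. (\<lambda>k. \<Sum>i<k. (of_bool (P (state i \<omega>)) * jump_prob (state i \<omega>) j) * (E i \<omega> - 1))
      \<in> o(\<lambda>k. real k)"
    by (rule AE_compensated_clocks[of "\<lambda>y. of_bool (P y) * jump_prob y j"])
  moreover have "AE \<omega> in M. (\<lambda>k. \<Sum>i<k. of_bool (P (state i \<omega>)) *
      (of_bool (site i \<omega> = j) - jump_prob (state i \<omega>) j))
    \<in> o(\<lambda>k. real k)"
    by (rule AE_compensated_jumps[OF j, of "\<lambda>y. of_bool (P y)"]) auto
  ultimately show ?thesis
  proof eventually_elim
    case (elim \<omega>)
    have "of_bool (P (state i \<omega>)) * (of_bool (site i \<omega> = j) - site_rate (state i \<omega>) j * (E i \<omega> / q (state i \<omega>)))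
      = of_bool (P (state i \<omega>)) * (of_bool (site i \<omega> = j) - jump_prob (state i \<omega>) j)
        - (of_bool (P (state i \<omega>)) * jump_prob (state i \<omega>) j) * (E i \<omega> - 1)" for i
      by (simp add: jump_prob_def right_diff_distrib)
    then show ?case
      unfolding jump_LLN_def using sum_in_smallo(2)[OF elim(2,1)] by (simp only: sum_subtractf)
  qed
qed

end

subsection \<open>Possible label sets\<close>

lemma maximal_block:
  fixes W :: "nat set"
  assumes "1 \<le> j" "j \<le> n" "j \<notin> W"
  obtains a b where "1 \<le> a" "a \<le> j" "j \<le> b" "b \<le> n" "W \<inter> {a..b} = {}"
    "a = 1 \<or> a - 1 \<in> W" "b = n \<or> b + 1 \<in> W"
proof -
  define left where "left a \<longleftrightarrow> 1 \<le> a \<and> a \<le> j \<and> (a = 1 \<or> a - 1 \<in> W)" for a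
  define right where "right b \<longleftrightarrow> j \<le> b \<and> b \<le> n \<and> (b = n \<or> b + 1 \<in> W)" for b
  define a where "a = (GREATEST a. left a)"
  define b where "b = (LEAST b. right b)"
  have left_le: "a' \<le> j" if "left a'" for a' using that by (simp add: left_def)
  have left_1: "left 1" and right_n: "right n" using assms by (simp_all add: left_def right_def)
  have a: "left a" "\<And>a'. left a' \<Longrightarrow> a' \<le> a"
    unfolding a_def
    using GreatestI_nat[of left 1 j] Greatest_le_nat[of left _ j] left_le left_1 by blast+
  have b: "right b" "\<And>b'. right b' \<Longrightarrow> b \<le> b'"
    unfolding b_def using LeastI[of right n] Least_le[of right] right_n by blast+
  have "i \<notin> {a..b}" if "i \<in> W" for i
  proof (cases "i < j")
    case True
    then show ?thesis using a(2)[of "i + 1"] that by (auto simp: left_def)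
  next
    case False
    then have "j \<le> i - 1" "i - 1 + 1 = i" using that assms by (cases "i = j"; auto)+
    then show ?thesis using b(2)[of "i - 1"] that b(1) by (auto simp: right_def)
  qed
  then have "W \<inter> {a..b} = {}" by blast
  then show ?thesis using that[of a b] a(1) b(1) unfolding left_def right_def by blast
qed

definition three_consecutive_unlabelled :: "nat \<Rightarrow> nat set \<Rightarrow> bool" where
  "three_consecutive_unlabelled n S \<longleftrightarrow> (\<exists>j\<ge>1. j + 2 \<le> n \<and> j \<notin> S \<and> j + 1 \<notin> S \<and> j + 2 \<notin> S)"

lemma long_maximal_block:
  assumes "three_consecutive_unlabelled n W"
  obtains a b where "1 \<le> a" "a + 2 \<le> b" "b \<le> n" "W \<inter> {a..b} = {}"
    "a = 1 \<or> a - 1 \<in> W" "b = n \<or> b + 1 \<in> W"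
proof -
  obtain j where j: "1 \<le> j" "j + 2 \<le> n" "j \<notin> W" "j + 1 \<notin> W" "j + 2 \<notin> W"
    using assms by (auto simp: three_consecutive_unlabelled_def)
  obtain a b where ab: "1 \<le> a" "a \<le> j" "j \<le> b" "b \<le> n" "W \<inter> {a..b} = {}"
      "a = 1 \<or> a - 1 \<in> W" "b = n \<or> b + 1 \<in> W"
    using maximal_block[of j n W] j by auto
  have "b \<noteq> j" "b \<noteq> j + 1" using ab(7) j by auto
  then show ?thesis using that[of a b] ab by linarith
qed

context crystal_model
begin

lemma surely_left_three_without_valley:
  assumes "b0 \<le> b1" and three: "three_consecutive_unlabelled n W"
  shows "surely_left (valleys_at W)"
proof (cases "b0 = b1")
  case True
  then show ?thesis
    using three surely_left_neutral_block_without_valley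
    unfolding three_consecutive_unlabelled_def by blast
next
  case False
  then have "b0 < b1" using assms(1) by simp
  with long_maximal_block[OF three] surely_left_contracting_block_without_valley show ?thesis
    by metis
qed

definition peaks_impossible :: "nat set \<Rightarrow> bool" where
  "peaks_impossible P \<longleftrightarrow> (1 \<notin> P \<and> 2 \<notin> P) \<or> (n \<notin> P \<and> n - 1 \<notin> P) \<or> three_consecutive_unlabelled n P"

lemma surely_left_if_peaks_impossible:
  assumes "b1 \<le> b2" "peaks_impossible P"
  shows "surely_left (peaks_at P)"
proof -
  consider "1 \<notin> P" "2 \<notin> P" | "n \<notin> P" "n - 1 \<notin> P"
    | "three_consecutive_unlabelled n P" "1 \<in> P \<or> 2 \<in> P" "n \<in> P \<or> n - 1 \<in> P"
    using assms(2) unfolding peaks_impossible_def by blast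
  then show ?thesis
  proof cases
    case 3
    show ?thesis
    proof (cases "b1 = b2")
      case True
      then show ?thesis
        using 3(1) surely_left_neutral_block_without_peak
        unfolding three_consecutive_unlabelled_def by blast
    next
      case False
      obtain a b where ab: "1 \<le> a" "a + 2 \<le> b" "b \<le> n" "P \<inter> {a..b} = {}"
          "a = 1 \<or> a - 1 \<in> P" "b = n \<or> b + 1 \<in> P"
        by (rule long_maximal_block[OF 3(1)])
      have "a \<noteq> 1" "b \<noteq> n" using 3(2,3) ab(2,4) by force+
      then show ?thesis
        using ab False assms(1) by (intro surely_left_contracting_block_without_peak[of a b]) auto
    qed
  qed (use surely_left_edge_without_peak in blast)+
qed

end

subsection \<open>Limit shapes\<close>

context crystal_model
begin

definition valley_speed :: "nat set \<Rightarrow> nat \<Rightarrow> real" where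
  "valley_speed W j = (if j \<in> W then b2
     else if (j = 1 \<or> j - 1 \<in> W) \<and> (j = n \<or> j + 1 \<in> W) then b0 else vel b0 b1)"

definition peak_speed :: "nat set \<Rightarrow> nat \<Rightarrow> real" where
  "peak_speed P j = (if j \<in> P then b0 else if j = 1 \<or> j = n then b1
     else if j - 1 \<in> P \<and> j + 1 \<in> P then b2 else vel b1 b2)"

definition label_index :: "nat set \<Rightarrow> nat set \<Rightarrow> nat \<Rightarrow> nat" where
  "label_index P W j = (if j \<in> P then 0 else if j \<in> W then 2 else 1)"

definition blocks_between_valleys :: "real list set" where
  "blocks_between_valleys = {[b0], [vel b0 b1, vel b0 b1]}"

definition valley_shapes :: "real list set" where
  "valley_shapes = {a @ concat (map (\<lambda>c. b2 # c) as) | a as.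
     a \<in> blocks_between_valleys \<and> set as \<subseteq> blocks_between_valleys}"

lemma valley_shapes_single: "a \<in> blocks_between_valleys \<Longrightarrow> a \<in> valley_shapes"
  unfolding valley_shapes_def by (force intro: exI[of _ "[]"])

lemma valley_shapes_append:
  assumes "a \<in> blocks_between_valleys" "l \<in> valley_shapes"
  shows "a @ b2 # l \<in> valley_shapes"
proof -
  obtain a' as where "l = a' @ concat (map (\<lambda>c. b2 # c) as)" "a' \<in> blocks_between_valleys"
      "set as \<subseteq> blocks_between_valleys"
    using assms(2) by (auto simp: valley_shapes_def)
  then show ?thesis using assms(1) unfolding valley_shapes_def by (force intro: exI[of _ "a' # as"])
qed

lemma map_valley_speed_mem_valley_shapes:
  assumes edge: "n \<notin> W" and adjacent: "\<And>j. j \<in> W \<Longrightarrow> j + 1 \<notin> W" and three: "\<not> three_consecutive_unlabelled n W"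
  shows "1 \<le> a \<Longrightarrow> a \<le> n \<Longrightarrow> a \<notin> W \<Longrightarrow> a = 1 \<or> a - 1 \<in> W \<Longrightarrow>
    map (valley_speed W) [a..<Suc n] \<in> valley_shapes"
proof (induction "n - a" arbitrary: a rule: less_induct)
  case less
  have IH: "map (valley_speed W) [Suc w..<Suc n] \<in> valley_shapes" if "w \<in> W" "a < w" "w \<le> n" for w
  proof -
    have "w \<noteq> n" "Suc w \<notin> W" using that edge adjacent[of w] by auto
    then show ?thesis using that less.prems by (intro less.hyps) auto
  qed
  consider "a = n" | "a < n" "Suc a \<in> W" | "Suc a = n" "Suc a \<notin> W"
    | "Suc (Suc a) \<le> n" "Suc a \<notin> W" "Suc (Suc a) \<in> W"
    using less.prems three unfolding three_consecutive_unlabelled_def by fastforce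
  then show ?case
  proof cases
    case 1
    then have "map (valley_speed W) [a..<Suc n] = [b0]"
      using less.prems by (auto simp: valley_speed_def)
    then show ?thesis by (simp add: valley_shapes_single blocks_between_valleys_def)
  next
    case 2
    then have "map (valley_speed W) [a..<Suc n] = [b0] @ b2 # map (valley_speed W) [Suc (Suc a)..<Suc n]"
      using less.prems by (simp add: upt_conv_Cons valley_speed_def del: upt_Suc)
    then show ?thesis using IH[of "Suc a"] 2 valley_shapes_append[of "[b0]"]
      by (simp add: blocks_between_valleys_def del: upt_Suc)
  next
    case 3
    then have "map (valley_speed W) [a..<Suc n] = [vel b0 b1, vel b0 b1]"
      using less.prems by (auto simp: upt_conv_Cons valley_speed_def simp del: upt_Suc)
    then show ?thesis by (simp add: valley_shapes_single blocks_between_valleys_def del: upt_Suc)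
  next
    case 4
    then have "map (valley_speed W) [a..<Suc n]
        = [vel b0 b1, vel b0 b1] @ b2 # map (valley_speed W) [Suc (Suc (Suc a))..<Suc n]"
      using less.prems by (auto simp: upt_conv_Cons valley_speed_def simp del: upt_Suc)
    then show ?thesis using IH[of "Suc (Suc a)"] 4 valley_shapes_append[of "[vel b0 b1, vel b0 b1]"]
      by (simp add: blocks_between_valleys_def del: upt_Suc)
  qed
qed

lemma valley_speed_in_E1:
  assumes "1 \<notin> W" "n \<notin> W" "\<And>j. j \<in> W \<Longrightarrow> j + 1 \<notin> W" "\<not> three_consecutive_unlabelled n W"
  shows "map (valley_speed W) [1..<Suc n] \<in> E1 b0 b1 b2 n"
proof -
  have "map (valley_speed W) [1..<Suc n] \<in> valley_shapes"
    using assms n_ge by (intro map_valley_speed_mem_valley_shapes) auto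
  then show ?thesis
    unfolding E1_def valley_shapes_def blocks_between_valleys_def Let_def
    by (auto simp del: upt_Suc)
qed

definition blocks_between_peaks :: "real list set" where
  "blocks_between_peaks = {[b2], [vel b1 b2, vel b1 b2]}"

definition peak_shapes :: "real list set" where
  "peak_shapes = {[b0] @ concat (map (\<lambda>c. c @ [b0]) as) @ eR | as eR.
     set as \<subseteq> blocks_between_peaks \<and> eR \<in> {[], [b1]}}"

lemma peak_shapes_single: "eR \<in> {[], [b1]} \<Longrightarrow> b0 # eR \<in> peak_shapes"
  unfolding peak_shapes_def by (force intro: exI[of _ "[]"])

lemma peak_shapes_append:
  assumes "c \<in> blocks_between_peaks" "l \<in> peak_shapes"
  shows "b0 # c @ l \<in> peak_shapes"
proof -
  obtain as eR where "l = [b0] @ concat (map (\<lambda>c. c @ [b0]) as) @ eR" "eR \<in> {[], [b1]}"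
      "set as \<subseteq> blocks_between_peaks"
    using assms(2) by (auto simp: peak_shapes_def)
  then show ?thesis using assms(1) unfolding peak_shapes_def by (force intro: exI[of _ "c # as"])
qed

lemma map_peak_speed_mem_peak_shapes:
  assumes adjacent: "\<And>j. j \<in> P \<Longrightarrow> j + 1 \<notin> P" and possible: "\<not> peaks_impossible P"
  shows "1 \<le> a \<Longrightarrow> a \<le> n \<Longrightarrow> a \<in> P \<Longrightarrow> map (peak_speed P) [a..<Suc n] \<in> peak_shapes"
proof (induction "n - a" arbitrary: a rule: less_induct)
  case less
  have a: "peak_speed P a = b0" "Suc a \<notin> P"
    using less.prems adjacent[of a] by (simp_all add: peak_speed_def)
  have three: "j \<in> P \<or> Suc j \<in> P \<or> Suc (Suc j) \<in> P" if "1 \<le> j" "Suc (Suc j) \<le> n" for j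
    using possible that by (auto simp: peaks_impossible_def three_consecutive_unlabelled_def)
  have right: "n \<in> P \<or> n - 1 \<in> P" using possible by (simp add: peaks_impossible_def)
  consider "a = n" | "Suc a = n" | "Suc (Suc a) \<le> n" "Suc (Suc a) \<in> P"
    | "Suc (Suc (Suc a)) \<le> n" "Suc (Suc a) \<notin> P" "Suc (Suc (Suc a)) \<in> P"
    using less.prems a(2) right three[of "Suc a"] by (cases "Suc (Suc a) = n") force+
  then show ?case
  proof cases
    case 1
    then show ?thesis using a(1) peak_shapes_single[of "[]"] by simp
  next
    case 2
    then have "map (peak_speed P) [a..<Suc n] = [b0, b1]"
      using a by (auto simp: upt_conv_Cons peak_speed_def simp del: upt_Suc)
    then show ?thesis using peak_shapes_single[of "[b1]"] by simp
  next
    case 3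
    then have "map (peak_speed P) [a..<Suc n] = b0 # [b2] @ map (peak_speed P) [Suc (Suc a)..<Suc n]"
      using a less.prems by (simp add: upt_conv_Cons del: upt_Suc) (simp add: peak_speed_def)
    then show ?thesis using less.hyps[of "Suc (Suc a)"] 3 peak_shapes_append[of "[b2]"]
      by (simp add: blocks_between_peaks_def del: upt_Suc)
  next
    case 4
    then have "map (peak_speed P) [a..<Suc n]
        = b0 # [vel b1 b2, vel b1 b2] @ map (peak_speed P) [Suc (Suc (Suc a))..<Suc n]"
      using a less.prems by (simp add: upt_conv_Cons del: upt_Suc) (simp add: peak_speed_def)
    then show ?thesis
      using less.hyps[of "Suc (Suc (Suc a))"] 4 peak_shapes_append[of "[vel b1 b2, vel b1 b2]"]
      by (simp add: blocks_between_peaks_def del: upt_Suc)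
  qed
qed

lemma peak_speed_in_E3:
  assumes adjacent: "\<And>j. j \<in> P \<Longrightarrow> j + 1 \<notin> P" and possible: "\<not> peaks_impossible P"
  shows "map (peak_speed P) [1..<Suc n] \<in> E3 b0 b1 b2 n"
proof -
  have "\<exists>eL\<in>{[], [b1]}. \<exists>l\<in>peak_shapes. map (peak_speed P) [1..<Suc n] = eL @ l"
  proof (cases "1 \<in> P")
    case True
    then have "map (peak_speed P) [1..<Suc n] \<in> peak_shapes"
      using map_peak_speed_mem_peak_shapes[OF assms] n_ge by simp
    then show ?thesis by fastforce
  next
    case False
    then have "2 \<in> P" using possible by (auto simp: peaks_impossible_def)
    then have "map (peak_speed P) [2..<Suc n] \<in> peak_shapes"
      using map_peak_speed_mem_peak_shapes[OF assms, of 2] n_ge by simp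
    moreover have "[1..<Suc n] = 1 # [2..<Suc n]"
      using n_ge by (simp add: upt_conv_Cons numeral_2_eq_2 del: upt_Suc)
    then have "map (peak_speed P) [1..<Suc n] = [b1] @ map (peak_speed P) [2..<Suc n]"
      using False by (simp add: peak_speed_def)
    ultimately show ?thesis by blast
  qed
  then obtain eL l where l: "eL \<in> {[], [b1]}" "l \<in> peak_shapes" "map (peak_speed P) [1..<Suc n] = eL @ l"
    by blast
  then obtain as eR where "l = [b0] @ concat (map (\<lambda>c. c @ [b0]) as) @ eR" "eR \<in> {[], [b1]}"
      "set as \<subseteq> blocks_between_peaks"
    by (auto simp: peak_shapes_def)
  moreover have "length (map (peak_speed P) [1..<Suc n]) = n" by simp
  ultimately show ?thesis using l(1,3) unfolding E3_def blocks_between_peaks_def by blast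
qed

lemma label_index_in_E2:
  assumes edges: "1 \<notin> W" "n \<notin> W" and adjacent: "\<And>j. j \<in> P \<Longrightarrow> j + 1 \<notin> P" "\<And>j. j \<in> W \<Longrightarrow> j + 1 \<notin> W"
    and two: "\<And>j. 1 \<le> j \<Longrightarrow> j + 1 \<le> n \<Longrightarrow> j \<in> P \<union> W \<or> j + 1 \<in> P \<union> W"
  shows "map (\<lambda>j. beta b0 b1 b2 (label_index P W j)) [1..<Suc n] \<in> E2 b0 b1 b2 n"
proof -
  define ix where "ix = map (label_index P W) [1..<Suc n]"
  have len: "length ix = n" by (simp add: ix_def)
  have nth: "ix ! j = label_index P W (Suc j)" if "j < n" for j
    using that by (simp add: ix_def del: upt_Suc)
  have "set ix \<subseteq> {0, 1, 2}" by (auto simp: ix_def label_index_def)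
  moreover have "ix ! j \<noteq> ix ! (j + 1)" if "j + 1 < n" for j
    using that adjacent(1)[of "Suc j"] adjacent(2)[of "Suc j"] two[of "Suc j"]
    by (auto simp: nth label_index_def)
  moreover have "ix \<noteq> []" using len n_ge by auto
  then have "hd ix = label_index P W 1" "last ix = label_index P W n"
    using nth[of 0] nth[of "n - 1"] len n_ge by (simp_all add: hd_conv_nth last_conv_nth)
  then have "hd ix \<noteq> 2" "last ix \<noteq> 2" using edges by (simp_all add: label_index_def)
  moreover have "map (\<lambda>j. beta b0 b1 b2 (label_index P W j)) [1..<Suc n] = map (beta b0 b1 b2) ix"
    by (simp add: ix_def)
  ultimately show ?thesis using len unfolding E2_def by blast
qed

subsubsection \<open>Rates determined by the labels\<close>

lemma V_eq_0_between_valleys: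
  "1 \<le> j \<Longrightarrow> j \<le> n \<Longrightarrow> j = 1 \<or> j - 1 \<in> valleys n y \<Longrightarrow> j = n \<or> j + 1 \<in> valleys n y \<Longrightarrow> V y j = 0"
  by (auto simp: Vn_eq mem_valleys_iff)

lemma V_pair_between_valleys:
  assumes "1 \<le> i" "i + 1 \<le> n" "i = 1 \<or> i - 1 \<in> valleys n y" "i + 1 = n \<or> i + 2 \<in> valleys n y"
  shows "V y i = of_bool (y i < y (i + 1))" "V y (i + 1) = of_bool (y (i + 1) < y i)"
proof -
  have "1 < i \<Longrightarrow> \<not> y i < y (i - 1)" "i + 1 < n \<Longrightarrow> \<not> y (i + 1) < y (i + 2)"
    using assms by (auto simp: mem_valleys_iff)
  then show "V y i = of_bool (y i < y (i + 1))" "V y (i + 1) = of_bool (y (i + 1) < y i)"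
    using assms(1,2) by (auto simp: Vn_eq)
qed

lemma V_eq_2_between_peaks: "j - 1 \<in> peaks n y \<Longrightarrow> j + 1 \<in> peaks n y \<Longrightarrow> 1 < j \<Longrightarrow> j < n \<Longrightarrow> V y j = 2"
  by (auto simp: Vn_eq mem_peaks_iff)

lemma V_eq_1_at_left_edge: "2 \<in> peaks n y \<Longrightarrow> V y 1 = 1"
  using n_ge by (auto simp: Vn_eq mem_peaks_iff numeral_2_eq_2)

lemma V_eq_1_at_right_edge: "n - 1 \<in> peaks n y \<Longrightarrow> V y n = 1"
  using n_ge by (auto simp: Vn_eq mem_peaks_iff)

lemma V_pair_between_peaks:
  assumes "1 < i" "i + 1 < n" "i - 1 \<in> peaks n y" "i + 2 \<in> peaks n y"
  shows "V y i = 1 + of_bool (y i < y (i + 1))" "V y (i + 1) = 1 + of_bool (y (i + 1) < y i)"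
  using assms by (auto simp: Vn_eq mem_peaks_iff)

lemma V_eq_label_index:
  assumes j: "1 \<le> j" "j \<le> n"
    and two: "\<And>i. 1 \<le> i \<Longrightarrow> i + 1 \<le> n \<Longrightarrow> i \<in> peaks n y \<union> valleys n y \<or> i + 1 \<in> peaks n y \<union> valleys n y"
  shows "V y j = label_index (peaks n y) (valleys n y) j"
proof -
  consider "j \<in> peaks n y" | "j \<notin> peaks n y" "j \<in> valleys n y" | "j \<notin> peaks n y" "j \<notin> valleys n y"
    by blast
  then show ?thesis
  proof cases
    case 1
    then show ?thesis by (simp add: Vn_eq_0_if_peak label_index_def)
  next
    case 2
    then show ?thesis using Vn_eq_2_iff[OF j, of y] by (simp add: label_index_def)
  next
    case 3
    have "V y j \<noteq> 0"
    proof
      assume V: "V y j = 0"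
      have "y (j - 1) < y j" if "1 < j"
      proof -
        have "j - 1 \<in> peaks n y \<union> valleys n y" "\<not> y j < y (j - 1)"
          using two[of "j - 1"] 3 j that V by (auto simp: Vn_eq)
        then show ?thesis using j that by (auto simp: mem_valleys_iff mem_peaks_iff)
      qed
      moreover have "y (j + 1) < y j" if "j < n"
      proof -
        have "j + 1 \<in> peaks n y \<union> valleys n y" "\<not> y j < y (j + 1)"
          using two[of j] 3 j that V by (auto simp: Vn_eq)
        then show ?thesis using j that by (auto simp: mem_valleys_iff mem_peaks_iff)
      qed
      ultimately show False using 3(1) j by (simp add: mem_peaks_iff)
    qed
    moreover have "V y j \<noteq> 2" using 3(2) Vn_eq_2_iff[OF j, of y] by simp
    ultimately show ?thesis using 3 by (cases rule: Vn_cases[of n y j]) (auto simp: label_index_def)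
  qed
qed

end

subsection \<open>Almost sure limits\<close>

context crystal_process
begin

definition has_speed :: "'a \<Rightarrow> nat \<Rightarrow> real \<Rightarrow> bool" where
  "has_speed \<omega> j v \<longleftrightarrow>
     ((\<lambda>t. real (crystal b0 b1 b2 n x (\<lambda>k. E k \<omega>) (\<lambda>k. U k \<omega>) t j) / t) \<longlongrightarrow> v) at_top"

abbreviation limit_in :: "'a \<Rightarrow> real list set \<Rightarrow> bool" where
  "limit_in \<omega> A \<equiv> converges_into b0 b1 b2 n x (\<lambda>k. E k \<omega>) (\<lambda>k. U k \<omega>) A"

abbreviation LLN_at :: "'a \<Rightarrow> ((nat \<Rightarrow> nat) \<Rightarrow> bool) \<Rightarrow> nat \<Rightarrow> bool" where
  "LLN_at \<omega> \<equiv> jump_LLN (\<lambda>k. state k \<omega>) (\<lambda>k. site k \<omega>) (\<lambda>k. E k \<omega> / q (state k \<omega>)) site_rate"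

definition typical :: "'a \<Rightarrow> bool" where
  "typical \<omega> \<longleftrightarrow> (\<forall>k. 0 \<le> E k \<omega>) \<and> (\<lambda>k. \<Sum>i<k. E i \<omega> - 1) \<in> o(\<lambda>k. real k) \<and>
    (\<forall>j\<in>{1..n}. LLN_at \<omega> (\<lambda>_. True) j \<and>
      (\<forall>u v. LLN_at \<omega> (\<lambda>y. y u = y v) j \<and> LLN_at \<omega> (\<lambda>y. y v < y u) j))"

lemma AE_typical: "AE \<omega> in M. typical \<omega>"
proof -
  have clocks: "AE \<omega> in M. (\<lambda>k. \<Sum>i<k. E i \<omega> - 1) \<in> o(\<lambda>k. real k)"
    using AE_compensated_clocks[of "\<lambda>_. 1"] by simp
  have "AE \<omega> in M. LLN_at \<omega> (\<lambda>_. True) j \<and>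
      (\<forall>u v. LLN_at \<omega> (\<lambda>y. y u = y v) j \<and> LLN_at \<omega> (\<lambda>y. y v < y u) j)" if "j \<in> {1..n}" for j
    using AE_jump_LLN[OF that] by (simp only: AE_conj_iff AE_all_countable simp_thms)
  then have "AE \<omega> in M. \<forall>j\<in>{1..n}. LLN_at \<omega> (\<lambda>_. True) j \<and>
      (\<forall>u v. LLN_at \<omega> (\<lambda>y. y u = y v) j \<and> LLN_at \<omega> (\<lambda>y. y v < y u) j)"
    by (rule AE_finite_allI[OF finite_atLeastAtMost])
  with clocks AE_E_nonneg show ?thesis unfolding typical_def by eventually_elim blast
qed

subsubsection \<open>Speeds at typical outcomes\<close>

lemma typical_growth_path:
  "typical \<omega> \<Longrightarrow> growth_path (\<lambda>k. state k \<omega>) (\<lambda>k. site k \<omega>) (\<lambda>k. E k \<omega> / q (state k \<omega>))"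
  using q_pos
  by unfold_locales (auto simp: typical_def state_Suc less_imp_le intro!: divide_nonneg_nonneg)

lemma jump_time_eq: "jump_time b0 b1 b2 n x (\<lambda>k. E k \<omega>) (\<lambda>k. U k \<omega>) k = (\<Sum>i<k. E i \<omega> / q (state i \<omega>))"
  by (induction k) (simp_all add: state_def)

lemma typical_clocks_smallo: "typical \<omega> \<Longrightarrow> (\<lambda>k. E k \<omega>) \<in> o(\<lambda>k. real k)"
proof -
  assume "typical \<omega>"
  then have S: "(\<lambda>k. \<Sum>i<k. E i \<omega> - 1) \<in> o(\<lambda>k. real k)" by (simp add: typical_def)
  have "(\<lambda>k. (\<Sum>i<Suc k. E i \<omega> - 1) - (\<Sum>i<k. E i \<omega> - 1) + 1) \<in> o(\<lambda>k. real k)"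
    by (intro sum_in_smallo smallo_real_Suc[OF S] S const_in_smallo_real)
  then show ?thesis by simp
qed

lemma typical_holding_times_smallo:
  assumes "typical \<omega>"
  shows "(\<lambda>k. E k \<omega> / q (state k \<omega>)) \<in> o(\<lambda>k. real k)"
proof (rule landau_o.big_small_trans[OF _ typical_clocks_smallo[OF assms]])
  have "\<bar>E k \<omega> / q (state k \<omega>)\<bar> \<le> 1 / (real n * min_rate) * \<bar>E k \<omega>\<bar>" for k
    using divide_left_mono[OF q_ge[of "state k \<omega>"], of "\<bar>E k \<omega>\<bar>"] n_min_rate_pos q_pos[of "state k \<omega>"]
    by simp
  then show "(\<lambda>k. E k \<omega> / q (state k \<omega>)) \<in> O(\<lambda>k. E k \<omega>)"
    by (intro landau_o.bigI[of "1 / (real n * min_rate)"]) (use n_min_rate_pos in auto)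
qed

lemma typical_time_linear:
  assumes "typical \<omega>"
  shows "\<forall>\<^sub>F k in sequentially. 1 / (2 * (real n * max_rate)) * real k \<le> (\<Sum>i<k. E i \<omega> / q (state i \<omega>))"
proof -
  have nonneg: "0 \<le> E k \<omega>" for k using assms by (simp add: typical_def)
  have "(\<lambda>k. \<Sum>i<k. E i \<omega> - 1) \<in> o(\<lambda>k. real k)" using assms by (simp add: typical_def)
  from landau_o.smallD[OF this, of "1 / 2"]
  have "\<forall>\<^sub>F k in sequentially. norm (\<Sum>i<k. E i \<omega> - 1) \<le> 1 / 2 * norm (real k)" by simp
  then show ?thesis
  proof eventually_elim
    case (elim k)
    then have "\<bar>(\<Sum>i<k. E i \<omega>) - real k\<bar> \<le> real k / 2" by (simp add: sum_subtractf)
    then have "real k / 2 \<le> (\<Sum>i<k. E i \<omega>)" by linarith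
    then have "1 / (2 * (real n * max_rate)) * real k \<le> (\<Sum>i<k. E i \<omega>) / (real n * max_rate)"
      using n_max_rate_pos by (simp add: field_simps)
    also have "\<dots> \<le> (\<Sum>i<k. E i \<omega> / q (state i \<omega>))"
      unfolding sum_divide_distrib
      by (intro sum_mono divide_left_mono q_le nonneg) (use n_max_rate_pos q_pos in auto)
    finally show ?case .
  qed
qed

lemma has_speed_if_sublinear:
  assumes typical: "typical \<omega>"
    and lim: "(\<lambda>k. real (state k \<omega> j) - b * (\<Sum>i<k. E i \<omega> / q (state i \<omega>))) \<in> o(\<lambda>k. real k)"
  shows "has_speed \<omega> j b"
proof -
  interpret growth_path "\<lambda>k. state k \<omega>" "\<lambda>k. site k \<omega>" "\<lambda>k. E k \<omega> / q (state k \<omega>)" site_rate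
    by (rule typical_growth_path[OF typical])
  have "((\<lambda>t. real (state (card {k. 0 < k \<and> time k \<le> t}) \<omega> j) / t) \<longlongrightarrow> b) at_top"
    by (rule speed_in_continuous_time[OF _ _ typical_holding_times_smallo[OF typical],
          where c = "1 / (2 * (real n * max_rate))"])
      (use typical_time_linear[OF typical] lim n_max_rate_pos in \<open>auto simp: time_def\<close>)
  then show ?thesis by (simp add: has_speed_def crystal_def jump_time_eq time_def flip: state_def)
qed

lemma has_speed_if_labels_determine_V:
  assumes typical: "typical \<omega>" and j: "j \<in> {1..n}"
    and labels: "\<forall>\<^sub>F k in sequentially. F (state k \<omega>) = S" and V: "\<And>y. F y = S \<Longrightarrow> V y j = m"
  shows "has_speed \<omega> j (beta b0 b1 b2 m)"
proof (rule has_speed_if_sublinear[OF typical])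
  interpret growth_path "\<lambda>k. state k \<omega>" "\<lambda>k. site k \<omega>" "\<lambda>k. E k \<omega> / q (state k \<omega>)" site_rate
    by (rule typical_growth_path[OF typical])
  have "\<forall>\<^sub>F k in sequentially. site_rate (state k \<omega>) j = beta b0 b1 b2 m"
    using labels by eventually_elim (simp add: V rate_def)
  then show "(\<lambda>k. real (state k \<omega> j) - beta b0 b1 b2 m * (\<Sum>i<k. E i \<omega> / q (state i \<omega>))) \<in> o(\<lambda>k. real k)"
    using single_speed[of j] typical j unfolding typical_def time_def by blast
qed

lemma has_speed_in_pair:
  assumes typical: "typical \<omega>" and uv: "u \<in> {1..n}" "v \<in> {1..n}" "u \<noteq> v"
    and rates: "beta b0 b1 b2 m \<le> beta b0 b1 b2 (m + 1)"
    and labels: "\<forall>\<^sub>F k in sequentially. F (state k \<omega>) = S"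
    and V: "\<And>y. F y = S \<Longrightarrow> V y u = m + of_bool (y u < y v)" "\<And>y. F y = S \<Longrightarrow> V y v = m + of_bool (y v < y u)"
  shows "has_speed \<omega> u (vel (beta b0 b1 b2 m) (beta b0 b1 b2 (m + 1)))"
proof (rule has_speed_if_sublinear[OF typical])
  let ?\<alpha> = "beta b0 b1 b2 m" and ?\<gamma> = "beta b0 b1 b2 (m + 1)"
  interpret growth_path "\<lambda>k. state k \<omega>" "\<lambda>k. site k \<omega>" "\<lambda>k. E k \<omega> / q (state k \<omega>)" site_rate
    by (rule typical_growth_path[OF typical])
  have LLN: "LLN (\<lambda>y. y u = y v) j" "LLN (\<lambda>y. y v < y u) j" "LLN (\<lambda>y. y u < y v) j" if "j \<in> {u, v}" for j
  proof -
    have "j \<in> {1..n}" using that uv by auto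
    then show "LLN (\<lambda>y. y u = y v) j" "LLN (\<lambda>y. y v < y u) j" "LLN (\<lambda>y. y u < y v) j"
      using typical unfolding typical_def by blast+
  qed
  have pos: "0 < ?\<alpha>" using b_pos by (auto simp: beta_def)
  have "\<forall>\<^sub>F k in sequentially. site_rate (state k \<omega>) u = (if state k \<omega> u < state k \<omega> v then ?\<gamma> else ?\<alpha>) \<and>
      site_rate (state k \<omega>) v = (if state k \<omega> v < state k \<omega> u then ?\<gamma> else ?\<alpha>)"
    using labels by eventually_elim (simp add: V rate_def)
  from pair_speed[OF uv(3) pos rates LLN this]
  show "(\<lambda>k. real (state k \<omega> u) - vel ?\<alpha> ?\<gamma> * (\<Sum>i<k. E i \<omega> / q (state i \<omega>))) \<in> o(\<lambda>k. real k)"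
    by (simp add: time_def)
qed

lemma has_speed_pair_between_valleys:
  assumes typical: "typical \<omega>" and "b0 \<le> b1" and W: "\<forall>\<^sub>F k in sequentially. valleys n (state k \<omega>) = W"
    and i: "1 \<le> i" "i + 1 \<le> n" and outer: "i = 1 \<or> i - 1 \<in> W" "i + 1 = n \<or> i + 2 \<in> W"
  shows "has_speed \<omega> i (vel b0 b1)" "has_speed \<omega> (i + 1) (vel b0 b1)"
proof -
  have V: "V y i = 0 + of_bool (y i < y (i + 1))" "V y (i + 1) = 0 + of_bool (y (i + 1) < y i)"
    if "valleys n y = W" for y
    using V_pair_between_valleys[OF i, of y] outer that by simp_all
  have "has_speed \<omega> i (vel (beta b0 b1 b2 0) (beta b0 b1 b2 (0 + 1)))"
    by (rule has_speed_in_pair[OF typical _ _ _ _ W V]) (use i assms(2) in \<open>auto simp: beta_def\<close>)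
  moreover have "has_speed \<omega> (i + 1) (vel (beta b0 b1 b2 0) (beta b0 b1 b2 (0 + 1)))"
    by (rule has_speed_in_pair[OF typical _ _ _ _ W V(2,1)]) (use i assms(2) in \<open>auto simp: beta_def\<close>)
  ultimately show "has_speed \<omega> i (vel b0 b1)" "has_speed \<omega> (i + 1) (vel b0 b1)"
    by (simp_all add: beta_def)
qed

lemma has_speed_pair_between_peaks:
  assumes typical: "typical \<omega>" and "b1 \<le> b2" and P: "\<forall>\<^sub>F k in sequentially. peaks n (state k \<omega>) = P"
    and i: "1 < i" "i + 1 < n" and outer: "i - 1 \<in> P" "i + 2 \<in> P"
  shows "has_speed \<omega> i (vel b1 b2)" "has_speed \<omega> (i + 1) (vel b1 b2)"
proof -
  have V: "V y i = 1 + of_bool (y i < y (i + 1))" "V y (i + 1) = 1 + of_bool (y (i + 1) < y i)"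
    if "peaks n y = P" for y
    using V_pair_between_peaks[OF i, of y] outer that by simp_all
  have "has_speed \<omega> i (vel (beta b0 b1 b2 1) (beta b0 b1 b2 (1 + 1)))"
    by (rule has_speed_in_pair[OF typical _ _ _ _ P V]) (use i assms(2) in \<open>auto simp: beta_def\<close>)
  moreover have "has_speed \<omega> (i + 1) (vel (beta b0 b1 b2 1) (beta b0 b1 b2 (1 + 1)))"
    by (rule has_speed_in_pair[OF typical _ _ _ _ P V(2,1)]) (use i assms(2) in \<open>auto simp: beta_def\<close>)
  ultimately show "has_speed \<omega> i (vel b1 b2)" "has_speed \<omega> (i + 1) (vel b1 b2)"
    by (simp_all add: beta_def)
qed

lemma limit_inI:
  assumes "map s [1..<Suc n] \<in> A" "\<And>j. j \<in> {1..n} \<Longrightarrow> has_speed \<omega> j (s j)"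
  shows "limit_in \<omega> A"
  unfolding converges_into_def
proof (intro exI[of _ "map s [1..<Suc n]"] conjI allI impI)
  fix j assume "j < n"
  then show "((\<lambda>t. real (crystal b0 b1 b2 n x (\<lambda>k. E k \<omega>) (\<lambda>k. U k \<omega>) t (j + 1)) / t)
      \<longlongrightarrow> map s [1..<Suc n] ! j) at_top"
    using assms(2)[of "j + 1"] by (simp add: has_speed_def del: upt_Suc)
qed (use assms(1) in simp_all)

subsubsection \<open>Limits for eventually constant labels\<close>

lemma has_speed_valley_speed:
  assumes typical: "typical \<omega>" and "b0 \<le> b1" and W: "\<forall>\<^sub>F k in sequentially. valleys n (state k \<omega>) = W"
    and three: "\<not> three_consecutive_unlabelled n W" and j: "j \<in> {1..n}"
  shows "has_speed \<omega> j (valley_speed W j)"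
proof -
  have near: "j \<in> W \<or> j + 1 \<in> W \<or> j + 2 \<in> W" if "1 \<le> j" "j + 2 \<le> n" for j
    using three that by (auto simp: three_consecutive_unlabelled_def)
  note pair = has_speed_pair_between_valleys[OF typical assms(2) W]
  note single = has_speed_if_labels_determine_V[OF typical _ W]
  consider "j \<in> W" | "j \<notin> W" "j = 1 \<or> j - 1 \<in> W" "j = n \<or> j + 1 \<in> W"
    | "j \<notin> W" "j \<noteq> n" "j + 1 \<notin> W" | "j \<notin> W" "j \<noteq> 1" "j - 1 \<notin> W" by blast
  then show ?thesis
  proof cases
    case 1
    then show ?thesis
      using single[of j 2] j Vn_eq_2_iff[of j n] j by (simp add: valley_speed_def beta_def)
  next
    case 2
    then show ?thesis
      using single[of j 0] j V_eq_0_between_valleys[of j] j by (simp add: valley_speed_def beta_def)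
  next
    case 3
    have "j = 1 \<or> j - 1 \<in> W" "j + 1 = n \<or> j + 2 \<in> W"
      using near[of "j - 1"] near[of j] j 3 by (cases "j = 1"; cases "j + 1 = n"; auto)+
    then show ?thesis using pair(1)[of j] 3 j by (auto simp: valley_speed_def)
  next
    case 4
    then obtain i where i: "j = i + 1" "1 \<le> i" using j by (cases j) auto
    have "i = 1 \<or> i - 1 \<in> W" "i + 1 = n \<or> i + 2 \<in> W"
      using near[of "i - 1"] near[of i] i j 4 by (cases "i = 1"; cases "i + 1 = n"; auto)+
    then show ?thesis using pair(2)[of i] 4 i j by (auto simp: valley_speed_def)
  qed
qed

lemma limit_in_E1_if_valleys_constant:
  assumes typical: "typical \<omega>" and "b0 \<le> b1" and W: "\<forall>\<^sub>F k in sequentially. valleys n (state k \<omega>) = W"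
    and three: "\<not> three_consecutive_unlabelled n W"
  shows "limit_in \<omega> (E1 b0 b1 b2 n)"
proof (rule limit_inI[of "valley_speed W"])
  obtain k where k: "valleys n (state k \<omega>) = W" using W by (auto simp: eventually_sequentially)
  have edges: "1 \<notin> W" "n \<notin> W" unfolding k[symmetric] by (auto simp: mem_valleys_iff)
  have adjacent: "j + 1 \<notin> W" if "j \<in> W" for j
    using that valleys_not_adjacent unfolding k[symmetric] by blast
  show "map (valley_speed W) [1..<Suc n] \<in> E1 b0 b1 b2 n"
    using edges adjacent three by (rule valley_speed_in_E1)
qed (use has_speed_valley_speed assms in blast)

lemma limit_in_E2_if_labels_constant:
  assumes typical: "typical \<omega>"
    and labels: "\<forall>\<^sub>F k in sequentially. (peaks n (state k \<omega>), valleys n (state k \<omega>)) = (P, W)"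
    and two: "\<And>j. 1 \<le> j \<Longrightarrow> j + 1 \<le> n \<Longrightarrow> j \<in> P \<union> W \<or> j + 1 \<in> P \<union> W"
  shows "limit_in \<omega> (E2 b0 b1 b2 n)"
proof (rule limit_inI[of "\<lambda>j. beta b0 b1 b2 (label_index P W j)"])
  obtain k where k: "peaks n (state k \<omega>) = P" "valleys n (state k \<omega>) = W"
    using labels by (auto simp: eventually_sequentially)
  show "map (\<lambda>j. beta b0 b1 b2 (label_index P W j)) [1..<Suc n] \<in> E2 b0 b1 b2 n"
  proof (rule label_index_in_E2)
    show "1 \<notin> W" "n \<notin> W" unfolding k[symmetric] by (auto simp: mem_valleys_iff)
    show "j + 1 \<notin> P" if "j \<in> P" for j using that peaks_not_adjacent unfolding k[symmetric] by blast
    show "j + 1 \<notin> W" if "j \<in> W" for j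
      using that valleys_not_adjacent unfolding k[symmetric] by blast
  qed (use two in blast)
  fix j assume j: "j \<in> {1..n}"
  show "has_speed \<omega> j (beta b0 b1 b2 (label_index P W j))"
    by (rule has_speed_if_labels_determine_V[OF typical j labels]) (use j two V_eq_label_index[of j] in auto)
qed

lemma has_speed_peak_speed:
  assumes typical: "typical \<omega>" and "b1 \<le> b2" and P: "\<forall>\<^sub>F k in sequentially. peaks n (state k \<omega>) = P"
    and possible: "\<not> peaks_impossible P" and j: "j \<in> {1..n}"
  shows "has_speed \<omega> j (peak_speed P j)"
proof -
  have near: "j \<in> P \<or> j + 1 \<in> P \<or> j + 2 \<in> P" if "1 \<le> j" "j + 2 \<le> n" for j
    using possible that by (auto simp: peaks_impossible_def three_consecutive_unlabelled_def)
  have edges: "1 \<in> P \<or> 2 \<in> P" "n \<in> P \<or> n - 1 \<in> P"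
    using possible by (auto simp: peaks_impossible_def)
  note pair = has_speed_pair_between_peaks[OF typical assms(2) P]
  note single = has_speed_if_labels_determine_V[OF typical _ P]
  consider "j \<in> P" | "j \<notin> P" "j = 1" | "j \<notin> P" "j = n" | "j \<notin> P" "1 < j" "j < n" "j - 1 \<in> P" "j + 1 \<in> P"
    | "j \<notin> P" "1 < j" "j < n" "j + 1 \<notin> P" | "j \<notin> P" "1 < j" "j < n" "j - 1 \<notin> P"
    using j by fastforce
  then show ?thesis
  proof cases
    case 1
    then show ?thesis using single[of j 0] j Vn_eq_0_if_peak by (simp add: peak_speed_def beta_def)
  next
    case 2
    then show ?thesis
      using single[of j 1] j V_eq_1_at_left_edge edges by (simp add: peak_speed_def beta_def)
  next
    case 3
    then show ?thesis
      using single[of j 1] j V_eq_1_at_right_edge edges by (simp add: peak_speed_def beta_def)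
  next
    case 4
    then show ?thesis
      using single[of j 2] j V_eq_2_between_peaks by (simp add: peak_speed_def beta_def)
  next
    case 5
    then have "j + 1 < n" using edges by (cases "j + 1 = n") auto
    then show ?thesis
      using pair(1)[of j] near[of "j - 1"] near[of j] 5 by (auto simp: peak_speed_def)
  next
    case 6
    then have "j \<noteq> 2" using edges by auto
    then obtain i where i: "j = i + 1" "1 < i" using 6 by (cases j) auto
    then have "i - 1 \<in> P" "i + 2 \<in> P" using near[of "i - 1"] near[of i] 6 by auto
    then show ?thesis using pair(2)[of i] 6 i by (auto simp: peak_speed_def)
  qed
qed

lemma limit_in_E3_if_peaks_constant:
  assumes typical: "typical \<omega>" and "b1 \<le> b2" and P: "\<forall>\<^sub>F k in sequentially. peaks n (state k \<omega>) = P"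
    and possible: "\<not> peaks_impossible P"
  shows "limit_in \<omega> (E3 b0 b1 b2 n)"
proof (rule limit_inI[of "peak_speed P"])
  obtain k where k: "peaks n (state k \<omega>) = P" using P by (auto simp: eventually_sequentially)
  have adjacent: "j + 1 \<notin> P" if "j \<in> P" for j
    using that peaks_not_adjacent unfolding k[symmetric] by blast
  show "map (peak_speed P) [1..<Suc n] \<in> E3 b0 b1 b2 n"
    using adjacent possible by (rule peak_speed_in_E3)
qed (use has_speed_peak_speed assms in blast)

subsubsection \<open>Convergence\<close>

lemma AE_eventually_constant_labels:
  assumes "\<And>y. F y \<subseteq> {1..n}" "\<And>j. persistent {y. j \<in> F y}"
  shows "AE \<omega> in M. \<exists>S. \<forall>\<^sub>F k in sequentially. F (state k \<omega>) = S"
proof -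
  have "AE \<omega> in M. \<forall>j\<in>{1..n}. (\<forall>\<^sub>F k in sequentially. j \<in> F (state k \<omega>))
      \<or> (\<forall>\<^sub>F k in sequentially. j \<notin> F (state k \<omega>))"
    using AE_eventually_constant[OF assms(2)] by (intro AE_finite_allI) simp_all
  then show ?thesis
  proof eventually_elim
    case (elim \<omega>)
    then show ?case
      using eventually_constant_set[of "{1..n}" "\<lambda>k. F (state k \<omega>)"] assms(1)
      by (metis finite_atLeastAtMost)
  qed
qed

lemma AE_eventual_value_not_surely_left:
  assumes "finite R" "\<And>y. F y \<in> R" and bad: "\<And>S. bad S \<Longrightarrow> surely_left {y. F y = S}"
  shows "AE \<omega> in M. \<forall>S. (\<forall>\<^sub>F k in sequentially. F (state k \<omega>) = S) \<longrightarrow> \<not> bad S"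
proof -
  have "AE \<omega> in M. \<forall>S\<in>R. (\<forall>\<^sub>F k in sequentially. F (state k \<omega>) = S) \<longrightarrow> \<not> bad S"
  proof (rule AE_finite_allI[OF assms(1)])
    fix S
    show "AE \<omega> in M. (\<forall>\<^sub>F k in sequentially. F (state k \<omega>) = S) \<longrightarrow> \<not> bad S"
      using AE_not_eventually_in[OF bad, of S] by (cases "bad S") simp_all
  qed
  then show ?thesis
  proof eventually_elim
    case (elim \<omega>)
    have "S \<in> R" if "\<forall>\<^sub>F k in sequentially. F (state k \<omega>) = S" for S
      using eventually_happens[OF that] assms(2) by auto
    then show ?case using elim by blast
  qed
qed

lemma valleys_subset: "valleys n y \<subseteq> {1..n}" and peaks_subset: "peaks n y \<subseteq> {1..n}"
  by (auto simp: mem_valleys_iff mem_peaks_iff)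

lemma AE_limit_in_E1:
  assumes "b2 < b0" "b0 \<le> b1"
  shows "AE \<omega> in M. limit_in \<omega> (E1 b0 b1 b2 n)"
proof -
  have "AE \<omega> in M. \<forall>W. (\<forall>\<^sub>F k in sequentially. valleys n (state k \<omega>) = W)
      \<longrightarrow> \<not> three_consecutive_unlabelled n W"
    by (rule AE_eventual_value_not_surely_left[of "Pow {1..n}"])
      (use valleys_subset surely_left_three_without_valley assms in auto)
  moreover have "AE \<omega> in M. \<exists>W. \<forall>\<^sub>F k in sequentially. valleys n (state k \<omega>) = W"
    by (intro AE_eventually_constant_labels valleys_subset valleys_persistent) (use assms in auto)
  ultimately show ?thesis using AE_typical
    by eventually_elim (use limit_in_E1_if_valleys_constant assms in blast)
qed

lemma AE_limit_in_E2:
  assumes "b2 < b1" "b1 < b0"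
  shows "AE \<omega> in M. limit_in \<omega> (E2 b0 b1 b2 n)"
proof -
  define bad where "bad = (\<lambda>(P, W). \<exists>j\<ge>1. j + 1 \<le> n \<and> j \<notin> P \<union> W \<and> j + 1 \<notin> P \<union> W)"
  have "surely_left {y. (peaks n y, valleys n y) = S}" if "bad S" for S
  proof -
    obtain P W where S: "S = (P, W)" by fastforce
    have "{y. (peaks n y, valleys n y) = S} = peaks_at P \<inter> valleys_at W" by (auto simp: S)
    then show ?thesis using that surely_left_adjacent_unlabelled by (auto simp: S bad_def)
  qed
  then have "AE \<omega> in M. \<forall>S. (\<forall>\<^sub>F k in sequentially. (peaks n (state k \<omega>), valleys n (state k \<omega>)) = S)
      \<longrightarrow> \<not> bad S"
    by (intro AE_eventual_value_not_surely_left[of "Pow {1..n} \<times> Pow {1..n}"])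
      (use valleys_subset peaks_subset in auto)
  moreover have "AE \<omega> in M. \<exists>P. \<forall>\<^sub>F k in sequentially. peaks n (state k \<omega>) = P"
    by (intro AE_eventually_constant_labels peaks_subset peaks_persistent) (use assms in auto)
  moreover have "AE \<omega> in M. \<exists>W. \<forall>\<^sub>F k in sequentially. valleys n (state k \<omega>) = W"
    by (intro AE_eventually_constant_labels valleys_subset valleys_persistent) (use assms in auto)
  ultimately show ?thesis using AE_typical
  proof eventually_elim
    case (elim \<omega>)
    then obtain P W where "\<forall>\<^sub>F k in sequentially. peaks n (state k \<omega>) = P"
      "\<forall>\<^sub>F k in sequentially. valleys n (state k \<omega>) = W" by blast
    then have labels: "\<forall>\<^sub>F k in sequentially. (peaks n (state k \<omega>), valleys n (state k \<omega>)) = (P, W)"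
      by eventually_elim simp
    then have "\<not> bad (P, W)" using elim(1) by blast
    then show ?case
      by (intro limit_in_E2_if_labels_constant[OF elim(4) labels]) (auto simp: bad_def)
  qed
qed

lemma AE_limit_in_E3:
  assumes "b1 \<le> b2" "b2 < b0"
  shows "AE \<omega> in M. limit_in \<omega> (E3 b0 b1 b2 n)"
proof -
  have "AE \<omega> in M. \<forall>P. (\<forall>\<^sub>F k in sequentially. peaks n (state k \<omega>) = P) \<longrightarrow> \<not> peaks_impossible P"
    by (rule AE_eventual_value_not_surely_left[of "Pow {1..n}"])
      (use peaks_subset surely_left_if_peaks_impossible assms in auto)
  moreover have "AE \<omega> in M. \<exists>P. \<forall>\<^sub>F k in sequentially. peaks n (state k \<omega>) = P"
    by (intro AE_eventually_constant_labels peaks_subset peaks_persistent) (use assms in auto)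
  ultimately show ?thesis using AE_typical
    by eventually_elim (use limit_in_E3_if_peaks_constant assms in blast)
qed

end

theorem theorem5:
  fixes M :: "'a measure" and E U :: "nat \<Rightarrow> 'a \<Rightarrow> real"
    and b0 b1 b2 :: real and n :: nat and x :: "nat \<Rightarrow> nat"
  assumes "prob_space M"
    and "0 < b0" "0 < b1" "0 < b2" and "2 \<le> n"
    and "\<And>k. distributed M lborel (E k) (exponential_density 1)"
    and "\<And>k. U k \<in> borel_measurable M"
    and "\<And>k. distr M lborel (U k) = uniform_measure lborel {0..1}"
    and "prob_space.indep_vars M (\<lambda>_. borel)
           (\<lambda>i. case i of Inl k \<Rightarrow> E k | Inr k \<Rightarrow> U k) UNIV"
  shows "(b2 < b0 \<and> b0 \<le> b1 \<longrightarrow>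
           (AE \<omega> in M. converges_into b0 b1 b2 n x (\<lambda>k. E k \<omega>) (\<lambda>k. U k \<omega>) (E1 b0 b1 b2 n)))
       \<and> (b2 < b1 \<and> b1 < b0 \<longrightarrow>
           (AE \<omega> in M. converges_into b0 b1 b2 n x (\<lambda>k. E k \<omega>) (\<lambda>k. U k \<omega>) (E2 b0 b1 b2 n)))
       \<and> (b1 \<le> b2 \<and> b2 < b0 \<longrightarrow>
           (AE \<omega> in M. converges_into b0 b1 b2 n x (\<lambda>k. E k \<omega>) (\<lambda>k. U k \<omega>) (E3 b0 b1 b2 n)))"
proof -
  interpret prob_space M by (rule assms(1))
  interpret crystal_process b0 b1 b2 n M E U x
    using assms by unfold_locales auto
  show ?thesis using AE_limit_in_E1 AE_limit_in_E2 AE_limit_in_E3 by blast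
qed

end
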